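(* Let $\mathbf Z_N^{(1)},\ldots,\mathbf Z_N^{(p)}$ be families of random $N\times N$ matrices such that: (1) $\mathbf Z_N^{(1)},\ldots,\mathbf Z_N^{(p)}$ are independent; (2) for every $j\in\{1,\ldots,p\}$, except possibly one, $\mathbf Z_N^{(j)}$ is permutation invariant, i.e. for every permutation matrix $U_N$ the family $U_N\mathbf Z_N^{(j)}U_N^*$ (all matrices of the family conjugated by the same $U_N$) has the same law as $\mathbf Z_N^{(j)}$; (3) for every $j$, $\mathbf Z_N^{(j)}$ satisfies Assumptions 1, 2 and 3 (stated in the context). Then the joint family $(\mathbf Z_N^{(1)},\ldots,\mathbf Z_N^{(p)})$ has a limiting distribution of traffics on cyclic $^*$-test graphs, which is the traffic-free product of the limiting distributions of $\mathbf Z_N^{(1)},\ldots,\mathbf Z_N^{(p)}$ on cyclic $^*$-test graphs; that is, for every cyclic $^*$-test graph $T$ in the joint variables $(\mathbf z_1,\ldots,\mathbf z_p)$, the limit $\tau^0[T]=\lim_N\mathbb E[\tau_N^0[T(\mathbf Z_N^{(1)},\ldots,\mathbf Z_N^{(p)})]]$ exists, equals $\prod_{\tilde T}\tau^0[\tilde T]$ (product over the connected components $\tilde T$ of $T$ labelled by variables in a same family) if $T$ is a free product in $\mathbf z_1,\ldots,\mathbf z_p$, and equals $0$ otherwise. In particular, the joint family has a limiting $^*$-distribution, which depends only on the limiting distributions of traffics of $\mathbf Z_N^{(1)},\ldots,\mathbf Z_N^{(p)}$ separately.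
   Context: All random matrices have complex entries with finite moments of all orders. The limiting $^*$-distribution of a family $\mathbf A_N$ is the map $P\mapsto\lim_N\mathbb E[\frac1N\mathrm{Tr}[P(\mathbf A_N)]]$ on non commutative $^*$-polynomials (when the limits exist). Test graphs. A $^*$-test graph in variables $\mathbf y=(y_1,\ldots,y_q)$ is a finite connected oriented graph $T=(V,E)$ (multiple edges and loops allowed), each edge $e$ carrying a label $y_{\gamma(e)}^{\varepsilon(e)}$ with $\gamma(e)\in\{1,\ldots,q\}$, $\varepsilon(e)\in\{1,*\}$. It is cyclic if there is a closed walk traversing each edge exactly once in the sense of its orientation. For a family $\mathbf Y_N$ of $N\times N$ matrices, $$\tau_N[T(\mathbf Y_N)]=\frac1N\sum_{\phi:V\to\{1,\ldots,N\}}\prod_{e\in E}Y_{\gamma(e)}^{\varepsilon(e)}(\phi(e)),\qquad \phi(e)=(\phi(v),\phi(w))\text{ for }e=(v,w),$$ and $\tau^0_N[T(\mathbf Y_N)]$ is the same sum restricted to injective $\phi$. Number of leaves $\mathfrak r(T)$. A cutting edge of $T$ is an edge whose removal disconnects $T$. The two-edge connected components of $T$ are its maximal connected subgraphs without cutting edges. The tree $\mathfrak T(T)$ has these components as vertices, two of them being linked by an edge if a cutting edge of $T$ joins them. $\mathfrak r(T)$ is the number of leaves (vertices of degree one) of $\mathfrak T(T)$, with $\mathfrak r(T)=2$ by convention if $\mathfrak T(T)$ has a single vertex. Assumption 1 (convergence): $\lim_N\mathbb E[\tau_N^0[T(\mathbf Y_N)]]$ exists for every cyclic $^*$-test graph $T$.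 (Equivalently with $\tau_N$; the limits form the limiting distribution of traffics of $\mathbf Y_N$ on cyclic $^*$-test graphs.) Assumption 2 (concentration): for all cyclic $^*$-test graphs $T_1,\ldots,T_n$, $\mathbb E[\prod_{i=1}^n\tau_N^0[T_i(\mathbf Y_N)]]-\prod_{i=1}^n\mathbb E[\tau_N^0[T_i(\mathbf Y_N)]]\to0$. Assumption 3 (tightness): for all (not necessarily cyclic) $^*$-test graphs $T_1,\ldots,T_n$, $\mathbb E[\prod_{i=1}^n\tau_N^0[T_i(\mathbf Y_N)]]=O\big(N^{\sum_{i=1}^n(\mathfrak r(T_i)/2-1)}\big)$. Free products of test graphs. Let $\mathbf z_1,\ldots,\mathbf z_p$ be families of variables and $T$ a $^*$-test graph in $(\mathbf z_1,\ldots,\mathbf z_p)$. The connected components of $T$ labelled by variables in a same family are the connected components $T_1,\ldots,T_K$ of the subgraphs formed, for each $i$, by the edges labelled in $\mathbf z_i$ and their endpoints. Let $G_{red}(T)$ be the undirected graph whose vertices are $T_1,\ldots,T_K$ together with the vertices $v_1,\ldots,v_L$ of $T$ belonging to at least two of the $T_i$, with an edge between $T_i$ and $v_j$ iff $v_j$ is a vertex of $T_i$. $T$ is a free product in $\mathbf z_1,\ldots,\mathbf z_p$ if $G_{red}(T)$ is a tree. (The graph with one vertex and no edge is counted as a free product, with $\tau^0=1$.) *)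

theory Defs
  imports
    "HOL-Probability.Probability"
    "HOL-Combinatorics.Permutations"
    "HOL-Library.Poly_Mapping"
    "Jordan_Normal_Form.Schur_Decomposition"
    "Graph_Theory.Digraph_Component"
    "Graph_Theory.Euler"
begin

text \<open>Unqualified, \<open>connected\<close> is graph-theoretic here: \<^const>\<open>Digraph_Component.connected\<close>,
  connectedness of the underlying undirected graph, which must have at least one vertex.\<close>

section \<open>Test graphs\<close>

text \<open>A letter \<open>(i, False)\<close> stands for the variable \<open>i\<close>, a letter \<open>(i, True)\<close> for its adjoint.
  Every finite multigraph has an isomorphic copy with vertices and arcs in \<^typ>\<open>nat\<close>. The value of
  \<open>label\<close> outside of the arcs is irrelevant.\<close>

type_synonym 'i letter = "'i \<times> bool"

record 'i test_graph =
  graph :: "(nat, nat) pre_digraph"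
  label :: "nat \<Rightarrow> 'i letter"

definition test_graph :: "'i set \<Rightarrow> 'i test_graph \<Rightarrow> bool" where
  "test_graph I T \<longleftrightarrow> fin_digraph (graph T) \<and> connected (graph T) \<and>
     (\<forall>e\<in>arcs (graph T). fst (label T e) \<in> I)"

definition cyclic_test_graph :: "'i set \<Rightarrow> 'i test_graph \<Rightarrow> bool" where
  "cyclic_test_graph I T \<longleftrightarrow> test_graph I T \<and>
     (\<exists>u p. pre_digraph.euler_trail (graph T) u p u)"

definition letter_mat :: "('i \<Rightarrow> complex mat) \<Rightarrow> 'i letter \<Rightarrow> complex mat" where
  "letter_mat A l = (if snd l then mat_adjoint (A (fst l)) else A (fst l))"

definition tau0 :: "nat \<Rightarrow> ('i \<Rightarrow> complex mat) \<Rightarrow> 'i test_graph \<Rightarrow> complex" where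
  "tau0 N A T = (1 / of_nat N) *
     (\<Sum>\<phi> | \<phi> \<in> verts (graph T) \<rightarrow>\<^sub>E {..<N} \<and> inj_on \<phi> (verts (graph T)).
        \<Prod>e\<in>arcs (graph T).
          letter_mat A (label T e) $$ (\<phi> (tail (graph T) e), \<phi> (head (graph T) e)))"


section \<open>Number of leaves\<close>

definition cutting_edge :: "('a, 'b) pre_digraph \<Rightarrow> 'b \<Rightarrow> bool" where
  "cutting_edge G e \<longleftrightarrow> e \<in> arcs G \<and> \<not> connected (pre_digraph.del_arc G e)"

definition two_edge_components :: "('a, 'b) pre_digraph \<Rightarrow> ('a, 'b) pre_digraph set" where
  "two_edge_components G =
     {C. pre_digraph.max_subgraph G (\<lambda>H. connected H \<and> (\<forall>e. \<not> cutting_edge H e)) C}"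

text \<open>An undirected graph is encoded as a symmetric digraph, so that the degree of a vertex is its
  out-degree.\<close>

definition component_tree ::
    "('a, 'b) pre_digraph \<Rightarrow> (('a, 'b) pre_digraph) pair_pre_digraph" where
  "component_tree G =
     \<lparr> pverts = two_edge_components G,
       parcs = {(C, D). C \<in> two_edge_components G \<and> D \<in> two_edge_components G \<and> C \<noteq> D \<and>
         (\<exists>e. cutting_edge G e \<and>
            (tail G e \<in> verts C \<and> head G e \<in> verts D \<or>
             tail G e \<in> verts D \<and> head G e \<in> verts C))} \<rparr>"

definition leaves :: "('a, 'b) pre_digraph \<Rightarrow> nat" where
  "leaves G =
     (if card (pverts (component_tree G)) = 1 then 2
      else card {C \<in> pverts (component_tree G).
                   out_degree (with_proj (component_tree G)) C = 1})"


section \<open>Free products of test graphs\<close>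

text \<open>The variables of several families are indexed by pairs \<open>(j, k)\<close>: the \<open>k\<close>-th variable of
  the \<open>j\<close>-th family.\<close>

definition family_subgraph :: "nat \<Rightarrow> (nat \<times> 'i) test_graph \<Rightarrow> (nat, nat) pre_digraph" where
  "family_subgraph j T =
     (let G = graph T; E = {e \<in> arcs G. fst (fst (label T e)) = j}
      in \<lparr> verts = tail G ` E \<union> head G ` E, arcs = E, tail = tail G, head = head G \<rparr>)"

definition family_components ::
    "nat \<Rightarrow> (nat \<times> 'i) test_graph \<Rightarrow> (nat, nat) pre_digraph set" where
  "family_components j T = {C. pre_digraph.max_subgraph (family_subgraph j T) connected C}"

text \<open>A component with labels in a single family, as a test graph in the variables of that
  family.\<close>

definition component_test_graph ::
    "(nat \<times> 'i) test_graph \<Rightarrow> (nat, nat) pre_digraph \<Rightarrow> 'i test_graph" where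
  "component_test_graph T C =
     \<lparr> graph = C, label = (\<lambda>e. (snd (fst (label T e)), snd (label T e))) \<rparr>"

text \<open>The bipartite graph of components and shared vertices, each undirected edge being
  represented by one arc from the component to the vertex.\<close>

definition reduced_graph ::
    "nat \<Rightarrow> (nat \<times> 'i) test_graph \<Rightarrow> ((nat, nat) pre_digraph + nat) pair_pre_digraph" where
  "reduced_graph p T =
     (let K = (\<Union>j<p. family_components j T);
          L = {v. \<exists>C\<in>K. \<exists>D\<in>K. C \<noteq> D \<and> v \<in> verts C \<and> v \<in> verts D}
      in \<lparr> pverts = Inl ` K \<union> Inr ` L,
           parcs = {(Inl C, Inr v) | C v. C \<in> K \<and> v \<in> L \<and> v \<in> verts C} \<rparr>)"

text \<open>The predicate \<^const>\<open>Digraph_Component.tree\<close> only excludes directed cycles. Undirected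
  cycles are cycles of the symmetrised graph of length at least three, as a walk along an edge
  and back is a cycle of length two there; this is adequate for graphs without loops and
  multiple edges.\<close>

definition undirected_tree :: "'a pair_pre_digraph \<Rightarrow> bool" where
  "undirected_tree G \<longleftrightarrow> connected (with_proj G) \<and>
     \<not> (\<exists>c. pre_digraph.cycle (with_proj (mk_symmetric (with_proj G))) c \<and> length c \<ge> 3)"

text \<open>Without arcs, the reduced graph has no vertex; by convention the one-vertex test graph is a
  free product.\<close>

definition free_product :: "nat \<Rightarrow> (nat \<times> 'i) test_graph \<Rightarrow> bool" where
  "free_product p T \<longleftrightarrow> arcs (graph T) = {} \<or> undirected_tree (reduced_graph p T)"


section \<open>Families of random matrices\<close>

text \<open>A family of random matrices is a function \<open>A\<close> such that \<open>A N \<omega> i\<close> is the value at \<open>\<omega>\<close> of the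
  \<open>i\<close>-th matrix of size \<open>N\<close>; the sample space \<open>M N\<close> may depend on \<open>N\<close>.\<close>

type_synonym ('w, 'i) matrix_family = "nat \<Rightarrow> 'w \<Rightarrow> 'i \<Rightarrow> complex mat"

definition random_matrices ::
    "'i set \<Rightarrow> (nat \<Rightarrow> 'w measure) \<Rightarrow> ('w, 'i) matrix_family \<Rightarrow> bool" where
  "random_matrices I M A \<longleftrightarrow>
     (\<forall>N. \<forall>i\<in>I. (\<forall>\<omega>\<in>space (M N). A N \<omega> i \<in> carrier_mat N N) \<and>
        (\<forall>a<N. \<forall>b<N. (\<lambda>\<omega>. A N \<omega> i $$ (a, b)) \<in> borel_measurable (M N) \<and>
           (\<forall>m::nat. integrable (M N) (\<lambda>\<omega>. cmod (A N \<omega> i $$ (a, b)) ^ m))))"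

definition entry_space :: "'i set \<Rightarrow> nat \<Rightarrow> ('i \<times> nat \<times> nat \<Rightarrow> complex) measure" where
  "entry_space I N = PiM (I \<times> {..<N} \<times> {..<N}) (\<lambda>_. borel)"

definition entries ::
    "'i set \<Rightarrow> nat \<Rightarrow> ('i \<Rightarrow> complex mat) \<Rightarrow> ('i \<times> nat \<times> nat \<Rightarrow> complex)" where
  "entries I N A = (\<lambda>(i, a, b)\<in>I \<times> {..<N} \<times> {..<N}. A i $$ (a, b))"

definition permutation_mat :: "nat \<Rightarrow> (nat \<Rightarrow> nat) \<Rightarrow> complex mat" where
  "permutation_mat N \<pi> = mat N N (\<lambda>(a, b). if a = \<pi> b then 1 else 0)"

definition permutation_invariant ::
    "'i set \<Rightarrow> (nat \<Rightarrow> 'w measure) \<Rightarrow> ('w, 'i) matrix_family \<Rightarrow> bool" where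
  "permutation_invariant I M A \<longleftrightarrow>
     (\<forall>N \<pi>. \<pi> permutes {..<N} \<longrightarrow>
        (let U = permutation_mat N \<pi>
         in distr (M N) (entry_space I N)
              (\<lambda>\<omega>. entries I N (\<lambda>i. U * A N \<omega> i * mat_adjoint U)) =
            distr (M N) (entry_space I N) (\<lambda>\<omega>. entries I N (A N \<omega>))))"

definition traffic_limit ::
    "'i set \<Rightarrow> (nat \<Rightarrow> 'w measure) \<Rightarrow> ('w, 'i) matrix_family \<Rightarrow> ('i test_graph \<Rightarrow> complex) \<Rightarrow> bool"
  where
  "traffic_limit I M A \<tau> \<longleftrightarrow>
     (\<forall>T. cyclic_test_graph I T \<longrightarrow>
        (\<lambda>N. \<integral>\<omega>. tau0 N (A N \<omega>) T \<partial>M N) \<longlonglongrightarrow> \<tau> T)"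

definition concentration ::
    "'i set \<Rightarrow> (nat \<Rightarrow> 'w measure) \<Rightarrow> ('w, 'i) matrix_family \<Rightarrow> bool" where
  "concentration I M A \<longleftrightarrow>
     (\<forall>Ts. (\<forall>T\<in>set Ts. cyclic_test_graph I T) \<longrightarrow>
        (\<lambda>N. (\<integral>\<omega>. (\<Prod>T\<leftarrow>Ts. tau0 N (A N \<omega>) T) \<partial>M N)
              - (\<Prod>T\<leftarrow>Ts. \<integral>\<omega>. tau0 N (A N \<omega>) T \<partial>M N)) \<longlonglongrightarrow> 0)"

definition tightness ::
    "'i set \<Rightarrow> (nat \<Rightarrow> 'w measure) \<Rightarrow> ('w, 'i) matrix_family \<Rightarrow> bool" where
  "tightness I M A \<longleftrightarrow>
     (\<forall>Ts. (\<forall>T\<in>set Ts. test_graph I T) \<longrightarrow>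
        (\<lambda>N. cmod (\<integral>\<omega>. (\<Prod>T\<leftarrow>Ts. tau0 N (A N \<omega>) T) \<partial>M N))
          \<in> O(\<lambda>N. real N powr (\<Sum>T\<leftarrow>Ts. real (leaves (graph T)) / 2 - 1)))"

text \<open>The hypotheses on \<open>p\<close> families, the \<open>j\<close>-th one consisting of the \<open>q j\<close> matrices
  \<open>Z j N \<omega> k\<close>, \<open>k < q j\<close>, and having the limiting distribution of traffics \<open>\<tau> j\<close> on cyclic test
  graphs.\<close>

definition independent_traffic_families ::
    "nat \<Rightarrow> (nat \<Rightarrow> nat) \<Rightarrow> (nat \<Rightarrow> 'w measure) \<Rightarrow> (nat \<Rightarrow> ('w, nat) matrix_family) \<Rightarrow>
     (nat \<Rightarrow> nat test_graph \<Rightarrow> complex) \<Rightarrow> bool" where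
  "independent_traffic_families p q M Z \<tau> \<longleftrightarrow>
     (\<forall>N. prob_space (M N)) \<and>
     (\<forall>j<p. random_matrices {..<q j} M (Z j)) \<and>
     (\<forall>N. prob_space.indep_vars (M N) (\<lambda>j. entry_space {..<q j} N)
            (\<lambda>j \<omega>. entries {..<q j} N (Z j N \<omega>)) {..<p}) \<and>
     (\<exists>j\<^sub>0. \<forall>j<p. j \<noteq> j\<^sub>0 \<longrightarrow> permutation_invariant {..<q j} M (Z j)) \<and>
     (\<forall>j<p. traffic_limit {..<q j} M (Z j) (\<tau> j)) \<and>
     (\<forall>j<p. concentration {..<q j} M (Z j)) \<and>
     (\<forall>j<p. tightness {..<q j} M (Z j))"

definition joint_index :: "nat \<Rightarrow> (nat \<Rightarrow> nat) \<Rightarrow> (nat \<times> nat) set" where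
  "joint_index p q = (SIGMA j:{..<p}. {..<q j})"

definition joint_family ::
    "(nat \<Rightarrow> ('w, nat) matrix_family) \<Rightarrow> ('w, nat \<times> nat) matrix_family" where
  "joint_family Z N \<omega> = (\<lambda>(j, k). Z j N \<omega> k)"

text \<open>The limit of the expectation of \<^const>\<open>tau0\<close> prescribed by traffic freeness.\<close>

definition traffic_free_product ::
    "nat \<Rightarrow> (nat \<Rightarrow> 'i test_graph \<Rightarrow> complex) \<Rightarrow> (nat \<times> 'i) test_graph \<Rightarrow> complex" where
  "traffic_free_product p \<tau> T =
     (if free_product p T
      then \<Prod>j<p. \<Prod>C\<in>family_components j T. \<tau> j (component_test_graph T C)
      else 0)"


section \<open>Limiting *-distributions\<close>

text \<open>Non-commutative *-polynomials are finite linear combinations of words in the letters.\<close>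

type_synonym 'i star_polynomial = "'i letter list \<Rightarrow>\<^sub>0 complex"

definition star_polynomials :: "'i set \<Rightarrow> 'i star_polynomial set" where
  "star_polynomials I = {P. Poly_Mapping.keys P \<subseteq> lists (I \<times> UNIV)}"

definition word_mat :: "nat \<Rightarrow> ('i \<Rightarrow> complex mat) \<Rightarrow> 'i letter list \<Rightarrow> complex mat" where
  "word_mat N A w = foldr (\<lambda>l B. letter_mat A l * B) w (1\<^sub>m N)"

definition star_poly_mat ::
    "nat \<Rightarrow> ('i \<Rightarrow> complex mat) \<Rightarrow> 'i star_polynomial \<Rightarrow> complex mat" where
  "star_poly_mat N A P = mat N N (\<lambda>(a, b).
     \<Sum>w\<in>Poly_Mapping.keys P. Poly_Mapping.lookup P w * word_mat N A w $$ (a, b))"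

definition expected_trace ::
    "(nat \<Rightarrow> 'w measure) \<Rightarrow> ('w, 'i) matrix_family \<Rightarrow> 'i star_polynomial \<Rightarrow> nat \<Rightarrow> complex" where
  "expected_trace M A P N =
     (\<integral>\<omega>. (1 / of_nat N) * (\<Sum>a<N. star_poly_mat N (A N \<omega>) P $$ (a, a)) \<partial>M N)"

end

theory Submission
  imports Defs
begin

text \<open>Group the arcs of a cyclic test graph \<open>T\<close> by family. For an injection \<open>\<phi>\<close> of its vertices,
  independence factorises the expected product over the arcs into one factor per family, and the
  factor of a permutation invariant family does not depend on \<open>\<phi>\<close>. As at most one family is not
  invariant, the sum over \<open>\<phi>\<close> factorises exactly, up to falling factorials
  (\<open>expectation_inj_sum_joint\<close>). Hence the expectation of
  \<open>\<tau>\<^sup>0(T)\<close> has the order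
  \<open>N ^ (|V| - 1 - \<Sum>\<^sub>j |V\<^sub>j|) * \<Prod>\<^sub>j E\<^sub>j\<close>, where \<open>V\<^sub>j\<close> are the vertices touched by family \<open>j\<close> and
  \<open>E\<^sub>j\<close> is the expected injective sum over the subgraph of family \<open>j\<close>, which is disconnected in
  general.

  An injective sum over a disconnected graph is the product of the sums over its components, minus
  the sums over all nontrivial glueings of the components (\<open>prod_inj_sum_components\<close>). A glueing has
  fewer components, and the total of their numbers \<open>r\<close> of leaves does not increase under it
  (\<open>sum_leaves_quotient_le\<close>). So tightness gives \<open>E\<^sub>j = O(N ^ (\<Sum> r/2))\<close>, summed over the components
  of family \<open>j\<close> (\<open>inj_sum_bound\<close>); if these components are cyclic, then \<open>r = 2\<close> for each, the
  glueings are negligible, and concentration gives the limit of \<open>E\<^sub>j\<close>, normalised by one factor \<open>N\<close>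
  per component, as the product of the limits over the components (\<open>inj_sum_limit\<close>).

  It remains to compare exponents (\<open>block_exponent\<close>). Let \<open>T\<^sub>1, \<dots>, T\<^sub>K\<close> be the components of all
  families. A component that meets the others in one vertex is balanced, because \<open>T\<close> is, so that
  \<open>r = 2\<close>, and deleting it does not change the exponent \<open>|V| - 1 - \<Sum> |V(T\<^sub>i)| + \<Sum> r(T\<^sub>i)/2\<close>. If
  the deletions end with a single component, then the reduced graph is a tree, all \<open>T\<^sub>i\<close> are cyclic
  and the exponent is \<open>0\<close>. Otherwise they end with components that all have at least two shared
  vertices. Every leaf of \<open>T\<^sub>i\<close> contains a shared vertex, as its boundary in the balanced graph \<open>T\<close>
  cannot be a single arc; so \<open>r(T\<^sub>i)\<close> is at most the number of shared vertices of \<open>T\<^sub>i\<close>, and counting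
  incidences shows that the exponent is at most \<open>-1\<close>: the limit vanishes.

  Leaves enter only through cuts: apart from the convention for graphs without cutting edges, the
  number of leaves is the largest number of disjoint vertex sets with a single boundary arc
  (\<open>disjoint_cuts_card_le_leaves\<close>, \<open>leaves_attained\<close>). Finally, the trace of a word is the full sum
  over a directed cycle, that is, a sum of \<open>\<tau>\<^sup>0\<close> over the quotients of the cycle, which are cyclic test
  graphs; this gives the limiting *-distribution.\<close>

section \<open>Edge cuts of digraphs\<close>

definition boundary :: "('a, 'b) pre_digraph \<Rightarrow> 'a set \<Rightarrow> 'b set" where
  "boundary G S = {e \<in> arcs G. (tail G e \<in> S) \<noteq> (head G e \<in> S)}"

lemma boundary_Diff_verts:
  assumes "wf_digraph G" "S \<subseteq> verts G"
  shows "boundary G (verts G - S) = boundary G S"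
  using assms by (auto simp: boundary_def wf_digraph_def)

text \<open>Connectivity is used through cuts instead of walks: the vertices reachable from a given one
  form a set without boundary.\<close>

lemma connected_iff_boundary:
  assumes "wf_digraph G"
  shows "connected G \<longleftrightarrow> verts G \<noteq> {} \<and>
    (\<forall>S\<subseteq>verts G. S \<noteq> {} \<longrightarrow> boundary G S = {} \<longrightarrow> S = verts G)"
proof -
  interpret wf_digraph G by fact
  define R where "R = (\<Union>e\<in>arcs G. {(tail G e, head G e), (head G e, tail G e)})"
  have conn: "connected G \<longleftrightarrow> verts G \<noteq> {} \<and>
      (\<forall>u\<in>verts G. \<forall>v\<in>verts G. (u, v) \<in> rtrancl_on (verts G) R)"
    by (auto simp: connected_def strongly_connected_def reachable_def mk_symmetric_def R_def
        with_proj_def arcs_ends_conv)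
  have "v \<in> S" if uv: "(u, v) \<in> rtrancl_on (verts G) R" and "u \<in> S" "boundary G S = {}" for u v S
    using uv
  proof (induct rule: rtrancl_on_induct)
    case base
    show ?case by fact
  next
    case (step y z)
    then show ?case using \<open>boundary G S = {}\<close> by (auto simp: R_def boundary_def)
  qed
  then have 1: "S = verts G" if "connected G" "S \<subseteq> verts G" "S \<noteq> {}" "boundary G S = {}" for S
    using that unfolding conn by blast
  have 2: "(u, v) \<in> rtrancl_on (verts G) R" if "u \<in> verts G" "v \<in> verts G"
    and cut: "\<forall>S\<subseteq>verts G. S \<noteq> {} \<longrightarrow> boundary G S = {} \<longrightarrow> S = verts G" for u v
  proof -
    let ?S = "{w. (u, w) \<in> rtrancl_on (verts G) R}"
    have "boundary G ?S = {}"
      by (auto simp: boundary_def R_def intro: rtrancl_on_into_rtrancl_on)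
    moreover have "u \<in> ?S" using that by simp
    moreover have "?S \<subseteq> verts G" by (auto dest: in_rtrancl_on_in_F)
    ultimately have "?S = verts G" using cut by blast
    then show ?thesis using that by blast
  qed
  show ?thesis using 1 2 conn by blast
qed

lemma connectedD_boundary:
  assumes "connected G" "wf_digraph G" "S \<subseteq> verts G" "S \<noteq> {}" "boundary G S = {}"
  shows "S = verts G"
  using assms connected_iff_boundary by blast

text \<open>A set without boundary in the union has no boundary in either part, so it contains all or
  nothing of each; a common vertex makes the two choices agree.\<close>

lemma connected_union:
  assumes C: "connected C" "wf_digraph C" and D: "connected D" "wf_digraph D"
    and comp: "tail C = tail D" "head C = head D"
    and meet: "verts C \<inter> verts D \<noteq> {}"
  shows "connected (union C D)" "wf_digraph (union C D)"
proof -
  show wf: "wf_digraph (union C D)"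
    using C D comp by (auto simp: union_def wf_digraph_def)
  have "S = verts (union C D)"
    if S: "S \<subseteq> verts (union C D)" "S \<noteq> {}" "boundary (union C D) S = {}" for S
  proof -
    have bC: "boundary C (S \<inter> verts C) = {}"
      using S(3) C(2) by (auto simp: boundary_def union_def wf_digraph_def)
    have bD: "boundary D (S \<inter> verts D) = {}"
      using S(3) D(2) comp by (auto simp: boundary_def union_def wf_digraph_def)
    have "S \<inter> verts C = {} \<or> S \<inter> verts C = verts C"
      using connectedD_boundary[OF C _ _ bC] by blast
    moreover have "S \<inter> verts D = {} \<or> S \<inter> verts D = verts D"
      using connectedD_boundary[OF D _ _ bD] by blast
    moreover have "verts (union C D) = verts C \<union> verts D" by (simp add: union_def)
    ultimately show ?thesis using S meet by blast
  qed
  moreover have "verts (union C D) \<noteq> {}"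
    using meet by (auto simp: union_def)
  ultimately show "connected (union C D)"
    using connected_iff_boundary[OF wf] by blast
qed

section \<open>Maximal subgraphs\<close>

lemma max_subgraph_exists:
  assumes fin: "fin_digraph G" and H: "subgraph H G" "P H"
  obtains C where "pre_digraph.max_subgraph G P C" "subgraph H C"
proof -
  interpret fin_digraph G by fact
  define Q where "Q = (\<lambda>C. subgraph H C \<and> subgraph C G \<and> P C)"
  define m where "m = (\<lambda>C::('a, 'b) pre_digraph. card (verts C) + card (arcs C))"
  have bound: "m C \<le> card (verts G) + card (arcs G)" if "subgraph C G" for C
    using that unfolding m_def by (intro add_mono card_mono) (auto simp: subgraph_def)
  have refl: "subgraph H H" using H by (auto simp: subgraph_def compatible_def)
  then have "Q H" using H by (simp add: Q_def)
  then obtain C where C: "Q C" "\<forall>C'. Q C' \<longrightarrow> m C' \<le> m C"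
    using ex_has_greatest_nat[of Q H m "Suc (card (verts G) + card (arcs G))"] bound
    by (auto simp: Q_def less_Suc_eq_le)
  have "\<not> (subgraph H' G \<and> P H')" if "H' \<noteq> C" "subgraph C H'" for H'
  proof
    assume H': "subgraph H' G \<and> P H'"
    have "Q H'" using H' C(1) that(2) by (auto simp: Q_def subgraph_def compatible_def)
    then have "m H' \<le> m C" using C by blast
    have fin': "finite (verts H')" "finite (arcs H')"
      using H' by (auto simp: subgraph_def intro: finite_subset)
    have sub: "verts C \<subseteq> verts H'" "arcs C \<subseteq> arcs H'" and comp: "compatible H' C"
      using that(2) by (auto simp: subgraph_def)
    have "verts C = verts H'" "arcs C = arcs H'"
    proof -
      have a: "card (verts C) \<le> card (verts H')" "card (arcs C) \<le> card (arcs H')"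
        using sub fin' by (auto intro: card_mono)
      then have "card (verts H') \<le> card (verts C)" "card (arcs H') \<le> card (arcs C)"
        using \<open>m H' \<le> m C\<close> unfolding m_def by linarith+
      then show "verts C = verts H'" "arcs C = arcs H'"
        using sub fin' card_seteq by blast+
    qed
    then have "H' = C" using comp by (simp add: compatible_def)
    then show False using that by blast
  qed
  then have "max_subgraph P C" using C(1) by (auto simp: max_subgraph_def Q_def)
  then show thesis using that C(1) by (auto simp: Q_def)
qed

lemma subgraph_union:
  assumes "subgraph C G" "subgraph D G"
  shows "subgraph (union C D) G" "subgraph C (union C D)" "subgraph D (union C D)"
  using assms by (auto simp: subgraph_def union_def compatible_def wf_digraph_def)

text \<open>The union of the two subgraphs has the property too, so by maximality both are equal to it.
  This makes connected components and two-edge connected components partition the vertices.\<close>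

lemma max_subgraph_overlap_eq:
  assumes C: "pre_digraph.max_subgraph G P C" and D: "pre_digraph.max_subgraph G P D"
    and meet: "verts C \<inter> verts D \<noteq> {}"
    and closed: "\<And>C D. subgraph C G \<Longrightarrow> subgraph D G \<Longrightarrow> P C \<Longrightarrow> P D \<Longrightarrow>
      verts C \<inter> verts D \<noteq> {} \<Longrightarrow> P (union C D)"
  shows "C = D"
proof -
  have sub: "subgraph C G" "P C" "subgraph D G" "P D"
    using C D by (auto simp: pre_digraph.max_subgraph_def)
  then have "P (union C D)" using closed meet by blast
  then have "union C D = C" "union C D = D"
    using C D subgraph_union[OF sub(1,3)] unfolding pre_digraph.max_subgraph_def by blast+
  then show ?thesis by simp
qed

lemma subgraph_connected_union:
  assumes "subgraph C G" "subgraph D G" "connected C" "connected D" "verts C \<inter> verts D \<noteq> {}"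
  shows "connected (union C D)"
  using assms by (intro connected_union) (auto simp: subgraph_def compatible_def)

lemma single_vertex_subgraph:
  assumes "wf_digraph G" "v \<in> verts G"
  defines "H \<equiv> \<lparr>verts = {v}, arcs = {}, tail = tail G, head = head G\<rparr>"
  shows "subgraph H G" "connected H" "wf_digraph H"
proof -
  show wf: "wf_digraph H" by (auto simp: H_def wf_digraph_def)
  show "subgraph H G" using assms wf by (auto simp: subgraph_def compatible_def)
  show "connected H" unfolding connected_iff_boundary[OF wf] by (auto simp: H_def)
qed

section \<open>Connected components\<close>

definition components :: "('a, 'b) pre_digraph \<Rightarrow> ('a, 'b) pre_digraph set" where
  "components G = {C. pre_digraph.max_subgraph G connected C}"

lemma components_subgraph:
  "C \<in> components G \<Longrightarrow> subgraph C G" "C \<in> components G \<Longrightarrow> connected C"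
  by (auto simp: components_def pre_digraph.max_subgraph_def)

lemma components_tail_head:
  assumes "C \<in> components G"
  shows "tail C = tail G" "head C = head G"
  using components_subgraph(1)[OF assms] by (auto simp: subgraph_def compatible_def)

lemma components_wf: "C \<in> components G \<Longrightarrow> wf_digraph C"
  using components_subgraph(1) by (auto simp: subgraph_def)

lemma components_fin:
  assumes "fin_digraph G" "C \<in> components G" shows "fin_digraph C"
proof -
  interpret fin_digraph G by fact
  have "subgraph C G" using assms components_subgraph by blast
  then show ?thesis
    by (auto simp: subgraph_def fin_digraph_def fin_digraph_axioms_def intro: finite_subset)
qed

lemma components_overlap_eq:
  assumes "C \<in> components G" "D \<in> components G" "v \<in> verts C" "v \<in> verts D"
  shows "C = D"
proof (rule max_subgraph_overlap_eq)
  show "pre_digraph.max_subgraph G connected C" "pre_digraph.max_subgraph G connected D"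
    using assms by (auto simp: components_def)
  show "verts C \<inter> verts D \<noteq> {}" using assms by blast
qed (rule subgraph_connected_union)

lemma component_of_vertex:
  assumes "fin_digraph G" "v \<in> verts G"
  obtains C where "C \<in> components G" "v \<in> verts C"
proof -
  have wf: "wf_digraph G" using assms fin_digraph_def by blast
  obtain C where "pre_digraph.max_subgraph G connected C"
      "subgraph \<lparr>verts = {v}, arcs = {}, tail = tail G, head = head G\<rparr> C"
    using max_subgraph_exists[where P = connected, OF assms(1) single_vertex_subgraph(1,2)[OF wf assms(2)]] .
  then show thesis using that by (auto simp: components_def subgraph_def)
qed

lemma components_arc_iff:
  assumes "C \<in> components G" "e \<in> arcs G"
  shows "e \<in> arcs C \<longleftrightarrow> tail G e \<in> verts C" "e \<in> arcs C \<longleftrightarrow> head G e \<in> verts C"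
proof -
  have sub: "subgraph C G" "connected C" using assms components_subgraph by auto
  have th: "tail C = tail G" "head C = head G" using components_tail_head assms by auto
  have wf: "wf_digraph G" "wf_digraph C" using sub by (auto simp: subgraph_def)
  have dir1: "tail G e \<in> verts C" "head G e \<in> verts C" if "e \<in> arcs C"
    using that wf th unfolding wf_digraph_def by auto
  have dir2: "e \<in> arcs C" if "tail G e \<in> verts C \<or> head G e \<in> verts C"
  proof -
    \<comment> \<open>A component absorbs the one-arc graph of any arc that it touches.\<close>
    let ?H = "\<lparr>verts = {tail G e, head G e}, arcs = {e}, tail = tail G, head = head G\<rparr>"
    have wfH: "wf_digraph ?H" by (auto simp: wf_digraph_def)
    have subH: "subgraph ?H G"
      using wf assms(2) wfH by (auto simp: subgraph_def compatible_def wf_digraph_def)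
    have "connected ?H"
      unfolding connected_iff_boundary[OF wfH] by (auto simp: boundary_def)
    then have "connected (union C ?H)"
      using subgraph_connected_union[OF sub(1) subH sub(2)] that by auto
    moreover have "subgraph (union C ?H) G" "subgraph C (union C ?H)"
      using subgraph_union[OF sub(1) subH] by auto
    ultimately have "union C ?H = C"
      using assms(1) unfolding components_def pre_digraph.max_subgraph_def by blast
    moreover have "arcs (union C ?H) = insert e (arcs C)" by (simp add: union_def)
    ultimately show ?thesis by (metis insertI1)
  qed
  show "e \<in> arcs C \<longleftrightarrow> tail G e \<in> verts C" "e \<in> arcs C \<longleftrightarrow> head G e \<in> verts C"
    using dir1 dir2 by blast+
qed

lemma components_arcs:
  assumes "C \<in> components G"
  shows "arcs C = {e \<in> arcs G. tail G e \<in> verts C}"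
  using components_arc_iff[OF assms] components_subgraph(1)[OF assms] by (auto simp: subgraph_def)

lemma components_verts_nonempty: "C \<in> components G \<Longrightarrow> verts C \<noteq> {}"
  using components_subgraph(2) by (auto simp: connected_def strongly_connected_def)

lemma components_Union_verts:
  assumes "fin_digraph G" shows "(\<Union>C\<in>components G. verts C) = verts G"
proof
  show "(\<Union>C\<in>components G. verts C) \<subseteq> verts G"
    using components_subgraph(1)[of _ G] by (auto simp: subgraph_def)
  show "verts G \<subseteq> (\<Union>C\<in>components G. verts C)"
  proof
    fix v assume "v \<in> verts G"
    then obtain C where "C \<in> components G" "v \<in> verts C" using component_of_vertex[OF assms] by metis
    then show "v \<in> (\<Union>C\<in>components G. verts C)" by blast
  qed
qed

lemma components_inj_verts: "inj_on verts (components G)"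
  by (rule inj_onI) (metis components_overlap_eq components_verts_nonempty equals0I)

lemma finite_components:
  assumes "fin_digraph G" shows "finite (components G)"
proof -
  interpret fin_digraph G by fact
  have "verts ` components G \<subseteq> Pow (verts G)"
    using components_subgraph(1)[of _ G] by (auto simp: subgraph_def)
  then have "finite (verts ` components G)" by (rule finite_subset) simp
  then show ?thesis using components_inj_verts finite_imageD by blast
qed

lemma components_Union_arcs:
  assumes "fin_digraph G" shows "(\<Union>C\<in>components G. arcs C) = arcs G"
proof -
  interpret fin_digraph G by fact
  show ?thesis
    using components_arcs[of _ G] components_Union_verts[OF assms] tail_in_verts
    by fastforce
qed

lemma components_disjoint_arcs:
  assumes "C \<in> components G" "D \<in> components G" "C \<noteq> D" shows "arcs C \<inter> arcs D = {}"
  using components_overlap_eq[OF assms(1,2)] components_arcs assms by fastforce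

lemma components_boundary: "C \<in> components G \<Longrightarrow> boundary G (verts C) = {}"
  unfolding boundary_def using components_arc_iff[of C G] by blast

section \<open>Cutting edges and the leaves of the component tree\<close>

text \<open>A cutting edge is the only arc between the two sides that its removal separates.\<close>

lemma cutting_edge_iff_boundary:
  assumes "wf_digraph H" "connected H"
  shows "cutting_edge H e \<longleftrightarrow> (\<exists>S\<subseteq>verts H. boundary H S = {e})"
proof -
  interpret wf_digraph H by fact
  have wfd: "wf_digraph (del_arc e)" by blast
  have bd: "boundary (del_arc e) S = boundary H S - {e}" for S
    by (auto simp: boundary_def)
  have bV: "boundary H (verts H) = {}" "boundary H {} = {}" by (auto simp: boundary_def)
  have ne: "boundary H S \<noteq> {}" if "S \<subseteq> verts H" "S \<noteq> {}" "S \<noteq> verts H" for S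
    using connectedD_boundary[OF assms(2,1)] that by blast
  have "verts H \<noteq> {}" using assms connected_iff_boundary by blast
  then have nc: "\<not> connected (del_arc e) \<longleftrightarrow>
      (\<exists>S\<subseteq>verts H. S \<noteq> {} \<and> boundary H S - {e} = {} \<and> S \<noteq> verts H)"
    unfolding connected_iff_boundary[OF wfd] bd by auto
  have "\<exists>S\<subseteq>verts H. boundary H S = {e}" if cut: "cutting_edge H e"
  proof -
    have "\<not> connected (del_arc e)" using cut by (simp add: cutting_edge_def)
    then obtain S where S: "S \<subseteq> verts H" "S \<noteq> {}" "boundary H S - {e} = {}" "S \<noteq> verts H"
      using nc by metis
    have "boundary H S = {e}" using ne[OF S(1,2,4)] S(3) by blast
    then show ?thesis using S(1) by metis
  qed
  moreover have "cutting_edge H e" if ex: "\<exists>S\<subseteq>verts H. boundary H S = {e}"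
  proof -
    obtain S where S: "S \<subseteq> verts H" "boundary H S = {e}" using ex by metis
    have "e \<in> arcs H" using S(2) by (auto simp: boundary_def)
    moreover have "S \<noteq> {}" "S \<noteq> verts H" using bV S(2) by auto
    moreover have "boundary H S - {e} = {}" using S(2) by simp
    ultimately show ?thesis unfolding cutting_edge_def using nc S(1) by metis
  qed
  ultimately show ?thesis by metis
qed

definition bridgeless :: "('a, 'b) pre_digraph \<Rightarrow> bool" where
  "bridgeless H \<longleftrightarrow> connected H \<and> (\<forall>e. \<not> cutting_edge H e)"

text \<open>A cut that meets a bridgeless graph in at most one arc cannot split it, as this arc would be
  a bridge.\<close>

lemma bridgeless_subgraph_one_sided:
  assumes "bridgeless C" "wf_digraph C" "boundary C (S \<inter> verts C) \<subseteq> {e}"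
  shows "verts C \<subseteq> S \<or> verts C \<inter> S = {}"
proof -
  have con: "connected C" using assms by (simp add: bridgeless_def)
  have "boundary C (S \<inter> verts C) \<noteq> {e}"
    using assms cutting_edge_iff_boundary[OF assms(2) con] by (auto simp: bridgeless_def)
  then have "boundary C (S \<inter> verts C) = {}" using assms(3) by blast
  then show ?thesis
    using connectedD_boundary[OF con assms(2), of "S \<inter> verts C"] by blast
qed

lemma boundary_subgraph:
  assumes "subgraph C G"
  shows "boundary C (S \<inter> verts C) = boundary G S \<inter> arcs C"
  using assms by (auto simp: boundary_def subgraph_def compatible_def wf_digraph_def)

lemma bridgeless_union:
  assumes sub: "subgraph C G" "subgraph D G" and br: "bridgeless C" "bridgeless D"
    and meet: "verts C \<inter> verts D \<noteq> {}"
  shows "bridgeless (union C D)"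
proof -
  let ?U = "union C D"
  have con: "connected ?U"
    using subgraph_connected_union[OF sub] br meet by (simp add: bridgeless_def)
  have wf: "wf_digraph ?U" "wf_digraph C" "wf_digraph D"
    using sub subgraph_union[OF sub] by (auto simp: subgraph_def)
  have "\<not> cutting_edge ?U e" for e
  proof
    assume "cutting_edge ?U e"
    then obtain S where S: "S \<subseteq> verts ?U" "boundary ?U S = {e}"
      using cutting_edge_iff_boundary[OF wf(1) con] by blast
    have "verts C \<subseteq> S \<or> verts C \<inter> S = {}"
      using bridgeless_subgraph_one_sided[OF br(1) wf(2)] S(2)
        boundary_subgraph[OF subgraph_union(2)[OF sub]] by blast
    moreover have "verts D \<subseteq> S \<or> verts D \<inter> S = {}"
      using bridgeless_subgraph_one_sided[OF br(2) wf(3)] S(2)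
        boundary_subgraph[OF subgraph_union(3)[OF sub]] by blast
    ultimately have "S = {} \<or> S = verts ?U"
      using meet S(1) by (auto simp: union_def)
    then have "boundary ?U S = {}" using wf(1) by (auto simp: boundary_def wf_digraph_def)
    then show False using S by simp
  qed
  then show ?thesis using con by (simp add: bridgeless_def)
qed

lemma two_edge_components_alt:
  "two_edge_components G = {C. pre_digraph.max_subgraph G bridgeless C}"
  unfolding two_edge_components_def bridgeless_def[abs_def] ..

lemma two_edge_componentD:
  assumes "C \<in> two_edge_components G"
  shows "subgraph C G" "bridgeless C" "wf_digraph C" "verts C \<noteq> {}"
proof -
  show "subgraph C G" "bridgeless C"
    using assms by (auto simp: two_edge_components_alt pre_digraph.max_subgraph_def)
  then show "wf_digraph C" "verts C \<noteq> {}"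
    by (auto simp: subgraph_def bridgeless_def connected_iff_boundary)
qed

lemma two_edge_components_overlap_eq:
  assumes "C \<in> two_edge_components G" "D \<in> two_edge_components G" "v \<in> verts C" "v \<in> verts D"
  shows "C = D"
proof (rule max_subgraph_overlap_eq)
  show "pre_digraph.max_subgraph G bridgeless C" "pre_digraph.max_subgraph G bridgeless D"
    using assms by (auto simp: two_edge_components_alt)
  show "verts C \<inter> verts D \<noteq> {}" using assms by blast
qed (rule bridgeless_union)

lemma two_edge_component_of_vertex:
  assumes "fin_digraph G" "v \<in> verts G"
  shows "\<exists>C\<in>two_edge_components G. v \<in> verts C"
proof -
  have wf: "wf_digraph G" using assms fin_digraph_def by blast
  let ?H = "\<lparr>verts = {v}, arcs = {}, tail = tail G, head = head G\<rparr>"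
  have "bridgeless ?H"
    using single_vertex_subgraph(2)[OF wf assms(2)] by (simp add: bridgeless_def cutting_edge_def)
  then obtain C where "pre_digraph.max_subgraph G bridgeless C" "subgraph ?H C"
    using max_subgraph_exists[where P = bridgeless, OF assms(1) single_vertex_subgraph(1)[OF wf assms(2)]]
    by metis
  then show ?thesis by (auto simp: two_edge_components_alt subgraph_def)
qed

lemma finite_two_edge_components:
  assumes "fin_digraph G" shows "finite (two_edge_components G)"
proof -
  interpret fin_digraph G by fact
  have "verts ` two_edge_components G \<subseteq> Pow (verts G)"
    using two_edge_componentD(1)[of _ G] by (auto simp: subgraph_def)
  then have "finite (verts ` two_edge_components G)" by (rule finite_subset) simp
  moreover have "inj_on verts (two_edge_components G)"
    by (rule inj_onI) (metis two_edge_components_overlap_eq two_edge_componentD(4) equals0I)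
  ultimately show ?thesis using finite_imageD by blast
qed

definition induced :: "('a, 'b) pre_digraph \<Rightarrow> 'a set \<Rightarrow> ('a, 'b) pre_digraph" where
  "induced G S = \<lparr>verts = S, arcs = {a \<in> arcs G. tail G a \<in> S \<and> head G a \<in> S},
     tail = tail G, head = head G\<rparr>"

lemma induced_simps [simp]:
  "verts (induced G S) = S" "tail (induced G S) = tail G" "head (induced G S) = head G"
  "arcs (induced G S) = {a \<in> arcs G. tail G a \<in> S \<and> head G a \<in> S}"
  by (simp_all add: induced_def)

lemma induced_subgraph_of:
  assumes "wf_digraph G" "S \<subseteq> verts G"
  shows "wf_digraph (induced G S)" "subgraph (induced G S) G"
  using assms by (auto simp: wf_digraph_def subgraph_def compatible_def)

lemma subgraph_induced:
  assumes "subgraph H G" "verts H \<subseteq> P" "P \<subseteq> verts G"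
  shows "subgraph H (induced G P)"
  using assms by (auto simp: subgraph_def compatible_def wf_digraph_def)

lemma out_arcs_component_tree:
  "out_arcs (with_proj (component_tree G)) C = (\<lambda>D. (C, D)) `
     {D \<in> two_edge_components G. C \<in> two_edge_components G \<and> C \<noteq> D \<and>
       (\<exists>e. cutting_edge G e \<and>
            (tail G e \<in> verts C \<and> head G e \<in> verts D \<or>
             tail G e \<in> verts D \<and> head G e \<in> verts C))}"
  unfolding out_arcs_def component_tree_def image_def by auto

lemma out_degree_component_tree:
  assumes "C \<in> two_edge_components G"
  shows "out_degree (with_proj (component_tree G)) C = card {D \<in> two_edge_components G. C \<noteq> D \<and>
       (\<exists>e. cutting_edge G e \<and>
            (tail G e \<in> verts C \<and> head G e \<in> verts D \<or>
             tail G e \<in> verts D \<and> head G e \<in> verts C))}"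
  unfolding out_degree_def out_arcs_component_tree
  using assms by (subst card_image) (auto simp: inj_on_def)

lemma boundary_obtain_ends:
  assumes "e \<in> boundary G S"
  obtains w z where "w \<in> S" "z \<notin> S" "e \<in> arcs G" "{tail G e, head G e} = {w, z}"
  using assms by (auto simp: boundary_def)

text \<open>An inclusion-minimal side of a one-arc cut is a leaf: any one-arc cut inside it would
  have a side that avoids the outgoing arc, and that side would be smaller.\<close>

lemma one_arc_cut_contains_leaf:
  assumes fin: "fin_digraph G" and con: "connected G"
    and S: "S \<subseteq> verts G" "card (boundary G S) = 1"
  shows "\<exists>C\<in>two_edge_components G. verts C \<subseteq> S \<and>
    out_degree (with_proj (component_tree G)) C = 1"
proof -
  interpret fin_digraph G by fact
  have wfG: "wf_digraph G" by unfold_locales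
  define Q where "Q A \<longleftrightarrow> A \<subseteq> S \<and> card (boundary G A) = 1" for A
  have "Q S" using S by (simp add: Q_def)
  then obtain A where A: "Q A" and min: "\<And>B. Q B \<Longrightarrow> card A \<le> card B"
    using ex_has_least_nat[of Q S card] by auto
  have AV: "A \<subseteq> verts G" using A S by (auto simp: Q_def)
  have finA: "finite A" using AV by (rule finite_subset) simp
  obtain e where e: "boundary G A = {e}" using A card_1_singletonE by (auto simp: Q_def)
  then obtain w z where wz: "w \<in> A" "z \<notin> A" "e \<in> arcs G" "{tail G e, head G e} = {w, z}"
    using boundary_obtain_ends[of e G A] by blast
  let ?H = "induced G A"
  have wfH: "wf_digraph ?H" and subH: "subgraph ?H G"
    using induced_subgraph_of[OF wfG AV] by auto
  have bHG: "boundary G B = boundary ?H B" if "B \<subseteq> A" "w \<notin> B" for B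
  proof -
    have "a \<in> boundary ?H B" if a: "a \<in> boundary G B" for a
    proof (cases "a = e")
      case True
      then show ?thesis using a wz \<open>B \<subseteq> A\<close> \<open>w \<notin> B\<close> by (auto simp: boundary_def doubleton_eq_iff)
    next
      case False
      then have "a \<notin> boundary G A" using e by blast
      then show ?thesis using a \<open>B \<subseteq> A\<close> by (auto simp: boundary_def)
    qed
    then show ?thesis by (auto simp: boundary_def)
  qed
  have "boundary G (verts G) = {}" by (auto simp: boundary_def)
  then have AneV: "A \<noteq> verts G" using e by auto
  have small: "B = {}" if B: "B \<subseteq> A" "w \<notin> B" "boundary ?H B \<subseteq> {b}" for B b
  proof (rule ccontr)
    assume "B \<noteq> {}"
    have "boundary G B \<noteq> {}"
      using connectedD_boundary[OF con wfG _ \<open>B \<noteq> {}\<close>] B AneV AV by blast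
    then have "boundary G B = {b}" using bHG[OF B(1,2)] B(3) by blast
    then have "Q B" using B A by (auto simp: Q_def)
    then have "card A \<le> card B" by (rule min)
    moreover have "B \<subset> A" using B wz by blast
    ultimately show False using finA psubset_card_mono by (metis not_le)
  qed
  have small': "B = {} \<or> B = A" if B: "B \<subseteq> A" "boundary ?H B \<subseteq> {b}" for B b
  proof (cases "w \<in> B")
    case True
    have "boundary ?H (A - B) = boundary ?H B"
      using boundary_Diff_verts[OF wfH] B(1) by simp
    then have "A - B = {}" using small[of "A - B" b] B True by simp
    then show ?thesis using B by blast
  next
    case False
    then show ?thesis using small[OF B(1) _ B(2)] by simp
  qed
  have bV: "boundary ?H {} = {}" "boundary ?H A = {}" by (auto simp: boundary_def)
  have conH: "connected ?H"
    unfolding connected_iff_boundary[OF wfH] using small' wz(1) by auto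
  have "\<not> cutting_edge ?H b" for b
  proof
    assume "cutting_edge ?H b"
    then obtain B where B: "B \<subseteq> A" "boundary ?H B = {b}"
      using cutting_edge_iff_boundary[OF wfH conH] by auto
    then show False using small'[OF B(1)] bV by fastforce
  qed
  then have brH: "bridgeless ?H" using conH by (simp add: bridgeless_def)
  have "\<not> (subgraph H' G \<and> bridgeless H')" if "H' \<noteq> ?H" "subgraph ?H H'" for H'
  proof
    assume H': "subgraph H' G \<and> bridgeless H'"
    then have sub': "subgraph H' G" and con': "connected H'" and wf': "wf_digraph H'"
      by (auto simp: bridgeless_def subgraph_def)
    have AH': "A \<subseteq> verts H'" using that(2) by (auto simp: subgraph_def)
    have "verts H' \<noteq> A"
    proof
      assume v: "verts H' = A"
      have th: "tail H' = tail G" "head H' = head G" using sub' by (auto simp: subgraph_def compatible_def)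
      have "arcs H' \<subseteq> arcs ?H"
        using sub' wf' v th by (auto simp: subgraph_def wf_digraph_def)
      then have "arcs H' = arcs ?H" using that(2) by (auto simp: subgraph_def)
      then have "H' = ?H" using v th by (intro pre_digraph.equality) auto
      then show False using that by blast
    qed
    have "boundary H' A = boundary G A \<inter> arcs H'"
      using boundary_subgraph[OF sub', of A] AH' by (simp add: Int_absorb2)
    moreover have "boundary H' A \<noteq> {}"
      using connectedD_boundary[OF con' wf' AH'] wz(1) \<open>verts H' \<noteq> A\<close> by auto
    ultimately have "boundary H' A = {e}" unfolding e by auto
    then have "cutting_edge H' e" using cutting_edge_iff_boundary[OF wf' con'] AH' by blast
    then show False using H' by (simp add: bridgeless_def)
  qed
  then have H2: "?H \<in> two_edge_components G"
    using subH brH by (auto simp: two_edge_components_alt max_subgraph_def)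
  have "z \<in> verts G" using wz wellformed by (metis doubleton_eq_iff)
  then obtain D0 where D0: "D0 \<in> two_edge_components G" "z \<in> verts D0"
    using two_edge_component_of_vertex[OF fin] by blast
  have disj: "D = ?H \<or> verts D \<inter> A = {}" if "D \<in> two_edge_components G" for D
    using two_edge_components_overlap_eq[OF that H2] by auto
  have cut: "cutting_edge G e" using cutting_edge_iff_boundary[OF wfG con] AV e by blast
  have "{D \<in> two_edge_components G. ?H \<noteq> D \<and> (\<exists>e. cutting_edge G e \<and>
            (tail G e \<in> verts ?H \<and> head G e \<in> verts D \<or>
             tail G e \<in> verts D \<and> head G e \<in> verts ?H))} = {D0}" (is "?X = _")
  proof
    show "{D0} \<subseteq> ?X"
      using D0 cut wz by (auto simp: doubleton_eq_iff)
    show "?X \<subseteq> {D0}"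
    proof
      fix D assume "D \<in> ?X"
      then obtain a where D: "D \<in> two_edge_components G" "D \<noteq> ?H" "a \<in> arcs G"
        "tail G a \<in> A \<and> head G a \<in> verts D \<or> tail G a \<in> verts D \<and> head G a \<in> A"
        by (auto simp: cutting_edge_def)
      then have dj: "verts D \<inter> A = {}" using disj by blast
      then have "a \<in> boundary G A" using D by (auto simp: boundary_def)
      then have "a = e" using e by simp
      then have "z \<in> verts D" using D wz dj by (auto simp: doubleton_eq_iff)
      then show "D \<in> {D0}" using two_edge_components_overlap_eq[OF D(1) D0(1) _ D0(2)] by simp
    qed
  qed
  then have "out_degree (with_proj (component_tree G)) ?H = 1"
    using out_degree_component_tree[OF H2] by simp
  then show ?thesis using H2 A by (intro bexI[of _ ?H]) (auto simp: Q_def)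
qed

text \<open>Each leaf of the component tree has a single boundary arc, and conversely every vertex set with
  a single boundary arc contains a leaf. Families of disjoint sets of this kind therefore measure
  the number of leaves, and unlike the component tree they behave well under restriction to
  subgraphs and under preimages.\<close>

definition disjoint_cuts :: "('a, 'b) pre_digraph \<Rightarrow> 'a set set \<Rightarrow> bool" where
  "disjoint_cuts G F \<longleftrightarrow> F \<subseteq> Pow (verts G) \<and> (\<forall>S\<in>F. card (boundary G S) = 1) \<and>
     (\<forall>S\<in>F. \<forall>S'\<in>F. S \<noteq> S' \<longrightarrow> S \<inter> S' = {})"

lemma leaves_alt:
  "leaves G = (if card (two_edge_components G) = 1 then 2
     else card {C \<in> two_edge_components G. out_degree (with_proj (component_tree G)) C = 1})"
  by (simp add: leaves_def component_tree_def)

lemma disjoint_cuts_card_le_leaves: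
  assumes fin: "fin_digraph G" and con: "connected G" and F: "disjoint_cuts G F"
  shows "card F \<le> leaves G"
proof (cases "F = {}")
  case False
  interpret fin_digraph G by fact
  let ?L = "{C \<in> two_edge_components G. out_degree (with_proj (component_tree G)) C = 1}"
  have "\<exists>C. C \<in> ?L \<and> verts C \<subseteq> S" if "S \<in> F" for S
  proof -
    have "S \<subseteq> verts G" "card (boundary G S) = 1" using F that by (auto simp: disjoint_cuts_def)
    from one_arc_cut_contains_leaf[OF fin con this] show ?thesis by auto
  qed
  then have "\<forall>S. \<exists>C. S \<in> F \<longrightarrow> C \<in> ?L \<and> verts C \<subseteq> S" by simp
  then obtain g where g': "\<forall>S. S \<in> F \<longrightarrow> g S \<in> ?L \<and> verts (g S) \<subseteq> S"
    unfolding choice_iff by (rule exE)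
  then have g: "\<And>S. S \<in> F \<Longrightarrow> g S \<in> ?L" "\<And>S. S \<in> F \<Longrightarrow> verts (g S) \<subseteq> S" by auto
  have inj: "inj_on g F"
  proof (rule inj_onI)
    fix S S' assume SS: "S \<in> F" "S' \<in> F" "g S = g S'"
    then have "verts (g S) \<subseteq> S \<inter> S'" using g(2)[OF SS(1)] g(2)[OF SS(2)] by auto
    moreover have "verts (g S) \<noteq> {}" using g(1)[OF SS(1)] two_edge_componentD(4) by blast
    ultimately have "S \<inter> S' \<noteq> {}" by blast
    then show "S = S'" using F SS(1,2) unfolding disjoint_cuts_def by metis
  qed
  have "card F \<le> card ?L"
    using finite_two_edge_components[OF fin] g(1) by (intro card_inj_on_le[OF inj]) auto
  moreover have "card (two_edge_components G) \<noteq> 1"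
  proof
    assume c1: "card (two_edge_components G) = 1"
    obtain S where S: "S \<in> F" using False by blast
    then have "boundary G S \<noteq> {}" "S \<subseteq> verts G" using F by (auto simp: disjoint_cuts_def)
    then have "S \<noteq> verts G" by (auto simp: boundary_def)
    then obtain v where v: "v \<in> verts G" "v \<notin> S" using \<open>S \<subseteq> verts G\<close> by blast
    then obtain D where "D \<in> two_edge_components G" "v \<in> verts D"
      using two_edge_component_of_vertex[OF fin] by blast
    moreover have "g S \<in> two_edge_components G" using g S by blast
    ultimately have "D = g S" using c1 by (metis card_1_singletonE singletonD)
    then show False using \<open>v \<in> verts D\<close> v g(2)[OF S] by blast
  qed
  ultimately show ?thesis by (simp add: leaves_alt)
qed simp

text \<open>If the arc were not cutting, then a minimal vertex set containing both the component and
  the other end of the arc, and staying connected without the arc, would be bridgeless.\<close>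

lemma boundary_two_edge_component_cutting:
  assumes fin: "fin_digraph G" and con: "connected G"
    and C: "C \<in> two_edge_components G" and e: "e \<in> boundary G (verts C)"
  shows "cutting_edge G e"
proof (rule ccontr)
  assume nc: "\<not> cutting_edge G e"
  interpret fin_digraph G by fact
  have wfG: "wf_digraph G" by unfold_locales
  obtain w z where wz: "w \<in> verts C" "z \<notin> verts C" "e \<in> arcs G" "{tail G e, head G e} = {w, z}"
    using boundary_obtain_ends[OF e] .
  have CG: "subgraph C G" "bridgeless C" "wf_digraph C" using two_edge_componentD[OF C] by auto
  have zG: "z \<in> verts G" using wz wellformed by (metis doubleton_eq_iff)
  let ?D = "\<lambda>P. pre_digraph.del_arc (induced G P) e"
  \<comment> \<open>A smallest such \<open>P\<close> has no bridge \<open>b\<close>: the side of \<open>b\<close> that contains \<open>C\<close> also contains \<open>z\<close>, and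
    it would be a smaller candidate.\<close>
  define Q where "Q P \<longleftrightarrow> insert z (verts C) \<subseteq> P \<and> P \<subseteq> verts G \<and> connected (?D P)" for P
  have "induced G (verts G) = G"
    by (rule pre_digraph.equality) auto
  then have "Q (verts G)"
    using nc wz(3) zG CG by (auto simp: Q_def cutting_edge_def subgraph_def)
  then obtain P where P: "Q P" and min: "\<And>B. Q B \<Longrightarrow> card P \<le> card B"
    using ex_has_least_nat[of Q "verts G" card] by auto
  have PV: "P \<subseteq> verts G" "verts C \<subseteq> P" "z \<in> P" "connected (?D P)" using P by (auto simp: Q_def)
  have finP: "finite P" using PV(1) by (rule finite_subset) simp
  have wfP: "wf_digraph (induced G A)" "wf_digraph (?D A)" if "A \<subseteq> verts G" for A
    using induced_subgraph_of[OF wfG that] by (auto intro: wf_digraph.wf_digraph_del_arc)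
  have bdel: "boundary (?D A) B = boundary (induced G A) B - {e}" for A B
    by (auto simp: boundary_def pre_digraph.del_arc_simps)
  have vD: "verts (?D A) = A" for A by (simp add: pre_digraph.del_arc_simps)
  have sep: "B = P" if "B \<subseteq> P" "B \<noteq> {}" "boundary (induced G P) B \<subseteq> {e}" for B
    using connectedD_boundary[OF PV(4) wfP(2)[OF PV(1)], of B] that by (auto simp: bdel vD)
  have con': "connected (induced G P)"
    unfolding connected_iff_boundary[OF wfP(1)[OF PV(1)]] using sep PV by auto
  have "\<not> cutting_edge (induced G P) b" for b
  proof
    assume "cutting_edge (induced G P) b"
    then obtain A0 where A0: "A0 \<subseteq> P" "boundary (induced G P) A0 = {b}"
      using cutting_edge_iff_boundary[OF wfP(1)[OF PV(1)] con'] by auto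
    have b0: "boundary (induced G P) {} = {}" "boundary (induced G P) P = {}" by (auto simp: boundary_def)
    have "b \<noteq> e" using A0 sep[OF A0(1)] b0 by auto
    have "boundary C (A0 \<inter> verts C) \<subseteq> {b}"
      using boundary_subgraph[OF subgraph_induced[OF CG(1) PV(2,1)], of A0] A0(2) by simp
    then have "verts C \<subseteq> A0 \<or> verts C \<inter> A0 = {}"
      by (rule bridgeless_subgraph_one_sided[OF CG(2,3)])
    moreover have "boundary (induced G P) (P - A0) = {b}"
      using boundary_Diff_verts[OF wfP(1)[OF PV(1)], of A0] A0 by simp
    moreover have "verts C \<subseteq> P - A0" if "verts C \<inter> A0 = {}" using that PV(2) by blast
    ultimately have "\<exists>A. A \<subseteq> P \<and> boundary (induced G P) A = {b} \<and> verts C \<subseteq> A"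
      using A0 by (metis Diff_subset)
    then obtain A where A: "A \<subseteq> P" "boundary (induced G P) A = {b}" "verts C \<subseteq> A" by metis
    have "A \<noteq> P" using A b0 by auto
    have "e \<in> arcs (induced G P)" using wz PV by (auto simp: doubleton_eq_iff)
    then have zA: "z \<in> A" using A wz \<open>b \<noteq> e\<close> by (auto simp: boundary_def doubleton_eq_iff)
    have "b \<in> boundary (induced G P) A" using A by blast
    then obtain w' z' where w': "w' \<in> A" "z' \<notin> A" "{tail G b, head G b} = {w', z'}"
      by (rule boundary_obtain_ends) simp
    have away: "B = {}" if B: "B \<subseteq> A" "w' \<notin> B" "boundary (?D A) B = {}" for B
    proof (rule ccontr)
      assume "B \<noteq> {}"
      have "boundary (induced G P) B \<subseteq> {e}"
      proof
        fix a assume a: "a \<in> boundary (induced G P) B"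
        show "a \<in> {e}"
        proof (cases "a = b")
          case True
          then show ?thesis using a w' B by (auto simp: boundary_def doubleton_eq_iff)
        next
          case False
          then have "a \<notin> boundary (induced G P) A" using A by blast
          then have "a \<in> boundary (induced G A) B" using a B A(1) by (auto simp: boundary_def)
          then show ?thesis using B(3) bdel by blast
        qed
      qed
      then show False using sep[of B] B A \<open>A \<noteq> P\<close> \<open>B \<noteq> {}\<close> by blast
    qed
    have AG: "A \<subseteq> verts G" using A PV by blast
    have "connected (?D A)"
      unfolding connected_iff_boundary[OF wfP(2)[OF AG]]
    proof (intro conjI allI impI)
      show "verts (?D A) \<noteq> {}" using zA by (auto simp: vD)
      fix B assume B: "B \<subseteq> verts (?D A)" "B \<noteq> {}" "boundary (?D A) B = {}"
      show "B = verts (?D A)"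
      proof (cases "w' \<in> B")
        case True
        have "boundary (?D A) (A - B) = {}"
          using boundary_Diff_verts[OF wfP(2)[OF AG], of B] B by (simp add: vD)
        then have "A - B = {}" using away[of "A - B"] True by blast
        then show ?thesis using B by (auto simp: vD)
      next
        case False
        then show ?thesis using away B by (auto simp: vD)
      qed
    qed
    then have "Q A" using A zA AG by (auto simp: Q_def)
    then have "card P \<le> card A" by (rule min)
    then show False using A(1) \<open>A \<noteq> P\<close> finP by (meson card_seteq)
  qed
  then have "bridgeless (induced G P)" using con' by (simp add: bridgeless_def)
  moreover have "subgraph (induced G P) G" using induced_subgraph_of[OF wfG PV(1)] by simp
  moreover have "subgraph C (induced G P)" using subgraph_induced[OF CG(1) PV(2,1)] .
  moreover have "induced G P \<noteq> C" using PV(3) wz(2) by auto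
  ultimately show False using C by (auto simp: two_edge_components_alt max_subgraph_def)
qed

text \<open>All arcs leaving the component are cutting edges. If there were two of them, the cut of the
  first would separate their outer ends, so they would lead to two different neighbours in the
  component tree.\<close>

lemma leaf_component_boundary:
  assumes fin: "fin_digraph G" and con: "connected G"
    and C: "C \<in> two_edge_components G" and n1: "card (two_edge_components G) \<noteq> 1"
    and deg: "out_degree (with_proj (component_tree G)) C = 1"
  shows "card (boundary G (verts C)) = 1"
proof -
  interpret fin_digraph G by fact
  have wfG: "wf_digraph G" by unfold_locales
  let ?X = "{D \<in> two_edge_components G. C \<noteq> D \<and> (\<exists>e. cutting_edge G e \<and>
            (tail G e \<in> verts C \<and> head G e \<in> verts D \<or>
             tail G e \<in> verts D \<and> head G e \<in> verts C))}"
  obtain D0 where D0: "?X = {D0}"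
    using deg unfolding out_degree_component_tree[OF C] by (rule card_1_singletonE)
  have CG: "subgraph C G" "bridgeless C" "wf_digraph C" "verts C \<noteq> {}"
    using two_edge_componentD[OF C] by auto
  have CV: "verts C \<subseteq> verts G" using CG by (auto simp: subgraph_def)
  have inX: "\<exists>D\<in>?X. z \<in> verts D" if e: "e \<in> boundary G (verts C)" and z: "z \<notin> verts C"
    "z \<in> {tail G e, head G e}" for e z
  proof -
    have "z \<in> verts G" using e z wellformed by (auto simp: boundary_def)
    then obtain D where D: "D \<in> two_edge_components G" "z \<in> verts D"
      using two_edge_component_of_vertex[OF fin] by blast
    moreover have "C \<noteq> D" using D z by blast
    moreover have "cutting_edge G e" by (rule boundary_two_edge_component_cutting[OF fin con C e])
    ultimately have "D \<in> ?X" using e z by (auto simp: boundary_def)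
    then show ?thesis using D by blast
  qed
  have "boundary G (verts C) \<noteq> {}"
  proof
    assume "boundary G (verts C) = {}"
    then have VC: "verts C = verts G" using connectedD_boundary[OF con wfG CV CG(4)] by blast
    have "D = C" if "D \<in> two_edge_components G" for D
    proof -
      have "verts D \<noteq> {}" "verts D \<subseteq> verts C"
        using two_edge_componentD[OF that] VC by (auto simp: subgraph_def)
      then show ?thesis using two_edge_components_overlap_eq[OF that C] by blast
    qed
    then have "two_edge_components G = {C}" using C by blast
    then show False using n1 by simp
  qed
  moreover have "e1 = e2" if e12: "e1 \<in> boundary G (verts C)" "e2 \<in> boundary G (verts C)" for e1 e2
  proof (rule ccontr)
    assume "e1 \<noteq> e2"
    have "cutting_edge G e1" by (rule boundary_two_edge_component_cutting[OF fin con C e12(1)])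
    then obtain S where S: "S \<subseteq> verts G" "boundary G S = {e1}"
      using cutting_edge_iff_boundary[OF wfG con] by blast
    have side: "verts D \<subseteq> S \<or> verts D \<inter> S = {}" if "D \<in> two_edge_components G" for D
    proof (rule bridgeless_subgraph_one_sided)
      show "bridgeless D" "wf_digraph D" using two_edge_componentD[OF that] by auto
      show "boundary D (S \<inter> verts D) \<subseteq> {e1}"
        using boundary_subgraph[OF two_edge_componentD(1)[OF that]] S by blast
    qed
    obtain w1 z1 where e1: "w1 \<in> verts C" "z1 \<notin> verts C" "{tail G e1, head G e1} = {w1, z1}"
      using boundary_obtain_ends[OF e12(1)] .
    obtain w2 z2 where e2: "w2 \<in> verts C" "z2 \<notin> verts C" "{tail G e2, head G e2} = {w2, z2}"
      using boundary_obtain_ends[OF e12(2)] .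
    have "(w1 \<in> S) \<noteq> (z1 \<in> S)"
      using S(2) e1(3) by (auto simp: boundary_def doubleton_eq_iff)
    moreover have "(w2 \<in> S) = (z2 \<in> S)"
    proof -
      have "e2 \<notin> boundary G S" "e2 \<in> arcs G" using S(2) \<open>e1 \<noteq> e2\<close> e12 by (auto simp: boundary_def)
      then show ?thesis using e2(3) by (auto simp: boundary_def doubleton_eq_iff)
    qed
    moreover have "(w1 \<in> S) = (w2 \<in> S)" using side[OF C] e1 e2 by blast
    ultimately have sep: "(z1 \<in> S) \<noteq> (z2 \<in> S)" by blast
    obtain D1 where D1: "D1 \<in> ?X" "z1 \<in> verts D1" using inX[OF e12(1) e1(2)] e1(3) by auto
    obtain D2 where D2: "D2 \<in> ?X" "z2 \<in> verts D2" using inX[OF e12(2) e2(2)] e2(3) by auto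
    have "D1 = D2" using D1(1) D2(1) unfolding D0 by simp
    then show False using side[of D1] D1 D2 sep by blast
  qed
  ultimately obtain e where "boundary G (verts C) = {e}" by blast
  then show ?thesis by simp
qed

text \<open>The two sides of a cutting edge are disjoint one-arc cuts.\<close>

lemma leaves_ge_2:
  assumes fin: "fin_digraph G" and con: "connected G"
  shows "leaves G \<ge> 2"
proof (cases "card (two_edge_components G) = 1")
  case False
  interpret fin_digraph G by fact
  have wfG: "wf_digraph G" by unfold_locales
  have "\<exists>e. cutting_edge G e"
  proof (rule ccontr)
    assume "\<not> ?thesis"
    then have "bridgeless G" using con by (simp add: bridgeless_def)
    moreover have refl: "subgraph G G" using wfG by (auto simp: subgraph_def compatible_def)
    moreover have "H' = G" if "subgraph H' G" "subgraph G H'" for H'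
      using that by (auto simp: subgraph_def compatible_def)
    ultimately have G: "G \<in> two_edge_components G"
      by (auto simp: two_edge_components_alt max_subgraph_def)
    have "D = G" if "D \<in> two_edge_components G" for D
    proof -
      have "verts D \<noteq> {}" "verts D \<subseteq> verts G"
        using two_edge_componentD[OF that] by (auto simp: subgraph_def)
      then show ?thesis using two_edge_components_overlap_eq[OF that G] by blast
    qed
    then have "two_edge_components G = {G}" using G by blast
    then show False using False by simp
  qed
  then obtain e S where S: "S \<subseteq> verts G" "boundary G S = {e}"
    using cutting_edge_iff_boundary[OF wfG con] by blast
  have S': "boundary G (verts G - S) = {e}" using boundary_Diff_verts[OF wfG S(1)] S by simp
  have "S \<noteq> verts G - S"
  proof
    assume "S = verts G - S"
    then have "S = {}" by blast
    then show False using S by (simp add: boundary_def)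
  qed
  then have "card {S, verts G - S} = 2" by simp
  moreover have "disjoint_cuts G {S, verts G - S}"
    using S S' by (auto simp: disjoint_cuts_def)
  ultimately show ?thesis using disjoint_cuts_card_le_leaves[OF fin con] by metis
qed (simp add: leaves_alt)

lemma leaves_attained:
  assumes fin: "fin_digraph G" and con: "connected G" and n2: "leaves G \<noteq> 2"
  obtains F where "disjoint_cuts G F" "card F = leaves G"
proof -
  let ?L = "{C \<in> two_edge_components G. out_degree (with_proj (component_tree G)) C = 1}"
  have c1: "card (two_edge_components G) \<noteq> 1" and l: "leaves G = card ?L"
    using n2 by (auto simp: leaves_alt split: if_splits)
  have inj: "inj_on verts ?L"
  proof (rule inj_onI)
    fix C D assume "C \<in> ?L" "D \<in> ?L" "verts C = verts D"
    then show "C = D"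
      using two_edge_components_overlap_eq[of C G D] two_edge_componentD(4)[of C G] by auto
  qed
  have "disjoint_cuts G (verts ` ?L)"
    unfolding disjoint_cuts_def
  proof (intro conjI ballI impI)
    show "verts ` ?L \<subseteq> Pow (verts G)"
      using two_edge_componentD(1)[of _ G] by (auto simp: subgraph_def)
    show "card (boundary G S) = 1" if "S \<in> verts ` ?L" for S
      using leaf_component_boundary[OF fin con _ c1] that by auto
    show "S \<inter> S' = {}" if SS: "S \<in> verts ` ?L" "S' \<in> verts ` ?L" "S \<noteq> S'" for S S'
    proof -
      obtain C where C: "S = verts C" "C \<in> ?L" using SS(1) by (rule imageE)
      obtain D where D: "S' = verts D" "D \<in> ?L" using SS(2) by (rule imageE)
      note CD = C(2) D(2) C(1) D(1)
      then have "C \<noteq> D" using SS(3) by auto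
      then show ?thesis using two_edge_components_overlap_eq[of C G D] CD by auto
    qed
  qed
  then show thesis using that[of "verts ` ?L"] card_image[OF inj] l by simp
qed

lemma leaves_le_bound:
  assumes "fin_digraph G" "connected G" "2 \<le> n" "\<And>F. disjoint_cuts G F \<Longrightarrow> card F \<le> n"
  shows "leaves G \<le> n"
proof (cases "leaves G = 2")
  case False
  then obtain F where "disjoint_cuts G F" "card F = leaves G"
    using leaves_attained[OF assms(1,2)] by blast
  then show ?thesis using assms(4) by metis
qed (use assms in simp)

section \<open>Balanced digraphs\<close>

definition excess :: "('b \<Rightarrow> 'a) \<Rightarrow> ('b \<Rightarrow> 'a) \<Rightarrow> 'b set \<Rightarrow> 'a set \<Rightarrow> int" where
  "excess t h E S = int (card {e \<in> E. t e \<in> S}) - int (card {e \<in> E. h e \<in> S})"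

text \<open>Quantifying over all vertex sets instead of single vertices makes balance stable under quotients:
  the excess of \<open>S\<close> in a quotient is the excess of the preimage of \<open>S\<close>.\<close>

definition balanced :: "('a, 'b) pre_digraph \<Rightarrow> bool" where
  "balanced G \<longleftrightarrow> (\<forall>S. excess (tail G) (head G) (arcs G) S = 0)"

lemma excess_Un_arcs:
  fixes t h :: "'b \<Rightarrow> 'a"
  assumes "finite E" "finite E'" "E \<inter> E' = {}"
  shows "excess t h (E \<union> E') S = excess t h E S + excess t h E' S"
proof -
  have c: "card {e \<in> E \<union> E'. f e \<in> S} = card {e \<in> E. f e \<in> S} + card {e \<in> E'. f e \<in> S}" for f :: "'b \<Rightarrow> 'a"
  proof -
    have "{e \<in> E \<union> E'. f e \<in> S} = {e \<in> E. f e \<in> S} \<union> {e \<in> E'. f e \<in> S}" by auto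
    then show ?thesis using assms by (simp add: card_Un_disjoint disjoint_iff)
  qed
  show ?thesis unfolding excess_def c by simp
qed

lemma excess_Un_verts:
  fixes t h :: "'b \<Rightarrow> 'a"
  assumes "finite E" "S \<inter> S' = {}"
  shows "excess t h E (S \<union> S') = excess t h E S + excess t h E S'"
proof -
  have c: "card {e \<in> E. f e \<in> S \<union> S'} = card {e \<in> E. f e \<in> S} + card {e \<in> E. f e \<in> S'}" for f :: "'b \<Rightarrow> 'a"
  proof -
    have "{e \<in> E. f e \<in> S \<union> S'} = {e \<in> E. f e \<in> S} \<union> {e \<in> E. f e \<in> S'}" by auto
    moreover have "{e \<in> E. f e \<in> S} \<inter> {e \<in> E. f e \<in> S'} = {}" using assms(2) by auto
    ultimately show ?thesis using assms by (simp add: card_Un_disjoint)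
  qed
  show ?thesis unfolding excess_def c by simp
qed

lemma excess_cong_verts:
  assumes "\<And>e. e \<in> E \<Longrightarrow> t e \<in> S \<longleftrightarrow> t e \<in> S'" "\<And>e. e \<in> E \<Longrightarrow> h e \<in> S \<longleftrightarrow> h e \<in> S'"
  shows "excess t h E S = excess t h E S'"
proof -
  have "{e \<in> E. t e \<in> S} = {e \<in> E. t e \<in> S'}" "{e \<in> E. h e \<in> S} = {e \<in> E. h e \<in> S'}"
    using assms by auto
  then show ?thesis by (simp add: excess_def)
qed

lemma balanced_iff_degree:
  assumes "fin_digraph G"
  shows "balanced G \<longleftrightarrow> (\<forall>v\<in>verts G. in_degree G v = out_degree G v)"
proof -
  interpret fin_digraph G by fact
  have "excess (tail G) (head G) (arcs G) S =
      (\<Sum>v\<in>S \<inter> verts G. int (out_degree G v) - int (in_degree G v))" for S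
  proof -
    have c: "card {e \<in> arcs G. f e \<in> S} = (\<Sum>v\<in>S \<inter> verts G. card {e \<in> arcs G. f e = v})"
      if f: "\<And>e. e \<in> arcs G \<Longrightarrow> f e \<in> verts G" for f
    proof -
      have "{e \<in> arcs G. f e \<in> S} = (\<Union>v\<in>S \<inter> verts G. {e \<in> arcs G. f e = v})"
        using f by auto
      also have "card \<dots> = (\<Sum>v\<in>S \<inter> verts G. card {e \<in> arcs G. f e = v})"
        by (rule card_UN_disjoint) auto
      finally show ?thesis .
    qed
    show ?thesis
      by (simp add: excess_def c out_degree_def in_degree_def out_arcs_def in_arcs_def sum_subtractf)
  qed
  then show ?thesis
    unfolding balanced_def
  proof (intro iffI ballI allI)
    fix v assume *: "\<And>S. excess (tail G) (head G) (arcs G) S =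
        (\<Sum>v\<in>S \<inter> verts G. int (out_degree G v) - int (in_degree G v))"
      "\<forall>S. excess (tail G) (head G) (arcs G) S = 0" "v \<in> verts G"
    then have "(\<Sum>w\<in>{v} \<inter> verts G. int (out_degree G w) - int (in_degree G w)) = 0" by metis
    then show "in_degree G v = out_degree G v" using *(3) by simp
  qed auto
qed

lemma euler_trail_iff_balanced:
  assumes "fin_digraph G" "connected G"
  shows "(\<exists>u p. pre_digraph.euler_trail G u p u) \<longleftrightarrow> balanced G"
  using fin_digraph.closed_euler[OF assms(1)] balanced_iff_degree[OF assms(1)] assms(2) by simp

text \<open>As many arcs leave the set as enter it.\<close>

lemma balanced_even_boundary:
  assumes "balanced G" "finite (arcs G)"
  shows "even (card (boundary G S))"
proof -
  let ?I = "{e \<in> arcs G. tail G e \<in> S \<and> head G e \<in> S}"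
  let ?O = "{e \<in> arcs G. tail G e \<in> S \<and> head G e \<notin> S}"
  let ?J = "{e \<in> arcs G. tail G e \<notin> S \<and> head G e \<in> S}"
  have fin: "finite ?I" "finite ?O" "finite ?J" using assms(2) by auto
  have "{e \<in> arcs G. tail G e \<in> S} = ?I \<union> ?O" "{e \<in> arcs G. head G e \<in> S} = ?I \<union> ?J" by auto
  then have "card {e \<in> arcs G. tail G e \<in> S} = card ?I + card ?O"
    "card {e \<in> arcs G. head G e \<in> S} = card ?I + card ?J"
    using card_Un_disjoint[OF fin(1,2)] card_Un_disjoint[OF fin(1,3)] by auto
  then have "card ?I + card ?O = card ?I + card ?J"
    using assms(1) unfolding balanced_def excess_def by auto
  moreover have "boundary G S = ?O \<union> ?J" by (auto simp: boundary_def)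
  then have "card (boundary G S) = card ?O + card ?J"
    using fin by (subst \<open>boundary G S = _\<close>, subst card_Un_disjoint) auto
  ultimately show ?thesis by simp
qed

text \<open>One-arc cuts are odd, so a balanced graph has none and the convention applies.\<close>

lemma balanced_leaves:
  assumes "fin_digraph G" "connected G" "balanced G"
  shows "leaves G = 2"
proof (rule antisym)
  interpret fin_digraph G by fact
  show "leaves G \<le> 2"
  proof (rule leaves_le_bound[OF assms(1,2)])
    fix F assume F: "disjoint_cuts G F"
    have "F = {}"
    proof (rule ccontr)
      assume "F \<noteq> {}"
      then obtain S where "S \<in> F" by blast
      then have "card (boundary G S) = 1" using F by (simp add: disjoint_cuts_def)
      then show False using balanced_even_boundary[OF assms(3), of S] by simp
    qed
    then show "card F \<le> 2" by simp
  qed simp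
qed (rule leaves_ge_2[OF assms(1,2)])

section \<open>Decomposing a digraph into connected blocks\<close>

definition join :: "('b \<Rightarrow> 'a) \<Rightarrow> ('b \<Rightarrow> 'a) \<Rightarrow> ('a, 'b) pre_digraph set \<Rightarrow> ('a, 'b) pre_digraph" where
  "join t h K = \<lparr>verts = (\<Union>C\<in>K. verts C), arcs = (\<Union>C\<in>K. arcs C), tail = t, head = h\<rparr>"

lemma join_simps [simp]:
  "verts (join t h K) = (\<Union>C\<in>K. verts C)" "arcs (join t h K) = (\<Union>C\<in>K. arcs C)"
  "tail (join t h K) = t" "head (join t h K) = h"
  by (simp_all add: join_def)

definition blocks :: "('b \<Rightarrow> 'a) \<Rightarrow> ('b \<Rightarrow> 'a) \<Rightarrow> ('a, 'b) pre_digraph set \<Rightarrow> bool" where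
  "blocks t h K \<longleftrightarrow> finite K \<and>
     (\<forall>C\<in>K. fin_digraph C \<and> connected C \<and> tail C = t \<and> head C = h) \<and>
     (\<forall>C\<in>K. \<forall>D\<in>K. C \<noteq> D \<longrightarrow> arcs C \<inter> arcs D = {})"

definition shared :: "('a, 'b) pre_digraph set \<Rightarrow> ('a, 'b) pre_digraph \<Rightarrow> 'a set" where
  "shared K C = verts C \<inter> (\<Union>D\<in>K - {C}. verts D)"

text \<open>A family of blocks none of which can be pruned as a leaf of the bipartite graph of blocks and
  shared vertices. This replaces a cycle of the bipartite graph in the inductions below.\<close>

definition is_core :: "('a, 'b) pre_digraph set \<Rightarrow> bool" where
  "is_core J \<longleftrightarrow> J \<noteq> {} \<and> (\<forall>C\<in>J. 2 \<le> card (shared J C))"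

lemma blocksD:
  assumes "blocks t h K" "C \<in> K"
  shows "fin_digraph C" "connected C" "tail C = t" "head C = h" "wf_digraph C"
    "finite (verts C)" "finite (arcs C)" "verts C \<noteq> {}"
    "\<And>e. e \<in> arcs C \<Longrightarrow> t e \<in> verts C" "\<And>e. e \<in> arcs C \<Longrightarrow> h e \<in> verts C"
proof -
  show *: "fin_digraph C" "connected C" "tail C = t" "head C = h"
    using assms by (auto simp: blocks_def)
  then interpret fin_digraph C by blast
  show "wf_digraph C" "finite (verts C)" "finite (arcs C)" by (simp_all add: wf_digraph)
  then show "verts C \<noteq> {}" using *(2) connected_iff_boundary[of C] by simp
  show "\<And>e. e \<in> arcs C \<Longrightarrow> t e \<in> verts C" "\<And>e. e \<in> arcs C \<Longrightarrow> h e \<in> verts C"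
    using * wellformed by auto
qed

lemma blocks_finite: "blocks t h K \<Longrightarrow> finite K"
  by (simp add: blocks_def)

lemma blocks_disjoint:
  "blocks t h K \<Longrightarrow> C \<in> K \<Longrightarrow> D \<in> K \<Longrightarrow> C \<noteq> D \<Longrightarrow> arcs C \<inter> arcs D = {}"
  by (simp add: blocks_def)

lemma blocks_subset: "blocks t h K \<Longrightarrow> J \<subseteq> K \<Longrightarrow> blocks t h J"
  unfolding blocks_def by (meson finite_subset subsetD)

lemma join_fin_digraph:
  assumes "blocks t h K" shows "fin_digraph (join t h K)" "wf_digraph (join t h K)"
proof -
  show wf: "wf_digraph (join t h K)"
    using blocksD(9,10)[OF assms] unfolding wf_digraph_def join_simps by blast
  show "fin_digraph (join t h K)"
    using wf blocks_finite[OF assms] blocksD(6,7)[OF assms]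
    by (auto simp: fin_digraph_def fin_digraph_axioms_def)
qed

lemma card_shared_le:
  assumes "blocks t h K" "J \<subseteq> K" "C \<in> J"
  shows "card (shared J C) \<le> card (shared K C)"
proof (rule card_mono)
  show "finite (shared K C)" using blocksD(6)[OF assms(1)] assms by (auto simp: shared_def)
  show "shared J C \<subseteq> shared K C" using assms by (auto simp: shared_def)
qed

lemma shared_nonempty:
  assumes K: "blocks t h K" and con: "connected (join t h K)" and C: "C \<in> K" "K \<noteq> {C}"
  shows "shared K C \<noteq> {}"
proof
  assume emp: "shared K C = {}"
  have "boundary (join t h K) (verts C) = {}"
  proof (rule ccontr)
    assume "boundary (join t h K) (verts C) \<noteq> {}"
    then obtain e D where D: "D \<in> K" "e \<in> arcs D" "(t e \<in> verts C) \<noteq> (h e \<in> verts C)"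
      by (auto simp: boundary_def)
    have "t e \<in> verts D" "h e \<in> verts D" using blocksD(9,10)[OF K D(1)] D by auto
    then have "C \<noteq> D \<Longrightarrow> shared K C \<noteq> {}" using D by (auto simp: shared_def)
    moreover have "C = D \<Longrightarrow> False" using D \<open>t e \<in> verts D\<close> \<open>h e \<in> verts D\<close> by simp
    ultimately show False using emp by blast
  qed
  then have eq: "verts C = (\<Union>D\<in>K. verts D)"
    using connectedD_boundary[OF con join_fin_digraph(2)[OF K], of "verts C"] C blocksD(8)[OF K C(1)]
    by auto
  obtain D where D: "D \<in> K" "D \<noteq> C" using C by blast
  then obtain v where "v \<in> verts D" using blocksD(8)[OF K] by blast
  then have "v \<in> shared K C" using eq D by (auto simp: shared_def)
  then show False using emp by simp
qed

text \<open>A block that meets the other blocks in a single vertex can be pruned: what remains is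
  connected, and both parts are balanced because the imbalance of the block, whose sum is zero,
  could only be located at the shared vertex.\<close>

lemma prune_block:
  assumes K: "blocks t h K" and con: "connected (join t h K)" and bal: "balanced (join t h K)"
    and C: "C \<in> K" "K \<noteq> {C}" and x: "shared K C = {x}"
  shows "connected (join t h (K - {C}))" "balanced (join t h (K - {C}))" "balanced C"
    "card (\<Union>D\<in>K. verts D) + 1 = card (\<Union>D\<in>K - {C}. verts D) + card (verts C)"
proof -
  let ?K' = "K - {C}"
  let ?V' = "\<Union>D\<in>?K'. verts D"
  have xi: "w = x" if "w \<in> verts C" "w \<in> ?V'" for w
  proof -
    have "w \<in> shared K C" using that unfolding shared_def by (rule IntI)
    then show ?thesis unfolding x by simp
  qed
  have K': "blocks t h ?K'" by (rule blocks_subset[OF K Diff_subset])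
  have KC: "K = insert C ?K'" using C by blast
  have xC: "verts C \<inter> ?V' = {x}" using x by (simp add: shared_def)
  have V: "(\<Union>D\<in>K. verts D) = verts C \<union> ?V'" using C by blast
  have fin: "finite (verts C)" "finite ?V'"
    using blocksD(6)[OF K C(1)] blocks_finite[OF K'] blocksD(6)[OF K'] by auto
  have "card (verts C \<union> ?V') + card (verts C \<inter> ?V') = card (verts C) + card ?V'"
    using card_Un_Int[OF fin] by simp
  then show "card (\<Union>D\<in>K. verts D) + 1 = card ?V' + card (verts C)"
    unfolding V xC by simp
  let ?E' = "\<Union>D\<in>?K'. arcs D"
  have E: "(\<Union>D\<in>K. arcs D) = arcs C \<union> ?E'" using C by blast
  have dE: "arcs C \<inter> ?E' = {}" using blocks_disjoint[OF K C(1)] by blast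
  have finE: "finite (arcs C)" "finite ?E'"
    using blocksD(7)[OF K C(1)] blocks_finite[OF K'] blocksD(7)[OF K'] by auto
  have add: "excess t h (arcs C) S + excess t h ?E' S = 0" for S
    using bal excess_Un_arcs[OF finE dE, of t h S] E by (simp add: balanced_def)
  have endsC: "t e \<in> verts C" "h e \<in> verts C" if "e \<in> arcs C" for e
    using blocksD(9,10)[OF K C(1) that] .
  have ends': "t e \<in> ?V'" "h e \<in> ?V'" if "e \<in> ?E'" for e
    using that blocksD(9,10)[OF K'] by blast+
  \<comment> \<open>Away from \<open>x\<close>, all arcs at a vertex of \<open>C\<close> belong to \<open>C\<close>.\<close>
  have avoid: "excess t h (arcs C) S = 0" if "x \<notin> S" for S
  proof -
    have no: "w \<notin> S \<inter> verts C" if "w \<in> ?V'" for w using xi[of w] that \<open>x \<notin> S\<close> by auto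
    have "excess t h (arcs C) S = excess t h (arcs C) (S \<inter> verts C)"
      using endsC by (intro excess_cong_verts) auto
    also have "\<dots> = - excess t h ?E' (S \<inter> verts C)" using add[of "S \<inter> verts C"] by simp
    also have "excess t h ?E' (S \<inter> verts C) = excess t h ?E' {}"
      using ends'[THEN no] by (intro excess_cong_verts) auto
    finally show ?thesis by (simp add: excess_def)
  qed
  have balC: "excess t h (arcs C) S = 0" for S
  proof (cases "x \<in> S")
    case True
    have "excess t h (arcs C) (S \<union> - S) = excess t h (arcs C) S + excess t h (arcs C) (- S)"
      by (rule excess_Un_verts[OF finE(1)]) simp
    moreover have "excess t h (arcs C) (- S) = 0" using avoid[of "- S"] True by simp
    moreover have "excess t h (arcs C) (S \<union> - S) = 0" by (simp add: excess_def)
    ultimately show ?thesis by simp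
  qed (rule avoid)
  then show "balanced C" using blocksD(3,4)[OF K C(1)] by (simp add: balanced_def)
  show "balanced (join t h ?K')" using add balC by (simp add: balanced_def)
  have ne: "verts (join t h ?K') \<noteq> {}" using xC by auto
  have "S = ?V'" if S: "S \<subseteq> ?V'" "S \<noteq> {}" "boundary (join t h ?K') S = {}" for S
  proof (cases "x \<in> S")
    case True
    have "boundary (join t h K) (S \<union> verts C) = {}"
    proof (rule ccontr)
      assume "boundary (join t h K) (S \<union> verts C) \<noteq> {}"
      then obtain e where e: "e \<in> arcs C \<union> ?E'" "(t e \<in> S \<union> verts C) \<noteq> (h e \<in> S \<union> verts C)"
        unfolding boundary_def using E by auto
      then have e': "e \<in> ?E'" using endsC by blast
      have "w \<in> S \<union> verts C \<longleftrightarrow> w \<in> S" if "w \<in> ?V'" for w using xi[of w] that True by auto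
      then have "(t e \<in> S) \<noteq> (h e \<in> S)" using e(2) ends'[OF e'] by metis
      then have "e \<in> boundary (join t h ?K') S" using e' by (simp add: boundary_def)
      then show False using S by simp
    qed
    then have "S \<union> verts C = verts C \<union> ?V'"
      using connectedD_boundary[OF con join_fin_digraph(2)[OF K], of "S \<union> verts C"] S V True by auto
    then have "w \<in> S" if "w \<in> ?V'" for w using that xi[of w] True by blast
    then show ?thesis using S(1) by auto
  next
    case False
    have "boundary (join t h K) S = {}"
    proof (rule ccontr)
      assume "boundary (join t h K) S \<noteq> {}"
      then obtain e where e: "e \<in> arcs C \<union> ?E'" "(t e \<in> S) \<noteq> (h e \<in> S)"
        unfolding boundary_def using E by auto
      have "w \<notin> S" if "w \<in> verts C" for w using xi[of w] that S(1) False by auto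
      then have "e \<notin> arcs C" using e(2) endsC by blast
      then have "e \<in> boundary (join t h ?K') S" using e by (simp add: boundary_def)
      then show False using S by simp
    qed
    then have "S = verts C \<union> ?V'"
      using connectedD_boundary[OF con join_fin_digraph(2)[OF K], of S] S V by auto
    then show ?thesis using S by blast
  qed
  then show "connected (join t h ?K')"
    unfolding connected_iff_boundary[OF join_fin_digraph(2)[OF K']] using ne by simp
qed

text \<open>A member of a core has two shared vertices within the core already, so a block that can be
  pruned belongs to no core.\<close>

lemma core_avoids_pruned:
  assumes "blocks t h K" "C \<in> K" "card (shared K C) \<le> 1" "J \<subseteq> K" "is_core J"
  shows "J \<subseteq> K - {C}"
proof -
  have "C \<notin> J"
  proof
    assume "C \<in> J"
    then have "2 \<le> card (shared J C)" using assms(5) by (simp add: is_core_def)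
    also have "\<dots> \<le> card (shared K C)" by (rule card_shared_le[OF assms(1,4) \<open>C \<in> J\<close>])
    finally show False using assms(3) by simp
  qed
  then show ?thesis using assms(4) by blast
qed

text \<open>Each leaf of a block contains a shared vertex, since otherwise its one-arc cut would be an
  odd cut of the balanced whole.\<close>

lemma leaves_le_shared:
  assumes K: "blocks t h K" and bal: "balanced (join t h K)"
    and C: "C \<in> K" "2 \<le> card (shared K C)"
  shows "leaves C \<le> card (shared K C)"
proof (rule leaves_le_bound)
  show "fin_digraph C" "connected C" using blocksD[OF K C(1)] by auto
  show "2 \<le> card (shared K C)" by fact
  fix F assume F: "disjoint_cuts C F"
  have finE: "finite (arcs (join t h K))" using join_fin_digraph(1)[OF K] fin_digraph.finite_arcs by blast
  have "\<exists>v. v \<in> S \<inter> shared K C" if "S \<in> F" for S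
  proof (rule ccontr)
    assume no: "\<not> ?thesis"
    have S: "S \<subseteq> verts C" "card (boundary C S) = 1" using F that by (auto simp: disjoint_cuts_def)
    have "boundary (join t h K) S = boundary C S"
    proof
      show "boundary C S \<subseteq> boundary (join t h K) S"
        using blocksD(3,4)[OF K C(1)] C(1) by (auto simp: boundary_def)
      show "boundary (join t h K) S \<subseteq> boundary C S"
      proof
        fix e assume "e \<in> boundary (join t h K) S"
        then obtain D where D: "D \<in> K" "e \<in> arcs D" "(t e \<in> S) \<noteq> (h e \<in> S)"
          by (auto simp: boundary_def)
        have "t e \<in> verts D" "h e \<in> verts D" using blocksD(9,10)[OF K D(1)] D by auto
        then have "D = C" using D no S(1) by (auto simp: shared_def)
        then show "e \<in> boundary C S" using D blocksD(3,4)[OF K C(1)] by (auto simp: boundary_def)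
      qed
    qed
    then show False using balanced_even_boundary[OF bal finE, of S] S by simp
  qed
  then have "\<forall>S. \<exists>v. S \<in> F \<longrightarrow> v \<in> S \<inter> shared K C" by blast
  then obtain g where g: "\<forall>S. S \<in> F \<longrightarrow> g S \<in> S \<inter> shared K C" unfolding choice_iff by (rule exE)
  have "inj_on g F"
  proof (rule inj_onI)
    fix S S' assume SS: "S \<in> F" "S' \<in> F" "g S = g S'"
    then have "g S \<in> S" "g S \<in> S'" using g[rule_format, of S] g[rule_format, of S'] by auto
    then have "S \<inter> S' \<noteq> {}" by auto
    then show "S = S'" using F SS(1,2) unfolding disjoint_cuts_def by metis
  qed
  then show "card F \<le> card (shared K C)"
    using g blocksD(6)[OF K C(1)] by (intro card_inj_on_le[of g]) (auto simp: shared_def)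
qed

text \<open>A vertex lying in \<open>d\<close> blocks counts \<open>2 * d\<close> on the right; on the left it counts \<open>2\<close> if \<open>d = 1\<close>, and
  \<open>2 + d\<close> if \<open>d\<close> is at least \<open>2\<close>.\<close>

lemma sum_card_verts_shared:
  assumes K: "blocks t h K"
  shows "2 * card (\<Union>C\<in>K. verts C) + (\<Sum>C\<in>K. card (shared K C)) \<le> 2 * (\<Sum>C\<in>K. card (verts C))"
proof -
  let ?V = "\<Union>C\<in>K. verts C"
  have finK: "finite K" and finV: "finite ?V" using blocks_finite[OF K] blocksD(6)[OF K] by auto
  define d where "d v = card {C \<in> K. v \<in> verts C}" for v
  have swap: "(\<Sum>C\<in>K. card {v \<in> ?V. P C v}) = (\<Sum>v\<in>?V. card {C \<in> K. P C v})" for P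
  proof -
    have "(\<Sum>C\<in>K. card {v \<in> ?V. P C v}) = (\<Sum>C\<in>K. \<Sum>v\<in>?V. if P C v then 1 else 0)"
      using finV by (intro sum.cong refl) (simp add: sum.If_cases Int_def)
    also have "\<dots> = (\<Sum>v\<in>?V. \<Sum>C\<in>K. if P C v then 1 else 0)" by (rule sum.swap)
    also have "\<dots> = (\<Sum>v\<in>?V. card {C \<in> K. P C v})"
      using finK by (intro sum.cong refl) (simp add: sum.If_cases Int_def)
    finally show ?thesis .
  qed
  have "(\<Sum>C\<in>K. card (verts C)) = (\<Sum>C\<in>K. card {v \<in> ?V. v \<in> verts C})"
    by (intro sum.cong arg_cong[where f = card]) auto
  then have s1: "(\<Sum>C\<in>K. card (verts C)) = (\<Sum>v\<in>?V. d v)"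
    using swap[of "\<lambda>C v. v \<in> verts C"] by (simp add: d_def)
  have "(\<Sum>C\<in>K. card (shared K C)) = (\<Sum>C\<in>K. card {v \<in> ?V. v \<in> shared K C})"
    by (intro sum.cong arg_cong[where f = card]) (auto simp: shared_def)
  then have s2: "(\<Sum>C\<in>K. card (shared K C)) = (\<Sum>v\<in>?V. card {C \<in> K. v \<in> shared K C})"
    using swap[of "\<lambda>C v. v \<in> shared K C"] by simp
  have "2 + card {C \<in> K. v \<in> shared K C} \<le> 2 * d v" if v: "v \<in> ?V" for v
  proof -
    obtain C where C: "C \<in> K" "v \<in> verts C" using v by (rule UN_E)
    have le: "card {C \<in> K. v \<in> shared K C} \<le> d v"
      unfolding d_def using finK by (intro card_mono) (auto simp: shared_def)
    have d1: "d v \<ge> 1"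
    proof -
      have "C \<in> {C \<in> K. v \<in> verts C}" "finite {C \<in> K. v \<in> verts C}" using C finK by auto
      then have "0 < card {C \<in> K. v \<in> verts C}" using card_gt_0_iff by blast
      then show ?thesis by (simp add: d_def)
    qed
    show ?thesis
    proof (cases "d v = 1")
      case True
      then obtain D where "{C \<in> K. v \<in> verts C} = {D}" unfolding d_def by (rule card_1_singletonE)
      then have "E = D" if "E \<in> K" "v \<in> verts E" for E using that by blast
      then have "{C \<in> K. v \<in> shared K C} = {}" unfolding shared_def by blast
      then show ?thesis using True by (simp only: card.empty)
    next
      case False
      then show ?thesis using le d1 by linarith
    qed
  qed
  then have "(\<Sum>v\<in>?V. 2 + card {C \<in> K. v \<in> shared K C}) \<le> (\<Sum>v\<in>?V. 2 * d v)" by (rule sum_mono)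
  then have "2 * card ?V + (\<Sum>v\<in>?V. card {C \<in> K. v \<in> shared K C}) \<le> 2 * (\<Sum>v\<in>?V. d v)"
    unfolding sum.distrib sum_distrib_left[symmetric] sum_constant by (simp add: mult.commute)
  then show ?thesis by (simp only: s1 s2)
qed

text \<open>The combinatorial core of the theorem. Pruning a block with one shared vertex changes
  both sides by the same amount. When nothing can be pruned, every block has at least as many shared vertices as
  leaves.\<close>

lemma block_exponent:
  assumes "blocks t h K" "K \<noteq> {}" "connected (join t h K)" "balanced (join t h K)"
  shows "(\<forall>J\<subseteq>K. \<not> is_core J) \<Longrightarrow>
      (\<Sum>C\<in>K. card (verts C)) + 1 = card (\<Union>C\<in>K. verts C) + card K \<and> (\<forall>C\<in>K. balanced C)"
    and "(\<exists>J\<subseteq>K. is_core J) \<Longrightarrow>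
      2 * card (\<Union>C\<in>K. verts C) + (\<Sum>C\<in>K. leaves C) \<le> 2 * (\<Sum>C\<in>K. card (verts C))"
  using assms
proof (atomize (full), induct "card K" arbitrary: K rule: less_induct)
  case less
  show ?case
  proof -
    note K = less.prems(1) and ne = less.prems(2) and con = less.prems(3) and bal = less.prems(4)
    have finK: "finite K" using blocks_finite[OF K] .
    consider C where "K = {C}" | C where "C \<in> K" "K \<noteq> {C}" "card (shared K C) \<le> 1"
      | "\<forall>C\<in>K. 2 \<le> card (shared K C)"
    proof (cases "\<forall>C\<in>K. 2 \<le> card (shared K C)")
      case False
      then obtain C where C: "C \<in> K" "\<not> 2 \<le> card (shared K C)" by metis
      then have "card (shared K C) \<le> 1" by linarith
      then show ?thesis using that(1,2)[of C] C(1) by metis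
    qed
    then show "((\<forall>J\<subseteq>K. \<not> is_core J) \<longrightarrow>
          (\<Sum>C\<in>K. card (verts C)) + 1 = card (\<Union>C\<in>K. verts C) + card K \<and> (\<forall>C\<in>K. balanced C)) \<and>
       ((\<exists>J\<subseteq>K. is_core J) \<longrightarrow>
          2 * card (\<Union>C\<in>K. verts C) + (\<Sum>C\<in>K. leaves C) \<le> 2 * (\<Sum>C\<in>K. card (verts C)))"
    proof cases
      case (1 C)
      have "\<not> is_core J" if "J \<subseteq> K" for J
        using that 1 by (auto simp: is_core_def shared_def subset_singleton_iff)
      moreover have "balanced C"
        using bal blocksD(3,4)[OF K] 1 by (auto simp: balanced_def)
      ultimately show ?thesis using 1 by auto
    next
      case (2 C)
      have "shared K C \<noteq> {}" by (rule shared_nonempty[OF K con 2(1,2)])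
      moreover have "finite (shared K C)" using blocksD(6)[OF K 2(1)] by (simp add: shared_def)
      ultimately have "card (shared K C) = 1" using 2(3) card_gt_0_iff[of "shared K C"] by linarith
      then obtain x where x: "shared K C = {x}" by (rule card_1_singletonE)
      note pr = prune_block[OF K con bal 2(1,2) x]
      have K': "blocks t h (K - {C})" by (rule blocks_subset[OF K Diff_subset])
      have ne': "K - {C} \<noteq> {}" using 2(2) ne by auto
      have cK: "card K = card (K - {C}) + 1" using card_Suc_Diff1[OF finK 2(1)] by simp
      then have less': "card (K - {C}) < card K" by simp
      have core: "(\<exists>J\<subseteq>K. is_core J) \<longleftrightarrow> (\<exists>J\<subseteq>K - {C}. is_core J)"
        using core_avoids_pruned[OF K 2(1,3)] by blast
      have leafC: "leaves C = 2" using balanced_leaves blocksD[OF K 2(1)] pr(3) by blast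
      have sums: "(\<Sum>D\<in>K. f D) = (\<Sum>D\<in>K - {C}. f D) + f C" for f :: "_ \<Rightarrow> nat"
        using sum.remove[OF finK 2(1), of f] by simp
      note IH = less.hyps[OF less' K' ne' pr(1,2)]
      show ?thesis
      proof (intro conjI impI)
        assume no: "\<forall>J\<subseteq>K. \<not> is_core J"
        then have "\<forall>J\<subseteq>K - {C}. \<not> is_core J" using core by blast
        then have *: "(\<Sum>C\<in>K - {C}. card (verts C)) + 1 = card (\<Union>C\<in>K - {C}. verts C) + card (K - {C})"
          and b: "\<forall>D\<in>K - {C}. balanced D" using IH by auto
        show "(\<Sum>C\<in>K. card (verts C)) + 1 = card (\<Union>C\<in>K. verts C) + card K"
          using * pr(4) sums[of "\<lambda>D. card (verts D)"] cK by linarith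
        show "\<forall>D\<in>K. balanced D" using b pr(3) by blast
      next
        assume "\<exists>J\<subseteq>K. is_core J"
        then have "\<exists>J\<subseteq>K - {C}. is_core J" using core by blast
        then have *: "2 * card (\<Union>C\<in>K - {C}. verts C) + (\<Sum>C\<in>K - {C}. leaves C)
            \<le> 2 * (\<Sum>C\<in>K - {C}. card (verts C))" using IH by auto
        show "2 * card (\<Union>C\<in>K. verts C) + (\<Sum>C\<in>K. leaves C) \<le> 2 * (\<Sum>C\<in>K. card (verts C))"
          using * pr(4) sums[of "\<lambda>D. card (verts D)"] sums[of leaves] leafC by linarith
      qed
    next
      case 3
      have "is_core K" using 3 ne by (simp add: is_core_def)
      moreover have "(\<Sum>C\<in>K. leaves C) \<le> (\<Sum>C\<in>K. card (shared K C))"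
        using 3 leaves_le_shared[OF K bal] by (intro sum_mono) simp
      ultimately show ?thesis using sum_card_verts_shared[OF K] by auto
    qed
  qed
qed

section \<open>Undirected trees\<close>

text \<open>The recursive description of a walk, unfolded to statements about its \<open>i\<close>-th arc.\<close>

lemma cas_indices:
  assumes "pre_digraph.cas G u c v"
  shows "Suc i < length c \<Longrightarrow> head G (c ! i) = tail G (c ! Suc i)"
    and "c \<noteq> [] \<Longrightarrow> tail G (c ! 0) = u"
    and "c \<noteq> [] \<Longrightarrow> head G (last c) = v"
    and "pre_digraph.awalk_verts G u c = u # map (head G) c"
  using assms
proof (atomize (full), induct c arbitrary: u i)
  case Nil
  then show ?case by (simp add: pre_digraph.cas.simps pre_digraph.awalk_verts.simps)
next
  case (Cons a c)
  then have a: "tail G a = u" and c: "pre_digraph.cas G (head G a) c v"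
    by (simp_all add: pre_digraph.cas.simps)
  have v0: "c = [] \<Longrightarrow> head G a = v" using c by (simp add: pre_digraph.cas.simps)
  from Cons.hyps[OF c] show ?case
    using a v0 by (cases i) (auto simp: pre_digraph.awalk_verts.simps)
qed

text \<open>A finite simple graph has a cycle iff some nonempty set of its vertices spans a subgraph of
  minimal degree at least two; this condition avoids walks and is easy to translate to blocks.\<close>

definition two_core :: "('a \<times> 'a) set \<Rightarrow> 'a set \<Rightarrow> bool" where
  "two_core R X \<longleftrightarrow> X \<noteq> {} \<and> (\<forall>x\<in>X. \<exists>y\<in>X. \<exists>z\<in>X. y \<noteq> z \<and> (x, y) \<in> R \<and> (x, z) \<in> R)"

text \<open>The predecessor and the successor of a vertex on the cycle are different vertices because the
  length is at least three.\<close>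

lemma cycle_imp_two_core:
  assumes sym: "sym (parcs P)" and cyc: "pre_digraph.cycle (with_proj P) c" and len: "3 \<le> length c"
  shows "two_core (parcs P) (snd ` set c)"
proof -
  obtain u where aw: "pre_digraph.awalk (with_proj P) u c u"
    and dist: "distinct (tl (pre_digraph.awalk_verts (with_proj P) u c))"
    using cyc by (auto simp: pre_digraph.cycle_def)
  then have cas: "pre_digraph.cas (with_proj P) u c u" and sub: "set c \<subseteq> parcs P"
    by (auto simp: pre_digraph.awalk_def)
  define n where "n = length c"
  define s where "s i = snd (c ! (i mod n))" for i
  have n3: "3 \<le> n" using len by (simp add: n_def)
  then have n_pos: "0 < n" by simp
  have dist': "distinct (map snd c)" using dist cas_indices(4)[OF cas] by (simp add: with_proj_def)
  have s_inj: "s i = s j \<longleftrightarrow> i mod n = j mod n" for i j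
  proof -
    have "i mod n < length (map snd c)" "j mod n < length (map snd c)"
      using n_pos by (simp_all add: n_def[symmetric])
    then show ?thesis using nth_eq_iff_index_eq[OF dist', of "i mod n" "j mod n"] by (simp add: s_def)
  qed
  have step: "(s i, s (Suc i)) \<in> parcs P" for i
  proof -
    have "c ! (Suc i mod n) \<in> set c" using n_pos by (intro nth_mem) (simp add: n_def[symmetric])
    moreover have "fst (c ! (Suc i mod n)) = snd (c ! (i mod n))"
    proof (cases "Suc (i mod n) = n")
      case True
      then have "Suc i mod n = 0" by (simp add: mod_Suc)
      moreover have "c ! (i mod n) = last c"
        using True n3 by (metis diff_Suc_1 last_conv_nth len list.size(3) n_def not_numeral_le_zero)
      moreover have "c \<noteq> []" using len by auto
      ultimately show ?thesis using cas_indices(2,3)[OF cas] by (simp add: with_proj_def)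
    next
      case False
      then have "Suc i mod n = Suc (i mod n)" by (simp add: mod_Suc)
      moreover have "Suc (i mod n) < length c"
        using False n3 by (metis Suc_lessI mod_less_divisor n_def not_numeral_le_zero gr0I)
      ultimately show ?thesis using cas_indices(1)[OF cas] by (simp add: with_proj_def)
    qed
    ultimately show ?thesis using sub unfolding s_def by (metis prod.collapse subsetD)
  qed
  have s_in: "s i \<in> snd ` set c" for i
    unfolding s_def using n_pos by (intro imageI nth_mem) (simp add: n_def[symmetric])
  have ex: "\<exists>i. x = s i" if x: "x \<in> snd ` set c" for x
  proof -
    obtain e where "x = snd e" "e \<in> set c" using x by (rule imageE)
    then obtain i where "i < n" "x = snd (c ! i)" by (auto simp: in_set_conv_nth n_def)
    then have "x = s i" by (simp add: s_def)
    then show ?thesis by blast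
  qed
  show ?thesis unfolding two_core_def
  proof (intro conjI ballI)
    show "snd ` set c \<noteq> {}" using s_in[of 0] by auto
    fix x assume "x \<in> snd ` set c"
    then obtain i where i: "x = s i" using ex by blast
    have pred: "s (Suc (i + (n - 1))) = s i" using n3 by (simp add: s_inj)
    have ne: "s (Suc i) \<noteq> s (i + (n - 1))"
    proof
      assume "s (Suc i) = s (i + (n - 1))"
      then have "(i + 1) mod n = (i + (n - 1)) mod n" by (simp add: s_inj)
      moreover have "i + 1 \<le> i + (n - 1)" using n3 by simp
      ultimately have "n dvd (i + (n - 1)) - (i + 1)" using mod_eq_dvd_iff_nat by metis
      moreover have "(i + (n - 1)) - (i + 1) = n - 2" by simp
      ultimately have "n dvd n - 2" by metis
      moreover have "0 < n - 2" "n - 2 < n" using n3 by simp_all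
      ultimately show False using nat_dvd_not_less by blast
    qed
    have "(s (i + (n - 1)), s i) \<in> parcs P" using step[of "i + (n - 1)"] unfolding pred .
    then have "(s i, s (i + (n - 1))) \<in> parcs P" using sym by (meson symD)
    then show "\<exists>y\<in>snd ` set c. \<exists>z\<in>snd ` set c. y \<noteq> z \<and> (x, y) \<in> parcs P \<and> (x, z) \<in> parcs P"
      using step[of i] ne s_in i by blast
  qed
qed

lemma successively_awalk:
  assumes wf: "parcs P \<subseteq> pverts P \<times> pverts P" and x: "x \<in> pverts P"
    and suc: "successively (\<lambda>a b. (a, b) \<in> parcs P) (x # ys)"
  shows "pre_digraph.awalk (with_proj P) x (zip (x # ys) ys) (last (x # ys)) \<and>
    pre_digraph.awalk_verts (with_proj P) x (zip (x # ys) ys) = x # ys"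
  using x suc
proof (induct ys arbitrary: x)
  case Nil
  then show ?case by (simp add: pre_digraph.awalk_def pre_digraph.cas.simps
        pre_digraph.awalk_verts.simps with_proj_def)
next
  case (Cons y ys)
  then have xy: "(x, y) \<in> parcs P" and "successively (\<lambda>a b. (a, b) \<in> parcs P) (y # ys)" by auto
  moreover have "y \<in> pverts P" using xy wf by blast
  ultimately have "pre_digraph.awalk (with_proj P) y (zip (y # ys) ys) (last (y # ys)) \<and>
    pre_digraph.awalk_verts (with_proj P) y (zip (y # ys) ys) = y # ys" using Cons(1) by blast
  then show ?case using xy Cons(2)
    by (auto simp: pre_digraph.awalk_def pre_digraph.cas.simps
        pre_digraph.awalk_verts.simps with_proj_def)
qed

text \<open>All neighbours of the first vertex of a longest path lie on the path, so one of them closes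
  a cycle.\<close>

lemma two_core_imp_cycle:
  assumes wf: "parcs P \<subseteq> pverts P \<times> pverts P" and sym: "sym (parcs P)" and irr: "irrefl (parcs P)"
    and X: "finite X" "two_core (parcs P) X"
  shows "\<exists>c. pre_digraph.cycle (with_proj P) c \<and> 3 \<le> length c"
proof -
  let ?R = "\<lambda>a b. (a, b) \<in> parcs P"
  define Q where "Q xs \<longleftrightarrow> xs \<noteq> [] \<and> distinct xs \<and> set xs \<subseteq> X \<and> successively ?R xs" for xs
  obtain x where "x \<in> X" using X(2) by (auto simp: two_core_def)
  then have "Q [x]" by (simp add: Q_def)
  moreover have "\<forall>xs. Q xs \<longrightarrow> length xs < Suc (card X)"
    unfolding Q_def using X(1) by (metis card_mono distinct_card less_Suc_eq_le)
  ultimately obtain xs where xs: "Q xs" and max: "\<And>ys. Q ys \<Longrightarrow> length ys \<le> length xs"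
    using ex_has_greatest_nat[of Q "[x]" length "Suc (card X)"] by blast
  obtain a ys where ays: "xs = a # ys" using xs by (cases xs) (auto simp: Q_def)
  have aX: "a \<in> X" using xs ays by (simp add: Q_def)
  then obtain y z where yz: "y \<in> X" "z \<in> X" "y \<noteq> z" "(a, y) \<in> parcs P" "(a, z) \<in> parcs P"
    using X(2) unfolding two_core_def by metis
  have on: "w \<in> set ys" if w: "w \<in> X" "(a, w) \<in> parcs P" for w
  proof (rule ccontr)
    assume "w \<notin> set ys"
    moreover have "w \<noteq> a" using w irr by (auto simp: irrefl_def)
    moreover have "(w, a) \<in> parcs P" using w sym by (meson symD)
    ultimately have "Q (w # xs)" using xs w ays by (auto simp: Q_def)
    then show False using max[of "w # xs"] by simp
  qed
  obtain i where i: "i < length ys" "ys ! i = y" using on[OF yz(1,4)] by (auto simp: in_set_conv_nth)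
  obtain j where j: "j < length ys" "ys ! j = z" using on[OF yz(2,5)] by (auto simp: in_set_conv_nth)
  have "i \<noteq> j" using i j yz by auto
  then have "1 \<le> i \<or> 1 \<le> j" by linarith
  then obtain k where k: "1 \<le> k" "k < length ys" "(a, ys ! k) \<in> parcs P"
    using i j yz by metis
  define zs where "zs = take (Suc k) ys"
  have lz: "length zs = Suc k" using k by (simp add: zs_def)
  have last: "last (a # zs) = ys ! k" using k lz by (auto simp: zs_def last_conv_nth)
  have "successively ?R (a # zs)"
  proof -
    have "successively ?R (a # ys)" using xs ays by (simp add: Q_def)
    moreover have "a # ys = (a # zs) @ drop (Suc k) ys" by (simp add: zs_def)
    ultimately show ?thesis by (metis successively_append_iff)
  qed
  moreover have "(ys ! k, a) \<in> parcs P" using k sym by (meson symD)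
  ultimately have suc: "successively ?R (a # zs @ [a])"
    using last by (metis append_Cons successively_append_iff successively.simps(2) list.sel(1) list.discI hd_Cons_tl)
  have "a \<in> pverts P" using yz wf by blast
  from successively_awalk[OF wf this suc]
  have aw: "pre_digraph.awalk (with_proj P) a (zip (a # zs @ [a]) (zs @ [a])) a"
    and av: "pre_digraph.awalk_verts (with_proj P) a (zip (a # zs @ [a]) (zs @ [a])) = a # zs @ [a]"
    by auto
  have "distinct (a # ys)" using xs ays by (simp add: Q_def)
  then have "distinct (zs @ [a])" using set_take_subset[of "Suc k" ys] by (auto simp: zs_def)
  moreover have len: "length (zip (a # zs @ [a]) (zs @ [a])) = k + 2" using lz by simp
  moreover have "zip (a # zs @ [a]) (zs @ [a]) \<noteq> []" using len by (metis list.size(3) add_is_0 zero_neq_numeral)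
  ultimately have "pre_digraph.cycle (with_proj P) (zip (a # zs @ [a]) (zs @ [a]))"
    unfolding pre_digraph.cycle_def using aw av by (metis list.sel(3))
  then show ?thesis using len k by (intro exI[of _ "zip (a # zs @ [a]) (zs @ [a])"]) auto
qed

text \<open>The reduced graph of a test graph, for an arbitrary family of blocks.\<close>

definition incidence_graph :: "('a, 'b) pre_digraph set \<Rightarrow> (('a, 'b) pre_digraph + 'a) pair_pre_digraph" where
  "incidence_graph K =
     (let L = {v. \<exists>C\<in>K. \<exists>D\<in>K. C \<noteq> D \<and> v \<in> verts C \<and> v \<in> verts D}
      in \<lparr> pverts = Inl ` K \<union> Inr ` L,
           parcs = {(Inl C, Inr v) | C v. C \<in> K \<and> v \<in> L \<and> v \<in> verts C} \<rparr>)"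

text \<open>Consider a set of nodes without boundary. With a block it contains every block that meets
  this block, so the vertices covered by its blocks have no boundary in the connected whole.\<close>

lemma incidence_graph_connected:
  assumes K: "blocks t h K" "K \<noteq> {}" and con: "connected (join t h K)"
  shows "connected (with_proj (incidence_graph K))"
proof -
  let ?G = "with_proj (incidence_graph K)"
  define L where "L = {v. \<exists>C\<in>K. \<exists>D\<in>K. C \<noteq> D \<and> v \<in> verts C \<and> v \<in> verts D}"
  have V: "verts ?G = Inl ` K \<union> Inr ` L"
    and A: "arcs ?G = {(Inl C, Inr v) | C v. C \<in> K \<and> v \<in> L \<and> v \<in> verts C}"
    and th: "tail ?G = fst" "head ?G = snd"
    by (simp_all add: incidence_graph_def L_def Let_def)
  have wf: "wf_digraph ?G" unfolding wf_digraph_def V A th by auto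
  have "S = verts ?G" if S: "S \<subseteq> verts ?G" "S \<noteq> {}" "boundary ?G S = {}" for S
  proof -
    have link: "Inl C \<in> S \<longleftrightarrow> Inr v \<in> S" if "C \<in> K" "v \<in> L" "v \<in> verts C" for C v
    proof -
      have "(Inl C, Inr v) \<in> arcs ?G" using that A by auto
      moreover have "(Inl C, Inr v) \<notin> boundary ?G S" using S by simp
      ultimately show ?thesis by (simp add: boundary_def)
    qed
    have meet: "Inl C \<in> S \<longleftrightarrow> Inl D \<in> S" if "C \<in> K" "D \<in> K" "v \<in> verts C" "v \<in> verts D" for C D v
    proof (cases "C = D")
      case False
      then have "v \<in> L" using that by (auto simp: L_def)
      then show ?thesis using link[of C v] link[of D v] that by simp
    qed simp
    define U where "U = (\<Union>C\<in>{C \<in> K. Inl C \<in> S}. verts C)"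
    have inU: "v \<in> U \<longleftrightarrow> Inl C \<in> S" if "C \<in> K" "v \<in> verts C" for C v
    proof
      assume "v \<in> U"
      then obtain D where "D \<in> K" "Inl D \<in> S" "v \<in> verts D" unfolding U_def by blast
      then show "Inl C \<in> S" using meet[of C D v] that by simp
    next
      assume "Inl C \<in> S"
      then show "v \<in> U" using that unfolding U_def by blast
    qed
    have "boundary (join t h K) U = {}"
    proof (rule ccontr)
      assume "boundary (join t h K) U \<noteq> {}"
      then obtain e C where e: "C \<in> K" "e \<in> arcs C" "(t e \<in> U) \<noteq> (h e \<in> U)"
        by (auto simp: boundary_def)
      then show False using inU[OF e(1), of "t e"] inU[OF e(1), of "h e"] blocksD(9,10)[OF K(1) e(1,2)]
        by simp
    qed
    moreover have "U \<noteq> {}"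
    proof -
      have "\<exists>C\<in>K. Inl C \<in> S"
      proof -
        obtain x where x: "x \<in> S" using S by blast
        show ?thesis
        proof (cases x)
          case (Inl C)
          then show ?thesis using x S V by blast
        next
          case (Inr v)
          then have "v \<in> L" using x S V by blast
          then obtain C where "C \<in> K" "v \<in> verts C" by (auto simp: L_def)
          then show ?thesis using link[of C v] \<open>v \<in> L\<close> Inr x by blast
        qed
      qed
      then obtain C where C: "C \<in> K" "Inl C \<in> S" by blast
      then obtain v where "v \<in> verts C" using blocksD(8)[OF K(1)] by blast
      then show ?thesis using C by (auto simp: U_def)
    qed
    ultimately have Uall: "U = (\<Union>C\<in>K. verts C)"
      using connectedD_boundary[OF con join_fin_digraph(2)[OF K(1)], of U] by (auto simp: U_def)
    have l: "Inl C \<in> S" if C: "C \<in> K" for C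
    proof -
      obtain v where "v \<in> verts C" using blocksD(8)[OF K(1) C] by blast
      then show ?thesis using inU[OF C, of v] Uall C by blast
    qed
    have r: "Inr v \<in> S" if v: "v \<in> L" for v
    proof -
      obtain C where "C \<in> K" "v \<in> verts C" using v by (auto simp: L_def)
      then show ?thesis using link[of C v] l v by blast
    qed
    show ?thesis using S(1) l r unfolding V by auto
  qed
  moreover have "verts ?G \<noteq> {}" using K(2) V by auto
  ultimately show ?thesis unfolding connected_iff_boundary[OF wf] by blast
qed

text \<open>The blocks in a set of nodes of minimal degree two form a core, and conversely a core and its
  shared vertices span such a set.\<close>

lemma incidence_graph_tree_iff:
  assumes K: "blocks t h K" "K \<noteq> {}" and con: "connected (join t h K)"
  shows "undirected_tree (incidence_graph K) \<longleftrightarrow> (\<forall>J\<subseteq>K. \<not> is_core J)"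
proof -
  let ?G = "mk_symmetric (with_proj (incidence_graph K))"
  define L where "L = {v. \<exists>C\<in>K. \<exists>D\<in>K. C \<noteq> D \<and> v \<in> verts C \<and> v \<in> verts D}"
  have V: "pverts ?G = Inl ` K \<union> Inr ` L"
    by (simp add: mk_symmetric_def incidence_graph_def L_def Let_def)
  have A: "parcs ?G = {(Inl C, Inr v) | C v. C \<in> K \<and> v \<in> L \<and> v \<in> verts C} \<union>
      {(Inr v, Inl C) | C v. C \<in> K \<and> v \<in> L \<and> v \<in> verts C}"
  proof -
    have A0: "parcs (incidence_graph K) = {(Inl C, Inr v) | C v. C \<in> K \<and> v \<in> L \<and> v \<in> verts C}"
      by (simp add: incidence_graph_def L_def Let_def)
    have "parcs ?G = parcs (incidence_graph K) \<union> (parcs (incidence_graph K))\<inverse>"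
      by (auto simp: mk_symmetric_def)
    then show ?thesis unfolding A0 by auto
  qed
  have sym: "sym (parcs ?G)" and irr: "irrefl (parcs ?G)"
    and wf: "parcs ?G \<subseteq> pverts ?G \<times> pverts ?G"
    unfolding A V by (auto simp: sym_def irrefl_def)
  have finv: "finite (verts C)" if "C \<in> K" for C using blocksD(6)[OF K(1) that] .
  have "\<exists>J\<subseteq>K. is_core J" if X: "two_core (parcs ?G) X" for X
  proof -
    have nb: "\<exists>y\<in>X. \<exists>z\<in>X. y \<noteq> z \<and> (x, y) \<in> parcs ?G \<and> (x, z) \<in> parcs ?G" if "x \<in> X" for x
      using X that by (simp add: two_core_def)
    define J where "J = {C. Inl C \<in> X}"
    have nbl: "\<exists>v w. v \<noteq> w \<and> Inr v \<in> X \<and> Inr w \<in> X \<and> v \<in> verts C \<and> w \<in> verts C \<and> C \<in> K"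
      if "C \<in> J" for C
    proof -
      have "Inl C \<in> X" using that by (simp add: J_def)
      from nb[OF this] show ?thesis unfolding A by auto
    qed
    have nbr: "\<exists>D E. D \<noteq> E \<and> D \<in> J \<and> E \<in> J \<and> v \<in> verts D \<and> v \<in> verts E" if "Inr v \<in> X" for v
      using nb[OF that] unfolding A J_def by auto
    have JK: "J \<subseteq> K" using nbl by blast
    have "J \<noteq> {}"
    proof -
      obtain x where x: "x \<in> X" using X by (auto simp: two_core_def)
      show ?thesis
      proof (cases x)
        case (Inl C)
        then show ?thesis using x by (auto simp: J_def)
      next
        case (Inr v)
        then show ?thesis using nbr[of v] x by blast
      qed
    qed
    moreover have "2 \<le> card (shared J C)" if C: "C \<in> J" for C
    proof -
      have sh: "v \<in> shared J C" if v: "Inr v \<in> X" "v \<in> verts C" for v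
        using nbr[OF v(1)] v(2) unfolding shared_def by blast
      obtain v w where vw: "v \<noteq> w" "Inr v \<in> X" "Inr w \<in> X" "v \<in> verts C" "w \<in> verts C"
        using nbl[OF C] by blast
      then have "{v, w} \<subseteq> shared J C" using sh by simp
      moreover have "finite (shared J C)" using finv C JK by (auto simp: shared_def)
      ultimately have "card {v, w} \<le> card (shared J C)" by (simp add: card_mono)
      then show ?thesis using vw by simp
    qed
    ultimately show ?thesis using JK by (auto simp: is_core_def)
  qed
  moreover have "\<exists>X. finite X \<and> two_core (parcs ?G) X" if J: "J \<subseteq> K" "is_core J" for J
  proof -
    define X where "X = Inl ` J \<union> Inr ` (\<Union>C\<in>J. shared J C)"
    have finJ: "finite J" using J blocks_finite[OF K(1)] finite_subset by metis
    have "finite (shared J C)" if "C \<in> J" for C using that J finv by (auto simp: shared_def)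
    then have "finite X" using finJ by (simp add: X_def)
    moreover have "two_core (parcs ?G) X" unfolding two_core_def
    proof (intro conjI ballI)
      show "X \<noteq> {}" using J by (auto simp: X_def is_core_def)
      fix x assume "x \<in> X"
      then consider C where "x = Inl C" "C \<in> J" | v C where "x = Inr v" "C \<in> J" "v \<in> shared J C"
        by (auto simp: X_def)
      then show "\<exists>y\<in>X. \<exists>z\<in>X. y \<noteq> z \<and> (x, y) \<in> parcs ?G \<and> (x, z) \<in> parcs ?G"
      proof cases
        case 1
        then have "2 \<le> card (shared J C)" using J by (simp add: is_core_def)
        then obtain v w where vw: "v \<in> shared J C" "w \<in> shared J C" "v \<noteq> w"
          by (meson card_2_iff' obtain_subset_with_card_n subsetD)
        have "(Inl C, Inr u) \<in> parcs ?G" if "u \<in> shared J C" for u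
          using that 1 J(1) unfolding A shared_def L_def by blast
        then have "(x, Inr v) \<in> parcs ?G" "(x, Inr w) \<in> parcs ?G" using vw 1 by auto
        moreover have "Inr v \<in> X" "Inr w \<in> X" using vw 1 unfolding X_def by blast+
        ultimately show ?thesis using vw(3) by blast
      next
        case 2
        then obtain D where D: "D \<in> J" "D \<noteq> C" "v \<in> verts D" "v \<in> verts C"
          by (auto simp: shared_def)
        then have "v \<in> L" using 2 J(1) by (auto simp: L_def)
        then have "(Inr v, Inl C) \<in> parcs ?G" "(Inr v, Inl D) \<in> parcs ?G"
          using D 2 J(1) unfolding A by auto
        moreover have "Inl C \<in> X" "Inl D \<in> X" using D 2 unfolding X_def by blast+
        ultimately show ?thesis using D(2) 2(1) by blast
      qed
    qed
    ultimately show ?thesis by blast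
  qed
  ultimately have core: "(\<exists>J\<subseteq>K. is_core J) \<longleftrightarrow> (\<exists>X. finite X \<and> two_core (parcs ?G) X)" by blast
  have "(\<exists>c. pre_digraph.cycle (with_proj ?G) c \<and> 3 \<le> length c) \<longleftrightarrow> (\<exists>X. finite X \<and> two_core (parcs ?G) X)"
    using cycle_imp_two_core[OF sym] two_core_imp_cycle[OF wf sym irr] by (metis List.finite_set finite_imageI)
  then show ?thesis
    using incidence_graph_connected[OF K con] core by (auto simp: undirected_tree_def)
qed

section \<open>Injective sums and quotients of test graphs\<close>

definition edge_prod :: "('i \<Rightarrow> complex mat) \<Rightarrow> 'i test_graph \<Rightarrow> (nat \<Rightarrow> nat) \<Rightarrow> complex" where
  "edge_prod A T \<phi> = (\<Prod>e\<in>arcs (graph T).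
     letter_mat A (label T e) $$ (\<phi> (tail (graph T) e), \<phi> (head (graph T) e)))"

definition injections :: "nat set \<Rightarrow> nat \<Rightarrow> (nat \<Rightarrow> nat) set" where
  "injections V N = {\<phi>. \<phi> \<in> V \<rightarrow>\<^sub>E {..<N} \<and> inj_on \<phi> V}"

definition inj_sum :: "nat \<Rightarrow> ('i \<Rightarrow> complex mat) \<Rightarrow> 'i test_graph \<Rightarrow> complex" where
  "inj_sum N A T = (\<Sum>\<phi>\<in>injections (verts (graph T)) N. edge_prod A T \<phi>)"

lemma tau0_eq_inj_sum: "tau0 N A T = inj_sum N A T / of_nat N"
  by (simp add: tau0_def inj_sum_def edge_prod_def injections_def)

lemma finite_injections: "finite V \<Longrightarrow> finite (injections V N)"
  unfolding injections_def by (rule finite_subset[of _ "V \<rightarrow>\<^sub>E {..<N}"]) (auto intro: finite_PiE)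

definition quotient :: "(nat \<Rightarrow> nat) \<Rightarrow> 'i test_graph \<Rightarrow> 'i test_graph" where
  "quotient f T = T\<lparr>graph := \<lparr>verts = f ` verts (graph T), arcs = arcs (graph T),
     tail = f \<circ> tail (graph T), head = f \<circ> head (graph T)\<rparr>\<rparr>"

lemma quotient_simps [simp]:
  "verts (graph (quotient f T)) = f ` verts (graph T)"
  "arcs (graph (quotient f T)) = arcs (graph T)"
  "tail (graph (quotient f T)) = f \<circ> tail (graph T)"
  "head (graph (quotient f T)) = f \<circ> head (graph T)"
  "label (quotient f T) = label T"
  by (simp_all add: quotient_def)

text \<open>An equivalence relation on a finite set of naturals is encoded by the map sending each element
  to the least element of its class.\<close>

definition partition_maps :: "nat set \<Rightarrow> (nat \<Rightarrow> nat) set" where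
  "partition_maps V = {f. f \<in> V \<rightarrow>\<^sub>E V \<and> (\<forall>v\<in>V. f (f v) = f v \<and> f v \<le> v)}"

definition kernel_map :: "nat set \<Rightarrow> (nat \<Rightarrow> nat) \<Rightarrow> nat \<Rightarrow> nat" where
  "kernel_map V \<phi> = (\<lambda>v\<in>V. LEAST w. w \<in> V \<and> \<phi> w = \<phi> v)"

lemma kernel_map:
  assumes "v \<in> V"
  shows "kernel_map V \<phi> v \<in> V" "\<phi> (kernel_map V \<phi> v) = \<phi> v" "kernel_map V \<phi> v \<le> v"
proof -
  have "(LEAST w. w \<in> V \<and> \<phi> w = \<phi> v) \<in> V \<and> \<phi> (LEAST w. w \<in> V \<and> \<phi> w = \<phi> v) = \<phi> v"
    by (rule LeastI[of _ v]) (simp add: assms)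
  moreover have "(LEAST w. w \<in> V \<and> \<phi> w = \<phi> v) \<le> v" by (rule Least_le) (simp add: assms)
  ultimately show "kernel_map V \<phi> v \<in> V" "\<phi> (kernel_map V \<phi> v) = \<phi> v" "kernel_map V \<phi> v \<le> v"
    using assms by (simp_all add: kernel_map_def)
qed

lemma kernel_map_eq_iff:
  assumes "v \<in> V" "w \<in> V"
  shows "kernel_map V \<phi> v = kernel_map V \<phi> w \<longleftrightarrow> \<phi> v = \<phi> w"
proof
  assume "kernel_map V \<phi> v = kernel_map V \<phi> w"
  then show "\<phi> v = \<phi> w" using kernel_map(2)[OF assms(1)] kernel_map(2)[OF assms(2)] by metis
qed (simp add: kernel_map_def assms)

lemma kernel_map_in_partition_maps: "kernel_map V \<phi> \<in> partition_maps V"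
  unfolding partition_maps_def
proof (intro CollectI conjI ballI)
  show "kernel_map V \<phi> \<in> V \<rightarrow>\<^sub>E V"
    by (intro PiE_I) (simp_all add: kernel_map, simp add: kernel_map_def)
  show "kernel_map V \<phi> (kernel_map V \<phi> v) = kernel_map V \<phi> v" if "v \<in> V" for v
    using kernel_map_eq_iff[of "kernel_map V \<phi> v" V v] kernel_map[OF that] that by simp
  show "kernel_map V \<phi> v \<le> v" if "v \<in> V" for v using kernel_map(3)[OF that] .
qed

lemma partition_mapsD:
  assumes "f \<in> partition_maps V" "v \<in> V"
  shows "f v \<in> V" "f (f v) = f v" "f v \<le> v"
  using assms by (auto simp: partition_maps_def)

lemma finite_partition_maps: "finite V \<Longrightarrow> finite (partition_maps V)"
  unfolding partition_maps_def by (rule finite_subset[of _ "V \<rightarrow>\<^sub>E V"]) (auto intro: finite_PiE)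

lemma kernel_map_of_composition:
  assumes f: "f \<in> partition_maps V" and \<psi>: "inj_on \<psi> (f ` V)"
  shows "kernel_map V (restrict (\<psi> \<circ> f) V) = f"
proof
  fix v
  show "kernel_map V (restrict (\<psi> \<circ> f) V) v = f v"
  proof (cases "v \<in> V")
    case True
    have iff: "\<psi> (f w) = \<psi> (f v) \<longleftrightarrow> f w = f v" if "w \<in> V" for w
      using \<psi> that True by (auto simp: inj_on_def)
    have "(LEAST w. w \<in> V \<and> restrict (\<psi> \<circ> f) V w = restrict (\<psi> \<circ> f) V v) = f v"
    proof (rule Least_equality)
      show "f v \<in> V \<and> restrict (\<psi> \<circ> f) V (f v) = restrict (\<psi> \<circ> f) V v"
        using partition_mapsD[OF f True] True by simp
      fix w assume "w \<in> V \<and> restrict (\<psi> \<circ> f) V w = restrict (\<psi> \<circ> f) V v"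
      then have "w \<in> V" "f w = f v" using iff[of w] True by auto
      then show "f v \<le> w" using partition_mapsD(3)[OF f, of w] by simp
    qed
    then show ?thesis using True by (simp add: kernel_map_def)
  next
    case False
    then show ?thesis using f by (simp add: kernel_map_def partition_maps_def PiE_def extensional_def)
  qed
qed

text \<open>Every map factors uniquely as the projection to the classes of its kernel, followed by an
  injection of the set of class representatives.\<close>

lemma sum_PiE_by_kernel:
  assumes fin: "finite V"
  shows "(\<Sum>\<phi>\<in>V \<rightarrow>\<^sub>E {..<N}. g \<phi>) =
    (\<Sum>f\<in>partition_maps V. \<Sum>\<psi>\<in>injections (f ` V) N. g (restrict (\<psi> \<circ> f) V))"
proof -
  have "(\<Sum>f\<in>partition_maps V. \<Sum>\<psi>\<in>injections (f ` V) N. g (restrict (\<psi> \<circ> f) V)) =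
      (\<Sum>(f, \<psi>)\<in>Sigma (partition_maps V) (\<lambda>f. injections (f ` V) N). g (restrict (\<psi> \<circ> f) V))"
    using fin by (intro sum.Sigma) (auto intro: finite_partition_maps finite_injections)
  also have "\<dots> = (\<Sum>\<phi>\<in>V \<rightarrow>\<^sub>E {..<N}. g \<phi>)"
  proof (rule sum.reindex_bij_witness[where
        i = "\<lambda>\<phi>. (kernel_map V \<phi>, restrict \<phi> (kernel_map V \<phi> ` V))" and
        j = "\<lambda>(f, \<psi>). restrict (\<psi> \<circ> f) V"])
    fix p assume "p \<in> Sigma (partition_maps V) (\<lambda>f. injections (f ` V) N)"
    then obtain f \<psi> where p: "p = (f, \<psi>)" and f: "f \<in> partition_maps V"
      and \<psi>: "\<psi> \<in> injections (f ` V) N" by auto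
    have inj: "inj_on \<psi> (f ` V)" and ran: "\<psi> \<in> f ` V \<rightarrow>\<^sub>E {..<N}"
      using \<psi> by (auto simp: injections_def)
    have k: "kernel_map V (restrict (\<psi> \<circ> f) V) = f" by (rule kernel_map_of_composition[OF f inj])
    have "restrict (restrict (\<psi> \<circ> f) V) (f ` V) = \<psi>"
    proof
      fix x show "restrict (restrict (\<psi> \<circ> f) V) (f ` V) x = \<psi> x"
        using partition_mapsD[OF f] PiE_arb[OF ran, of x] by (cases "x \<in> f ` V") auto
    qed
    then show "(kernel_map V (case p of (f, \<psi>) \<Rightarrow> restrict (\<psi> \<circ> f) V),
        restrict (case p of (f, \<psi>) \<Rightarrow> restrict (\<psi> \<circ> f) V)
          (kernel_map V (case p of (f, \<psi>) \<Rightarrow> restrict (\<psi> \<circ> f) V) ` V)) = p"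
      using k p by simp
    show "(case p of (f, \<psi>) \<Rightarrow> restrict (\<psi> \<circ> f) V) \<in> V \<rightarrow>\<^sub>E {..<N}"
      using ran p by auto
    show "g (case p of (f, \<psi>) \<Rightarrow> restrict (\<psi> \<circ> f) V) = (case p of (f, \<psi>) \<Rightarrow> g (restrict (\<psi> \<circ> f) V))"
      using p by simp
  next
    fix \<phi> assume \<phi>: "\<phi> \<in> V \<rightarrow>\<^sub>E {..<N}"
    let ?k = "kernel_map V \<phi>"
    have "inj_on \<phi> (?k ` V)"
    proof (rule inj_onI)
      fix x y assume xy: "x \<in> ?k ` V" "y \<in> ?k ` V" "\<phi> x = \<phi> y"
      then obtain v w where "x = ?k v" "y = ?k w" "v \<in> V" "w \<in> V" by auto
      then show "x = y" using xy(3) kernel_map(2) kernel_map_eq_iff by metis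
    qed
    then have "inj_on (restrict \<phi> (?k ` V)) (?k ` V)" by (simp add: inj_on_restrict_eq)
    moreover have "restrict \<phi> (?k ` V) \<in> ?k ` V \<rightarrow>\<^sub>E {..<N}"
      using \<phi> kernel_map(1) by (auto simp: PiE_iff)
    ultimately show "(?k, restrict \<phi> (?k ` V)) \<in> Sigma (partition_maps V) (\<lambda>f. injections (f ` V) N)"
      using kernel_map_in_partition_maps by (auto simp: injections_def)
    show "(case (?k, restrict \<phi> (?k ` V)) of (f, \<psi>) \<Rightarrow> restrict (\<psi> \<circ> f) V) = \<phi>"
    proof
      fix x show "(case (?k, restrict \<phi> (?k ` V)) of (f, \<psi>) \<Rightarrow> restrict (\<psi> \<circ> f) V) x = \<phi> x"
        using kernel_map(2)[of x V \<phi>] PiE_arb[OF \<phi>, of x] by (cases "x \<in> V") auto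
    qed
  qed
  finally show ?thesis by simp
qed

lemma edge_prod_cong:
  assumes "wf_digraph (graph T)" "\<And>v. v \<in> verts (graph T) \<Longrightarrow> \<phi> v = \<phi>' v"
  shows "edge_prod A T \<phi> = edge_prod A T \<phi>'"
  unfolding edge_prod_def using assms by (intro prod.cong) (auto simp: wf_digraph_def)

lemma edge_prod_quotient:
  assumes "wf_digraph (graph T)"
  shows "edge_prod A T (restrict (\<psi> \<circ> f) (verts (graph T))) = edge_prod A (quotient f T) \<psi>"
proof -
  have "edge_prod A T (restrict (\<psi> \<circ> f) (verts (graph T))) = edge_prod A T (\<psi> \<circ> f)"
    by (rule edge_prod_cong[OF assms]) simp
  also have "\<dots> = edge_prod A (quotient f T) \<psi>" by (simp add: edge_prod_def)
  finally show ?thesis .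
qed

lemma sum_edge_prod_eq_quotients:
  assumes "fin_digraph (graph T)"
  shows "(\<Sum>\<phi>\<in>verts (graph T) \<rightarrow>\<^sub>E {..<N}. edge_prod A T \<phi>) =
    (\<Sum>f\<in>partition_maps (verts (graph T)). inj_sum N A (quotient f T))"
proof -
  interpret fin_digraph "graph T" by fact
  show ?thesis
    unfolding sum_PiE_by_kernel[OF finite_verts] inj_sum_def edge_prod_quotient[OF wf_digraph]
    by simp
qed

text \<open>The partitions that only identify vertices of different components. The trivial one is the
  identity, restricted to the vertices so as to be extensional.\<close>

definition glueings :: "(nat, nat) pre_digraph \<Rightarrow> (nat \<Rightarrow> nat) set" where
  "glueings G = {f \<in> partition_maps (verts G). \<forall>C\<in>components G. inj_on f (verts C)}"

lemma finite_glueings: "fin_digraph G \<Longrightarrow> finite (glueings G)"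
  unfolding glueings_def by (simp add: finite_partition_maps fin_digraph.finite_verts)

definition no_glueing :: "(nat, nat) pre_digraph \<Rightarrow> nat \<Rightarrow> nat" where
  "no_glueing G = (\<lambda>v\<in>verts G. v)"

lemma no_glueing_in_glueings:
  assumes "fin_digraph G" shows "no_glueing G \<in> glueings G"
proof -
  have "inj_on (no_glueing G) (verts C)" if "C \<in> components G" for C
    using components_subgraph(1)[OF that] by (auto simp: no_glueing_def subgraph_def inj_on_def subset_iff)
  then show ?thesis by (auto simp: glueings_def partition_maps_def no_glueing_def)
qed

lemma inj_sum_no_glueing:
  assumes "wf_digraph (graph T)"
  shows "inj_sum N A (quotient (no_glueing (graph T)) T) = inj_sum N A T"
proof -
  have v: "no_glueing (graph T) ` verts (graph T) = verts (graph T)" by (simp add: no_glueing_def)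
  have "edge_prod A (quotient (no_glueing (graph T)) T) \<phi> = edge_prod A T \<phi>" for \<phi>
    unfolding edge_prod_def using assms
    by (intro prod.cong) (auto simp: no_glueing_def wf_digraph_def)
  then show ?thesis by (simp add: inj_sum_def v)
qed

text \<open>A product of injective sums over the components is a sum over maps that are injective on each
  component; sorting these by their kernel expresses it through glued graphs.\<close>

lemma prod_inj_sum_components:
  assumes fin: "fin_digraph (graph T)"
  shows "(\<Prod>C\<in>components (graph T). inj_sum N A (T\<lparr>graph := C\<rparr>)) =
    (\<Sum>f\<in>glueings (graph T). inj_sum N A (quotient f T))"
proof -
  let ?G = "graph T" let ?V = "verts ?G" let ?K = "components ?G"
  interpret fin_digraph ?G by fact
  have finK: "finite ?K" by (rule finite_components[OF fin])
  have finV: "finite (verts C)" if "C \<in> ?K" for C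
    using components_fin[OF fin that] fin_digraph.finite_verts by blast
  have sub: "verts C \<subseteq> ?V" if "C \<in> ?K" for C
    using components_subgraph(1)[OF that] by (simp add: subgraph_def)
  define comp where "comp v = (SOME C. C \<in> ?K \<and> v \<in> verts C)" for v
  have comp: "comp v \<in> ?K \<and> v \<in> verts (comp v)" if v: "v \<in> ?V" for v
  proof -
    obtain C where "C \<in> ?K" "v \<in> verts C" using component_of_vertex[OF fin v] .
    then show ?thesis unfolding comp_def by (intro someI[of "\<lambda>C. C \<in> ?K \<and> v \<in> verts C"]) simp
  qed
  have comp_eq: "comp v = C" if "C \<in> ?K" "v \<in> verts C" for v C
    using components_overlap_eq[of "comp v" ?G C v] comp[of v] sub that by auto
  let ?D = "\<lambda>\<phi>. \<forall>C\<in>?K. inj_on \<phi> (verts C)"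
  have ep: "edge_prod A T \<phi> = (\<Prod>C\<in>?K. edge_prod A (T\<lparr>graph := C\<rparr>) \<phi>)" for \<phi>
  proof -
    have "edge_prod A T \<phi> = (\<Prod>e\<in>(\<Union>C\<in>?K. arcs C).
        letter_mat A (label T e) $$ (\<phi> (tail ?G e), \<phi> (head ?G e)))"
      by (simp add: edge_prod_def components_Union_arcs[OF fin])
    also have "\<dots> = (\<Prod>C\<in>?K. \<Prod>e\<in>arcs C.
        letter_mat A (label T e) $$ (\<phi> (tail ?G e), \<phi> (head ?G e)))"
    proof (rule prod.UNION_disjoint[OF finK])
      show "\<forall>C\<in>?K. finite (arcs C)"
        using components_fin[OF fin] fin_digraph.finite_arcs by blast
      show "\<forall>C\<in>?K. \<forall>D\<in>?K. C \<noteq> D \<longrightarrow> arcs C \<inter> arcs D = {}"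
        using components_disjoint_arcs by blast
    qed
    also have "\<dots> = (\<Prod>C\<in>?K. edge_prod A (T\<lparr>graph := C\<rparr>) \<phi>)"
      by (intro prod.cong refl) (simp add: edge_prod_def components_tail_head)
    finally show ?thesis .
  qed
  have "(\<Prod>C\<in>?K. inj_sum N A (T\<lparr>graph := C\<rparr>)) =
      (\<Sum>g\<in>Pi\<^sub>E ?K (\<lambda>C. injections (verts C) N). \<Prod>C\<in>?K. edge_prod A (T\<lparr>graph := C\<rparr>) (g C))"
    unfolding inj_sum_def by (simp add: prod_sum_PiE[OF finK] finite_injections finV)
  also have "\<dots> = (\<Sum>\<phi>\<in>{\<phi> \<in> ?V \<rightarrow>\<^sub>E {..<N}. ?D \<phi>}. edge_prod A T \<phi>)"
  proof (rule sum.reindex_bij_witness[where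
        i = "\<lambda>\<phi>. \<lambda>C\<in>?K. restrict \<phi> (verts C)" and j = "\<lambda>g. \<lambda>v\<in>?V. g (comp v) v"])
    fix g assume g: "g \<in> Pi\<^sub>E ?K (\<lambda>C. injections (verts C) N)"
    let ?\<phi> = "\<lambda>v\<in>?V. g (comp v) v"
    have gC: "g C \<in> verts C \<rightarrow>\<^sub>E {..<N}" "inj_on (g C) (verts C)" if "C \<in> ?K" for C
      using PiE_mem[OF g that] by (auto simp: injections_def)
    have \<phi>g: "?\<phi> v = g C v" if "C \<in> ?K" "v \<in> verts C" for C v
      using comp_eq[OF that] sub[OF that(1)] that by auto
    have rest: "restrict ?\<phi> (verts C) = g C" if "C \<in> ?K" for C
    proof
      fix x show "restrict ?\<phi> (verts C) x = g C x"
        using \<phi>g[OF that, of x] PiE_arb[OF gC(1)[OF that], of x] by (cases "x \<in> verts C") auto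
    qed
    show "(\<lambda>C\<in>?K. restrict ?\<phi> (verts C)) = g"
    proof
      fix C show "(\<lambda>C\<in>?K. restrict ?\<phi> (verts C)) C = g C"
        using rest[of C] PiE_arb[OF g, of C] by (cases "C \<in> ?K") auto
    qed
    have "?\<phi> \<in> ?V \<rightarrow>\<^sub>E {..<N}"
      using comp gC(1) by (intro PiE_I) (auto dest: PiE_mem)
    moreover have "inj_on ?\<phi> (verts C)" if "C \<in> ?K" for C
      using gC(2)[OF that] \<phi>g[OF that] by (subst inj_on_cong[of _ _ "g C"]) auto
    ultimately show "?\<phi> \<in> {\<phi> \<in> ?V \<rightarrow>\<^sub>E {..<N}. ?D \<phi>}" by simp
    show "edge_prod A T ?\<phi> = (\<Prod>C\<in>?K. edge_prod A (T\<lparr>graph := C\<rparr>) (g C))"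
      unfolding ep
    proof (intro prod.cong refl)
      fix C assume C: "C \<in> ?K"
      show "edge_prod A (T\<lparr>graph := C\<rparr>) ?\<phi> = edge_prod A (T\<lparr>graph := C\<rparr>) (g C)"
        using \<phi>g[OF C] components_wf[OF C] by (intro edge_prod_cong) auto
    qed
  next
    fix \<phi> assume "\<phi> \<in> {\<phi> \<in> ?V \<rightarrow>\<^sub>E {..<N}. ?D \<phi>}"
    then have \<phi>: "\<phi> \<in> ?V \<rightarrow>\<^sub>E {..<N}" "\<And>C. C \<in> ?K \<Longrightarrow> inj_on \<phi> (verts C)" by auto
    show "(\<lambda>C\<in>?K. restrict \<phi> (verts C)) \<in> Pi\<^sub>E ?K (\<lambda>C. injections (verts C) N)"
    proof (intro PiE_I)
      fix C assume C: "C \<in> ?K"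
      have "restrict \<phi> (verts C) \<in> verts C \<rightarrow>\<^sub>E {..<N}"
        using \<phi>(1) sub[OF C] by (auto simp: PiE_iff)
      then show "(\<lambda>C\<in>?K. restrict \<phi> (verts C)) C \<in> injections (verts C) N"
        using C \<phi>(2)[OF C] by (simp add: injections_def inj_on_restrict_eq)
    qed simp
    show "(\<lambda>v\<in>?V. (\<lambda>C\<in>?K. restrict \<phi> (verts C)) (comp v) v) = \<phi>"
    proof
      fix v show "(\<lambda>v\<in>?V. (\<lambda>C\<in>?K. restrict \<phi> (verts C)) (comp v) v) v = \<phi> v"
        using comp[of v] PiE_arb[OF \<phi>(1), of v] by (cases "v \<in> ?V") auto
    qed
  qed
  also have "\<dots> = (\<Sum>\<phi>\<in>?V \<rightarrow>\<^sub>E {..<N}. if ?D \<phi> then edge_prod A T \<phi> else 0)"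
    by (rule sum.inter_filter) (simp add: finite_PiE)
  also have "\<dots> = (\<Sum>f\<in>partition_maps ?V. if ?D f then inj_sum N A (quotient f T) else 0)"
    unfolding sum_PiE_by_kernel[OF finite_verts]
  proof (intro sum.cong refl)
    fix f assume f: "f \<in> partition_maps ?V"
    have "?D (restrict (\<psi> \<circ> f) ?V) \<longleftrightarrow> ?D f" if \<psi>: "\<psi> \<in> injections (f ` ?V) N" for \<psi>
    proof (intro ball_cong refl)
      fix C assume C: "C \<in> ?K"
      have eq: "restrict (\<psi> \<circ> f) ?V v = restrict (\<psi> \<circ> f) ?V w \<longleftrightarrow> f v = f w"
        if "v \<in> verts C" "w \<in> verts C" for v w
        using \<psi> that sub[OF C] by (auto simp: injections_def inj_on_def)
      show "inj_on (restrict (\<psi> \<circ> f) ?V) (verts C) \<longleftrightarrow> inj_on f (verts C)"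
        unfolding inj_on_def using eq by metis
    qed
    then have "(\<Sum>\<psi>\<in>injections (f ` ?V) N. if ?D (restrict (\<psi> \<circ> f) ?V)
          then edge_prod A T (restrict (\<psi> \<circ> f) ?V) else 0) =
        (\<Sum>\<psi>\<in>injections (f ` ?V) N. if ?D f then edge_prod A T (restrict (\<psi> \<circ> f) ?V) else 0)"
      by (intro sum.cong refl) simp
    then show "(\<Sum>\<psi>\<in>injections (f ` ?V) N. if ?D (restrict (\<psi> \<circ> f) ?V)
          then edge_prod A T (restrict (\<psi> \<circ> f) ?V) else 0) =
        (if ?D f then inj_sum N A (quotient f T) else 0)"
      unfolding inj_sum_def quotient_simps edge_prod_quotient[OF wf_digraph]
      by (cases "?D f") (simp_all only: if_True if_False sum.neutral_const if_P if_not_P)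
  qed
  also have "\<dots> = (\<Sum>f\<in>{f \<in> partition_maps ?V. ?D f}. inj_sum N A (quotient f T))"
    by (rule sum.inter_filter[symmetric]) (simp add: finite_partition_maps)
  finally show ?thesis by (simp add: glueings_def)
qed

section \<open>Components of quotients\<close>

lemma quotient_fin_digraph:
  assumes "fin_digraph (graph T)" shows "fin_digraph (graph (quotient f T))"
proof -
  interpret fin_digraph "graph T" by fact
  show ?thesis by unfold_locales auto
qed

lemma quotient_connected:
  assumes fin: "fin_digraph (graph T)" and con: "connected (graph T)"
  shows "connected (graph (quotient f T))"
proof -
  interpret fin_digraph "graph T" by fact
  interpret Q: fin_digraph "graph (quotient f T)" by (rule quotient_fin_digraph[OF fin])
  have "S = f ` verts (graph T)"
    if S: "S \<subseteq> f ` verts (graph T)" "S \<noteq> {}" "boundary (graph (quotient f T)) S = {}" for S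
  proof -
    let ?P = "{v \<in> verts (graph T). f v \<in> S}"
    have "boundary (graph T) ?P = {}"
      using S(3) wellformed by (auto simp: boundary_def)
    moreover have "?P \<noteq> {}" using S(1,2) by auto
    ultimately have "?P = verts (graph T)"
      using connectedD_boundary[OF con wf_digraph, of ?P] by auto
    then show ?thesis using S(1) by auto
  qed
  moreover have "verts (graph T) \<noteq> {}" using con connected_iff_boundary[OF wf_digraph] by blast
  ultimately show ?thesis unfolding connected_iff_boundary[OF Q.wf_digraph] by simp
qed

lemma quotient_balanced:
  assumes "balanced (graph T)" shows "balanced (graph (quotient f T))"
proof -
  have "excess (f \<circ> tail (graph T)) (f \<circ> head (graph T)) (arcs (graph T)) S =
      excess (tail (graph T)) (head (graph T)) (arcs (graph T)) (f -` S)" for S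
    by (simp add: excess_def)
  then show ?thesis using assms by (simp add: balanced_def)
qed

lemma component_balanced:
  assumes "balanced G" "C \<in> components G"
  shows "balanced C"
proof -
  have "excess (tail G) (head G) (arcs C) S = excess (tail G) (head G) (arcs G) (S \<inter> verts C)" for S
  proof -
    have "{e \<in> arcs C. tail G e \<in> S} = {e \<in> arcs G. tail G e \<in> S \<inter> verts C}"
      using components_arcs[OF assms(2)] by auto
    moreover have "{e \<in> arcs C. head G e \<in> S} = {e \<in> arcs G. head G e \<in> S \<inter> verts C}"
      using components_arcs[OF assms(2)] components_arc_iff[OF assms(2)] by auto
    ultimately show ?thesis by (simp add: excess_def)
  qed
  then show ?thesis using assms(1) components_tail_head[OF assms(2)] by (simp add: balanced_def)
qed

lemma balanced_of_components:
  assumes fin: "fin_digraph G" and bal: "\<And>C. C \<in> components G \<Longrightarrow> balanced C"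
  shows "balanced G"
proof -
  interpret fin_digraph G by fact
  have finK: "finite (components G)" by (rule finite_components[OF fin])
  have c: "card {e \<in> arcs G. P e} = (\<Sum>C\<in>components G. card {e \<in> arcs C. P e})" for P
  proof -
    have "{e \<in> arcs G. P e} = (\<Union>C\<in>components G. {e \<in> arcs C. P e})"
      using components_Union_arcs[OF fin] by blast
    also have "card \<dots> = (\<Sum>C\<in>components G. card {e \<in> arcs C. P e})"
    proof (rule card_UN_disjoint[OF finK])
      show "\<forall>C\<in>components G. finite {e \<in> arcs C. P e}"
        using fin_digraph.finite_arcs[OF components_fin[OF fin]] by auto
      show "\<forall>C\<in>components G. \<forall>D\<in>components G. C \<noteq> D \<longrightarrow> {e \<in> arcs C. P e} \<inter> {e \<in> arcs D. P e} = {}"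
        using components_disjoint_arcs by blast
    qed
    finally show ?thesis .
  qed
  have "excess (tail G) (head G) (arcs G) S = (\<Sum>C\<in>components G. excess (tail C) (head C) (arcs C) S)" for S
    by (simp add: excess_def c components_tail_head sum_subtractf)
  then show ?thesis using bal by (simp add: balanced_def)
qed

text \<open>A component of a quotient is covered by the images of the components that it receives.\<close>

definition image_component :: "(nat \<Rightarrow> nat) \<Rightarrow> 'i test_graph \<Rightarrow> (nat, nat) pre_digraph \<Rightarrow> (nat, nat) pre_digraph" where
  "image_component f T C =
     (SOME D. D \<in> components (graph (quotient f T)) \<and> f ` verts C \<subseteq> verts D)"

lemma image_component:
  assumes fin: "fin_digraph (graph T)" and C: "C \<in> components (graph T)"
  shows "image_component f T C \<in> components (graph (quotient f T)) \<and>
    f ` verts C \<subseteq> verts (image_component f T C)"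
proof -
  let ?Q = "graph (quotient f T)"
  have finQ: "fin_digraph ?Q" by (rule quotient_fin_digraph[OF fin])
  obtain v where v: "v \<in> verts C" using components_verts_nonempty[OF C] by blast
  have sub: "subgraph C (graph T)" using components_subgraph[OF C] by simp
  then have "v \<in> verts (graph T)" using v by (auto simp: subgraph_def)
  then have "f v \<in> verts ?Q" by simp
  then obtain D where D: "D \<in> components ?Q" "f v \<in> verts D" using component_of_vertex[OF finQ] by metis
  let ?P = "{w \<in> verts C. f w \<in> verts D}"
  have "boundary C ?P = {}"
  proof (rule ccontr)
    assume "boundary C ?P \<noteq> {}"
    then obtain e where e: "e \<in> arcs C" "(tail C e \<in> ?P) \<noteq> (head C e \<in> ?P)"
      by (auto simp: boundary_def)
    have "tail C e \<in> verts C" "head C e \<in> verts C"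
      using components_wf[OF C] e by (auto simp: wf_digraph_def)
    then have "(f (tail C e) \<in> verts D) \<noteq> (f (head C e) \<in> verts D)" using e by simp
    moreover have "e \<in> arcs (graph T)" using sub e by (auto simp: subgraph_def)
    ultimately have "e \<in> boundary ?Q (verts D)"
      using components_tail_head[OF C] by (simp add: boundary_def)
    then show False using components_boundary[OF D(1)] by simp
  qed
  then have "?P = verts C"
    using connectedD_boundary[OF components_subgraph(2)[OF C] components_wf[OF C], of ?P] v D by auto
  then have "D \<in> components ?Q \<and> f ` verts C \<subseteq> verts D" using D by auto
  then show ?thesis unfolding image_component_def by (rule someI)
qed

lemma image_component_eqI:
  assumes fin: "fin_digraph (graph T)" and C: "C \<in> components (graph T)"
    and D: "D \<in> components (graph (quotient f T))" "v \<in> verts C" "f v \<in> verts D"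
  shows "image_component f T C = D"
proof -
  have "image_component f T C \<in> components (graph (quotient f T))"
    "f v \<in> verts (image_component f T C)" using image_component[OF fin C, of f] D by auto
  then show ?thesis using D by (intro components_overlap_eq[of _ _ D "f v"])
qed

lemma image_component_surj:
  assumes fin: "fin_digraph (graph T)"
  shows "image_component f T ` components (graph T) = components (graph (quotient f T))"
proof
  show "image_component f T ` components (graph T) \<subseteq> components (graph (quotient f T))"
    using image_component[OF fin] by auto
  show "components (graph (quotient f T)) \<subseteq> image_component f T ` components (graph T)"
  proof
    fix D assume D: "D \<in> components (graph (quotient f T))"
    obtain x where x: "x \<in> verts D" using components_verts_nonempty[OF D] by blast
    have "subgraph D (graph (quotient f T))" using components_subgraph[OF D] by simp
    then have "x \<in> f ` verts (graph T)" using x by (auto simp: subgraph_def)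
    then obtain v where v: "v \<in> verts (graph T)" "x = f v" by auto
    obtain C where C: "C \<in> components (graph T)" "v \<in> verts C" using component_of_vertex[OF fin v(1)] .
    have "image_component f T C = D" using image_component_eqI[OF fin C(1) D C(2)] x v by simp
    then show "D \<in> image_component f T ` components (graph T)" using C by blast
  qed
qed

text \<open>A vertex that is moved is identified with a vertex of another component, so two components
  have the same image component.\<close>

lemma card_components_glueing:
  assumes fin: "fin_digraph (graph T)" and f: "f \<in> glueings (graph T)" "f \<noteq> no_glueing (graph T)"
  shows "card (components (graph (quotient f T))) < card (components (graph T))"
proof -
  have fp: "f \<in> partition_maps (verts (graph T))"
    and inj: "\<And>C. C \<in> components (graph T) \<Longrightarrow> inj_on f (verts C)"
    using f by (auto simp: glueings_def)
  have "\<exists>v\<in>verts (graph T). f v \<noteq> v"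
  proof (rule ccontr)
    assume "\<not> ?thesis"
    then have "f v = no_glueing (graph T) v" for v
      using fp by (cases "v \<in> verts (graph T)") (auto simp: no_glueing_def partition_maps_def PiE_def extensional_def)
    then show False using f(2) by blast
  qed
  then obtain v where v: "v \<in> verts (graph T)" "f v \<noteq> v" by blast
  have fv: "f v \<in> verts (graph T)" "f (f v) = f v" using partition_mapsD[OF fp v(1)] by auto
  obtain C where C: "C \<in> components (graph T)" "v \<in> verts C" using component_of_vertex[OF fin v(1)] .
  obtain C' where C': "C' \<in> components (graph T)" "f v \<in> verts C'" using component_of_vertex[OF fin fv(1)] .
  have "C \<noteq> C'" using inj[OF C(1)] C C' v(2) fv(2) by (auto simp: inj_on_def)
  moreover have "image_component f T C = image_component f T C'"
  proof (rule image_component_eqI[OF fin C(1) _ C(2)])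
    show "image_component f T C' \<in> components (graph (quotient f T))" "f v \<in> verts (image_component f T C')"
      using image_component[OF fin C'(1), of f] C'(2) fv(2) by auto
  qed
  ultimately have "\<not> inj_on (image_component f T) (components (graph T))"
    using C C' by (auto simp: inj_on_def)
  then have "card (image_component f T ` components (graph T)) \<noteq> card (components (graph T))"
    using eq_card_imp_inj_on[OF finite_components[OF fin]] by blast
  then show ?thesis
    using card_image_le[OF finite_components[OF fin], of "image_component f T"]
    unfolding image_component_surj[OF fin] by simp
qed

text \<open>A one-arc cut of a component of the quotient pulls back to a one-arc cut of the unique
  component that contains this arc.\<close>

lemma leaves_image_component_le:
  assumes fin: "fin_digraph (graph T)" and D: "D \<in> components (graph (quotient f T))"
  shows "leaves D \<le> (\<Sum>C\<in>{C \<in> components (graph T). image_component f T C = D}. leaves C)"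
proof -
  let ?G = "graph T" let ?Q = "graph (quotient f T)"
  let ?K = "{C \<in> components ?G. image_component f T C = D}"
  have finQ: "fin_digraph ?Q" by (rule quotient_fin_digraph[OF fin])
  have finK: "finite ?K" using finite_components[OF fin] by simp
  have leafC: "2 \<le> leaves C" "fin_digraph C" "connected C" if "C \<in> ?K" for C
    using that components_fin[OF fin] components_subgraph(2) leaves_ge_2 by blast+
  show ?thesis
  proof (rule leaves_le_bound)
    show "fin_digraph D" "connected D" using components_fin[OF finQ D] components_subgraph(2)[OF D] by auto
    have "D \<in> image_component f T ` components ?G" using D image_component_surj[OF fin] by blast
    then obtain C where "C \<in> ?K" by auto
    then show "2 \<le> sum leaves ?K" using leafC(1) member_le_sum[of C ?K leaves] finK by fastforce
    fix F assume F: "disjoint_cuts D F"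
    have finF: "finite F"
      using F fin_digraph.finite_verts[OF components_fin[OF finQ D]] finite_subset
      unfolding disjoint_cuts_def by (metis finite_Pow_iff)
    let ?pre = "\<lambda>C S. {v \<in> verts C. f v \<in> S}"
    have "\<exists>C. C \<in> ?K \<and> card (boundary C (?pre C S)) = 1" if S: "S \<in> F" for S
    proof -
      have SD: "S \<subseteq> verts D" "card (boundary D S) = 1" using F S by (auto simp: disjoint_cuts_def)
      then obtain e where e: "boundary D S = {e}" using card_1_singletonE by blast
      then have eD: "e \<in> arcs D" by (auto simp: boundary_def)
      have subD: "subgraph D ?Q" using components_subgraph[OF D] by simp
      then have "e \<in> arcs ?G" using eD by (auto simp: subgraph_def)
      then obtain C where C: "C \<in> components ?G" "e \<in> arcs C" using components_Union_arcs[OF fin] by blast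
      have thC: "tail C = tail ?G" "head C = head ?G" using components_tail_head[OF C(1)] by auto
      have thD: "tail D = f \<circ> tail ?G" "head D = f \<circ> head ?G" using components_tail_head[OF D] by auto
      have endsC: "tail ?G a \<in> verts C" "head ?G a \<in> verts C" if "a \<in> arcs C" for a
        using components_wf[OF C(1)] that thC by (auto simp: wf_digraph_def)
      have "tail D e \<in> verts D" using components_wf[OF D] eD by (auto simp: wf_digraph_def)
      then have "image_component f T C = D"
        using image_component_eqI[OF fin C(1) D, of "tail ?G e"] endsC(1)[OF C(2)] thD by simp
      moreover have "boundary C (?pre C S) = {e}"
      proof
        show "{e} \<subseteq> boundary C (?pre C S)"
          using e C(2) endsC[OF C(2)] thC thD by (auto simp: boundary_def)
        show "boundary C (?pre C S) \<subseteq> {e}"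
        proof
          fix a assume a: "a \<in> boundary C (?pre C S)"
          then have aC: "a \<in> arcs C" by (simp add: boundary_def)
          then have sep: "(f (tail ?G a) \<in> S) \<noteq> (f (head ?G a) \<in> S)"
            using a endsC[OF aC] thC by (simp add: boundary_def)
          have "a \<in> arcs ?Q" using aC components_subgraph(1)[OF C(1)] by (auto simp: subgraph_def)
          then have "a \<in> arcs D" using components_arc_iff[OF D, of a] sep SD(1) by auto
          then have "a \<in> boundary D S" using sep thD by (simp add: boundary_def)
          then show "a \<in> {e}" using e by simp
        qed
      qed
      ultimately show ?thesis using C(1) by (intro exI[of _ C]) simp
    qed
    then have "\<forall>S. \<exists>C. S \<in> F \<longrightarrow> C \<in> ?K \<and> card (boundary C (?pre C S)) = 1" by blast
    then obtain c where c: "\<forall>S. S \<in> F \<longrightarrow> c S \<in> ?K \<and> card (boundary (c S) (?pre (c S) S)) = 1"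
      unfolding choice_iff by (rule exE)
    have "card {S \<in> F. c S = C} \<le> leaves C" if C: "C \<in> ?K" for C
    proof -
      have one: "card (boundary C (?pre C S)) = 1" if "S \<in> F" "c S = C" for S using c that by blast
      have disj: "?pre C S \<inter> ?pre C S' = {}" if "S \<in> F" "S' \<in> F" "S \<noteq> S'" for S S'
      proof -
        have "S \<inter> S' = {}" using F that by (simp add: disjoint_cuts_def)
        then show ?thesis by auto
      qed
      have ne: "?pre C S \<noteq> {}" if "S \<in> F" "c S = C" for S
      proof
        assume "?pre C S = {}"
        then have "boundary C (?pre C S) = {}" unfolding boundary_def by simp
        then show False using one[OF that] by simp
      qed
      have inj: "inj_on (?pre C) {S \<in> F. c S = C}"
      proof (rule inj_onI)
        fix S S' assume "S \<in> {S \<in> F. c S = C}" "S' \<in> {S \<in> F. c S = C}" "?pre C S = ?pre C S'"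
        then show "S = S'" using disj[of S S'] ne[of S] by auto
      qed
      have "disjoint_cuts C (?pre C ` {S \<in> F. c S = C})"
        unfolding disjoint_cuts_def
      proof (intro conjI ballI impI)
        show "?pre C ` {S \<in> F. c S = C} \<subseteq> Pow (verts C)" by auto
        show "card (boundary C S) = 1" if "S \<in> ?pre C ` {S \<in> F. c S = C}" for S
          using that one by auto
        fix X Y assume "X \<in> ?pre C ` {S \<in> F. c S = C}" "Y \<in> ?pre C ` {S \<in> F. c S = C}" "X \<noteq> Y"
        then obtain S S' where "S \<in> F" "S' \<in> F" "X = ?pre C S" "Y = ?pre C S'" "S \<noteq> S'" by auto
        then show "X \<inter> Y = {}" using disj by simp
      qed
      then have "card (?pre C ` {S \<in> F. c S = C}) \<le> leaves C"
        by (rule disjoint_cuts_card_le_leaves[OF leafC(2,3)[OF C]])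
      then show ?thesis using card_image[OF inj] by simp
    qed
    then have "(\<Sum>C\<in>?K. card {S \<in> F. c S = C}) \<le> sum leaves ?K" by (rule sum_mono)
    moreover have "card F = (\<Sum>C\<in>?K. card {S \<in> F. c S = C})"
    proof -
      have "F = (\<Union>C\<in>?K. {S \<in> F. c S = C})" using c by auto
      then have "card F = card (\<Union>C\<in>?K. {S \<in> F. c S = C})" by simp
      also have "\<dots> = (\<Sum>C\<in>?K. card {S \<in> F. c S = C})"
        using finK finF by (intro card_UN_disjoint) auto
      finally show ?thesis .
    qed
    ultimately show "card F \<le> sum leaves ?K" by simp
  qed
qed

lemma sum_leaves_quotient_le:
  assumes fin: "fin_digraph (graph T)"
  shows "(\<Sum>D\<in>components (graph (quotient f T)). leaves D) \<le> (\<Sum>C\<in>components (graph T). leaves C)"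
proof -
  let ?K = "components (graph T)" let ?i = "image_component f T"
  have "(\<Sum>D\<in>components (graph (quotient f T)). leaves D) \<le>
      (\<Sum>D\<in>?i ` ?K. \<Sum>C\<in>{C \<in> ?K. ?i C = D}. leaves C)"
    unfolding image_component_surj[OF fin] using leaves_image_component_le[OF fin] by (rule sum_mono)
  also have "\<dots> = (\<Sum>C\<in>?K. leaves C)"
    using sum.image_gen[OF finite_components[OF fin], of leaves ?i] by simp
  finally show ?thesis .
qed

section \<open>Random variables with finite moments of all orders\<close>

text \<open>This class is closed under sums and products, so it contains all random variables built from the
  entries below.\<close>

definition all_moments :: "'w measure \<Rightarrow> ('w \<Rightarrow> complex) \<Rightarrow> bool" where
  "all_moments M X \<longleftrightarrow> X \<in> borel_measurable M \<and> (\<forall>m::nat. integrable M (\<lambda>\<omega>. cmod (X \<omega>) ^ m))"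

lemma all_moments_cong:
  assumes "\<And>\<omega>. \<omega> \<in> space M \<Longrightarrow> X \<omega> = Y \<omega>"
  shows "all_moments M X \<longleftrightarrow> all_moments M Y"
proof -
  have "X \<in> borel_measurable M \<longleftrightarrow> Y \<in> borel_measurable M" by (rule measurable_cong[OF assms])
  moreover have "integrable M (\<lambda>\<omega>. cmod (X \<omega>) ^ m) \<longleftrightarrow> integrable M (\<lambda>\<omega>. cmod (Y \<omega>) ^ m)" for m :: nat
    by (rule Bochner_Integration.integrable_cong) (simp_all add: assms)
  ultimately show ?thesis by (simp add: all_moments_def)
qed

lemma all_moments_integrable:
  assumes "all_moments M X" shows "integrable M X"
proof -
  have "integrable M (\<lambda>\<omega>. cmod (X \<omega>) ^ 1)" "X \<in> borel_measurable M"
    using assms unfolding all_moments_def by blast+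
  then show ?thesis by (simp add: integrable_norm_iff)
qed

lemma all_moments_const:
  assumes "prob_space M" shows "all_moments M (\<lambda>\<omega>. c)"
proof -
  interpret prob_space M by fact
  show ?thesis by (simp add: all_moments_def)
qed

lemma all_moments_cnj:
  assumes "all_moments M X" shows "all_moments M (\<lambda>\<omega>. cnj (X \<omega>))"
  using assms by (auto simp: all_moments_def intro: borel_measurable_continuous_on[OF continuous_on_cnj[OF continuous_on_id]])

lemma all_moments_add:
  assumes "all_moments M X" "all_moments M Y" shows "all_moments M (\<lambda>\<omega>. X \<omega> + Y \<omega>)"
proof -
  have [measurable]: "X \<in> borel_measurable M" "Y \<in> borel_measurable M"
    using assms by (auto simp: all_moments_def)
  have "integrable M (\<lambda>\<omega>. cmod (X \<omega> + Y \<omega>) ^ m)" for m :: nat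
  proof (rule Bochner_Integration.integrable_bound)
    show "integrable M (\<lambda>\<omega>. 2 ^ m * (cmod (X \<omega>) ^ m + cmod (Y \<omega>) ^ m))"
      using assms by (auto simp: all_moments_def)
    have "cmod (x + y) ^ m \<le> 2 ^ m * (cmod x ^ m + cmod y ^ m)" for x y
    proof -
      have "cmod (x + y) \<le> 2 * max (cmod x) (cmod y)" using norm_triangle_ineq[of x y] by linarith
      then have "cmod (x + y) ^ m \<le> (2 * max (cmod x) (cmod y)) ^ m" by (rule power_mono) simp
      also have "\<dots> = 2 ^ m * max (cmod x) (cmod y) ^ m" by (rule power_mult_distrib)
      also have "max (cmod x) (cmod y) ^ m \<le> cmod x ^ m + cmod y ^ m" by (simp add: max_def)
      finally show ?thesis by simp
    qed
    then show "AE \<omega> in M. norm (cmod (X \<omega> + Y \<omega>) ^ m) \<le> norm (2 ^ m * (cmod (X \<omega>) ^ m + cmod (Y \<omega>) ^ m))"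
      by simp
  qed measurable
  then show ?thesis by (simp add: all_moments_def)
qed

lemma all_moments_mult:
  assumes "all_moments M X" "all_moments M Y" shows "all_moments M (\<lambda>\<omega>. X \<omega> * Y \<omega>)"
proof -
  have [measurable]: "X \<in> borel_measurable M" "Y \<in> borel_measurable M"
    using assms by (auto simp: all_moments_def)
  have "integrable M (\<lambda>\<omega>. cmod (X \<omega> * Y \<omega>) ^ m)" for m :: nat
  proof (rule Bochner_Integration.integrable_bound)
    show "integrable M (\<lambda>\<omega>. cmod (X \<omega>) ^ (2 * m) + cmod (Y \<omega>) ^ (2 * m))"
      using assms by (auto simp: all_moments_def)
    have "cmod (x * y) ^ m \<le> cmod x ^ (2 * m) + cmod y ^ (2 * m)" for x y
    proof -
      have "cmod (x * y) ^ m = cmod x ^ m * cmod y ^ m" by (simp add: norm_mult power_mult_distrib)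
      also have "\<dots> \<le> 2 * (cmod x ^ m * cmod y ^ m)" by simp
      also have "\<dots> \<le> (cmod x ^ m)\<^sup>2 + (cmod y ^ m)\<^sup>2"
        using sum_squares_bound[of "cmod x ^ m" "cmod y ^ m"] by simp
      finally show ?thesis by (simp add: power_mult[symmetric] mult.commute)
    qed
    then show "AE \<omega> in M. norm (cmod (X \<omega> * Y \<omega>) ^ m) \<le> norm (cmod (X \<omega>) ^ (2 * m) + cmod (Y \<omega>) ^ (2 * m))"
      by simp
  qed measurable
  then show ?thesis by (simp add: all_moments_def)
qed

lemma all_moments_sum:
  assumes "prob_space M" "\<And>i. i \<in> I \<Longrightarrow> all_moments M (X i)"
  shows "all_moments M (\<lambda>\<omega>. \<Sum>i\<in>I. X i \<omega>)"
  using assms(2)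
  by (induct I rule: infinite_finite_induct) (auto intro: all_moments_const[OF assms(1)] all_moments_add)

lemma all_moments_prod:
  assumes "prob_space M" "\<And>i. i \<in> I \<Longrightarrow> all_moments M (X i)"
  shows "all_moments M (\<lambda>\<omega>. \<Prod>i\<in>I. X i \<omega>)"
  using assms(2)
  by (induct I rule: infinite_finite_induct) (auto intro: all_moments_const[OF assms(1)] all_moments_mult)

section \<open>Letters and edge products of random matrices\<close>

lemma mat_adjoint_index:
  assumes "A \<in> carrier_mat N N" "a < N" "b < N"
  shows "mat_adjoint A $$ (a, b) = cnj (A $$ (b, a))" "mat_adjoint A \<in> carrier_mat N N"
proof -
  have dim: "dim_row A = N" "dim_col A = N" using assms by auto
  show "mat_adjoint A $$ (a, b) = cnj (A $$ (b, a))"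
    using assms dim by (simp add: mat_adjoint_def mat_of_rows_index)
  show "mat_adjoint A \<in> carrier_mat N N"
    using mat_of_rows_carrier(1)[of N "map conjugate (cols A)"] dim by (simp add: mat_adjoint_def)
qed

definition letter_entry :: "'i letter \<Rightarrow> ('i \<times> nat \<times> nat \<Rightarrow> complex) \<Rightarrow> nat \<Rightarrow> nat \<Rightarrow> complex" where
  "letter_entry l x a b = (if snd l then cnj (x (fst l, b, a)) else x (fst l, a, b))"

lemma letter_mat_entry:
  assumes "A (fst l) \<in> carrier_mat N N" "a < N" "b < N"
  shows "letter_mat A l $$ (a, b) = letter_entry l (\<lambda>(i, a, b). A i $$ (a, b)) a b"
  using assms by (simp add: letter_mat_def letter_entry_def mat_adjoint_index)

lemma letter_mat_entries:
  assumes "A (fst l) \<in> carrier_mat N N" "a < N" "b < N" "fst l \<in> I"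
  shows "letter_mat A l $$ (a, b) = letter_entry l (entries I N A) a b"
  using assms by (simp add: letter_mat_entry letter_entry_def entries_def)

definition labelled_in :: "'i set \<Rightarrow> 'i test_graph \<Rightarrow> bool" where
  "labelled_in I T \<longleftrightarrow> fin_digraph (graph T) \<and> (\<forall>e\<in>arcs (graph T). fst (label T e) \<in> I)"

lemma random_matricesD:
  assumes "random_matrices I M A" "i \<in> I"
  shows "\<omega> \<in> space (M N) \<Longrightarrow> A N \<omega> i \<in> carrier_mat N N"
    and "a < N \<Longrightarrow> b < N \<Longrightarrow> all_moments (M N) (\<lambda>\<omega>. A N \<omega> i $$ (a, b))"
  using assms unfolding random_matrices_def all_moments_def by blast+

lemma letter_mat_all_moments:
  assumes "random_matrices I M A" "fst l \<in> I" "a < N" "b < N"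
  shows "all_moments (M N) (\<lambda>\<omega>. letter_mat (A N \<omega>) l $$ (a, b))"
proof -
  have eq: "letter_mat (A N \<omega>) l $$ (a, b) =
      (if snd l then cnj (A N \<omega> (fst l) $$ (b, a)) else A N \<omega> (fst l) $$ (a, b))" if "\<omega> \<in> space (M N)" for \<omega>
    using letter_mat_entry[of "A N \<omega>" l N a b] random_matricesD(1)[OF assms(1,2) that] assms(3,4)
    by (simp add: letter_entry_def)
  have "all_moments (M N) (\<lambda>\<omega>. if snd l then cnj (A N \<omega> (fst l) $$ (b, a)) else A N \<omega> (fst l) $$ (a, b))"
    using random_matricesD(2)[OF assms(1,2) assms(3,4)]
      all_moments_cnj[OF random_matricesD(2)[OF assms(1,2) assms(4,3)]] by (cases "snd l") simp_all
  then show ?thesis using all_moments_cong[OF eq, of "M N" "\<lambda>\<omega>. \<omega>"] by simp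
qed

lemma edge_prod_all_moments:
  assumes ps: "prob_space (M N)" and A: "random_matrices I M A" and T: "labelled_in I T"
    and \<phi>: "\<And>v. v \<in> verts (graph T) \<Longrightarrow> \<phi> v < N"
  shows "all_moments (M N) (\<lambda>\<omega>. edge_prod (A N \<omega>) T \<phi>)"
proof -
  interpret fin_digraph "graph T" using T by (simp add: labelled_in_def)
  show ?thesis unfolding edge_prod_def
    using T \<phi> by (intro all_moments_prod[OF ps] letter_mat_all_moments[OF A]) (auto simp: labelled_in_def)
qed

lemma inj_sum_all_moments:
  assumes ps: "prob_space (M N)" and A: "random_matrices I M A" and T: "labelled_in I T"
  shows "all_moments (M N) (\<lambda>\<omega>. inj_sum N (A N \<omega>) T)"
  unfolding inj_sum_def
  by (intro all_moments_sum[OF ps] edge_prod_all_moments[OF ps A T]) (auto simp: injections_def)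

lemma labelled_in_quotient: "labelled_in I T \<Longrightarrow> labelled_in I (quotient f T)"
  unfolding labelled_in_def using quotient_fin_digraph by auto

lemma component_test_graph_in:
  assumes T: "labelled_in I T" and C: "C \<in> components (graph T)"
  shows "test_graph I (T\<lparr>graph := C\<rparr>)" "labelled_in I (T\<lparr>graph := C\<rparr>)"
proof -
  have "fin_digraph C" "connected C" "arcs C \<subseteq> arcs (graph T)"
    using T C components_fin components_subgraph(1,2)[OF C]
    by (auto simp: labelled_in_def subgraph_def)
  then show "test_graph I (T\<lparr>graph := C\<rparr>)" "labelled_in I (T\<lparr>graph := C\<rparr>)"
    using T by (auto simp: test_graph_def labelled_in_def)
qed

section \<open>Injective sums over disconnected graphs\<close>

text \<open>The glueing expansion, solved for the term of the trivial glueing.\<close>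

lemma expectation_inj_sum_components:
  assumes ps: "prob_space (M N)" and A: "random_matrices I M A" and T: "labelled_in I T"
  shows "(\<integral>\<omega>. inj_sum N (A N \<omega>) T \<partial>M N) =
    (\<integral>\<omega>. (\<Prod>C\<in>components (graph T). inj_sum N (A N \<omega>) (T\<lparr>graph := C\<rparr>)) \<partial>M N) -
    (\<Sum>f\<in>glueings (graph T) - {no_glueing (graph T)}. \<integral>\<omega>. inj_sum N (A N \<omega>) (quotient f T) \<partial>M N)"
proof -
  have fin: "fin_digraph (graph T)" using T by (simp add: labelled_in_def)
  then have wf: "wf_digraph (graph T)" using fin_digraph_def by blast
  let ?R = "glueings (graph T)" let ?id = "no_glueing (graph T)"
  have int: "integrable (M N) (\<lambda>\<omega>. inj_sum N (A N \<omega>) (quotient f T))" for f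
    using all_moments_integrable[OF inj_sum_all_moments[OF ps A labelled_in_quotient[OF T]]] .
  have "(\<integral>\<omega>. (\<Prod>C\<in>components (graph T). inj_sum N (A N \<omega>) (T\<lparr>graph := C\<rparr>)) \<partial>M N) =
      (\<Sum>f\<in>?R. \<integral>\<omega>. inj_sum N (A N \<omega>) (quotient f T) \<partial>M N)"
    unfolding prod_inj_sum_components[OF fin] using int by (rule Bochner_Integration.integral_sum)
  also have "\<dots> = (\<integral>\<omega>. inj_sum N (A N \<omega>) T \<partial>M N) +
      (\<Sum>f\<in>?R - {?id}. \<integral>\<omega>. inj_sum N (A N \<omega>) (quotient f T) \<partial>M N)"
    by (subst sum.remove[OF finite_glueings[OF fin] no_glueing_in_glueings[OF fin]])
      (simp add: inj_sum_no_glueing[OF wf])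
  finally show ?thesis by simp
qed

lemma expectation_prod_components:
  assumes N: "0 < N" and cs: "distinct Cs" "set Cs = components (graph T)"
  shows "(\<integral>\<omega>. (\<Prod>C\<in>components (graph T). inj_sum N (A N \<omega>) (T\<lparr>graph := C\<rparr>)) \<partial>M N) =
    of_nat N ^ card (components (graph T)) *
      (\<integral>\<omega>. (\<Prod>T'\<leftarrow>map (\<lambda>C. T\<lparr>graph := C\<rparr>) Cs. tau0 N (A N \<omega>) T') \<partial>M N)"
proof -
  have "(\<Prod>C\<in>components (graph T). inj_sum N (A N \<omega>) (T\<lparr>graph := C\<rparr>)) =
      of_nat N ^ card (components (graph T)) *
        (\<Prod>T'\<leftarrow>map (\<lambda>C. T\<lparr>graph := C\<rparr>) Cs. tau0 N (A N \<omega>) T')" for \<omega>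
  proof -
    have "(\<Prod>T'\<leftarrow>map (\<lambda>C. T\<lparr>graph := C\<rparr>) Cs. tau0 N (A N \<omega>) T') =
        (\<Prod>C\<in>components (graph T). tau0 N (A N \<omega>) (T\<lparr>graph := C\<rparr>))"
      using prod.distinct_set_conv_list[OF cs(1), of "\<lambda>C. tau0 N (A N \<omega>) (T\<lparr>graph := C\<rparr>)"]
      by (simp add: cs(2) o_def)
    then show ?thesis using N by (simp add: tau0_eq_inj_sum prod_dividef)
  qed
  then show ?thesis by simp
qed

text \<open>Tightness bounds products of injective sums over connected graphs. An injective sum over a
  disconnected graph differs from such a product by sums over glued graphs, which have fewer
  components and no more leaves.\<close>

lemma inj_sum_bound:
  assumes ps: "\<And>N. prob_space (M N)" and A: "random_matrices I M A" and tight: "tightness I M A"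
    and T: "labelled_in I T"
  shows "(\<lambda>N. cmod (\<integral>\<omega>. inj_sum N (A N \<omega>) T \<partial>M N)) \<in>
    O(\<lambda>N. real N powr ((\<Sum>C\<in>components (graph T). real (leaves C)) / 2))"
  using T
proof (induct "card (components (graph T))" arbitrary: T rule: less_induct)
  case less
  let ?K = "components (graph T)"
  define s where "s = (\<Sum>C\<in>?K. real (leaves C)) / 2"
  have fin: "fin_digraph (graph T)" using less.prems by (simp add: labelled_in_def)
  obtain Cs where cs: "set Cs = ?K" "distinct Cs"
    using finite_distinct_list[OF finite_components[OF fin]] by blast
  define X where "X N = (\<integral>\<omega>. (\<Prod>T'\<leftarrow>map (\<lambda>C. T\<lparr>graph := C\<rparr>) Cs. tau0 N (A N \<omega>) T') \<partial>M N)" for N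
  define E where "E f N = (\<integral>\<omega>. inj_sum N (A N \<omega>) (quotient f T) \<partial>M N)" for f N
  let ?R = "glueings (graph T) - {no_glueing (graph T)}"
  have "(\<Sum>T'\<leftarrow>map (\<lambda>C. T\<lparr>graph := C\<rparr>) Cs. real (leaves (graph T')) / 2 - 1) = (\<Sum>C\<in>?K. real (leaves C) / 2 - 1)"
    using sum.distinct_set_conv_list[OF cs(2), of "\<lambda>C. real (leaves C) / 2 - 1"] by (simp add: cs(1) o_def)
  also have "\<dots> = s - real (card ?K)" by (simp add: s_def sum_subtractf sum_divide_distrib)
  finally have ex: "(\<Sum>T'\<leftarrow>map (\<lambda>C. T\<lparr>graph := C\<rparr>) Cs. real (leaves (graph T')) / 2 - 1) = s - real (card ?K)" .
  have "\<forall>T'\<in>set (map (\<lambda>C. T\<lparr>graph := C\<rparr>) Cs). test_graph I T'"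
    using component_test_graph_in[OF less.prems] cs by auto
  then have "(\<lambda>N. cmod (X N)) \<in> O(\<lambda>N. real N powr (s - real (card ?K)))"
    using tight unfolding tightness_def X_def ex[symmetric] by blast
  then have "(\<lambda>N. real N ^ card ?K * cmod (X N)) \<in> O(\<lambda>N. real N ^ card ?K * real N powr (s - real (card ?K)))"
    by (intro landau_o.big.mult) auto
  also have "(\<lambda>N. real N ^ card ?K * real N powr (s - real (card ?K))) \<in> O(\<lambda>N. real N powr s)"
  proof (rule landau_o.bigI[where c = 1])
    show "eventually (\<lambda>N. norm (real N ^ card ?K * real N powr (s - real (card ?K))) \<le> 1 * norm (real N powr s)) at_top"
      using eventually_gt_at_top[of 0]
    proof eventually_elim
      case (elim N)
      then show ?case by (simp add: powr_realpow[symmetric] powr_add[symmetric])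
    qed
  qed simp
  finally have XO: "(\<lambda>N. real N ^ card ?K * cmod (X N)) \<in> O(\<lambda>N. real N powr s)" .
  have EO: "(\<lambda>N. cmod (E f N)) \<in> O(\<lambda>N. real N powr s)" if f: "f \<in> ?R" for f
  proof -
    have "card (components (graph (quotient f T))) < card ?K"
      using card_components_glueing[OF fin, of f] f by blast
    from less.hyps[OF this labelled_in_quotient[OF less.prems]]
    have "(\<lambda>N. cmod (E f N)) \<in>
        O(\<lambda>N. real N powr ((\<Sum>C\<in>components (graph (quotient f T)). real (leaves C)) / 2))"
      unfolding E_def .
    also have "(\<lambda>N. real N powr ((\<Sum>C\<in>components (graph (quotient f T)). real (leaves C)) / 2)) \<in> O(\<lambda>N. real N powr s)"
    proof (rule landau_o.bigI[where c = 1])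
      have "(\<Sum>C\<in>components (graph (quotient f T)). real (leaves C)) / 2 \<le> s"
        using sum_leaves_quotient_le[OF fin, of f] unfolding s_def
        by (simp only: of_nat_sum[symmetric] divide_right_mono of_nat_le_iff zero_le_numeral)
      then have "norm (real N powr ((\<Sum>C\<in>components (graph (quotient f T)). real (leaves C)) / 2))
          \<le> 1 * norm (real N powr s)" if "1 \<le> N" for N
        using powr_mono[of _ s "real N"] that by simp
      then show "eventually (\<lambda>N. norm (real N powr ((\<Sum>C\<in>components (graph (quotient f T)). real (leaves C)) / 2))
          \<le> 1 * norm (real N powr s)) at_top"
        using eventually_ge_at_top[of 1] by (rule eventually_mono[rotated])
    qed simp
    finally show ?thesis .
  qed
  have "(\<lambda>N. real N ^ card ?K * cmod (X N) + (\<Sum>f\<in>?R. cmod (E f N))) \<in> O(\<lambda>N. real N powr s)"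
    using XO EO by (intro sum_in_bigo big_sum_in_bigo) auto
  moreover have "(\<lambda>N. cmod (\<integral>\<omega>. inj_sum N (A N \<omega>) T \<partial>M N)) \<in>
      O(\<lambda>N. real N ^ card ?K * cmod (X N) + (\<Sum>f\<in>?R. cmod (E f N)))"
  proof (rule landau_o.bigI[where c = 1])
    show "eventually (\<lambda>N. norm (cmod (\<integral>\<omega>. inj_sum N (A N \<omega>) T \<partial>M N)) \<le>
        1 * norm (real N ^ card ?K * cmod (X N) + (\<Sum>f\<in>?R. cmod (E f N)))) at_top"
      using eventually_gt_at_top[of 0]
    proof eventually_elim
      case (elim N)
      have "(\<integral>\<omega>. inj_sum N (A N \<omega>) T \<partial>M N) = of_nat N ^ card ?K * X N - (\<Sum>f\<in>?R. E f N)"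
        using expectation_inj_sum_components[OF ps A less.prems, of N]
        unfolding expectation_prod_components[OF elim cs(2,1), of M A] X_def E_def .
      then have "cmod (\<integral>\<omega>. inj_sum N (A N \<omega>) T \<partial>M N) \<le> cmod (of_nat N ^ card ?K * X N) + cmod (\<Sum>f\<in>?R. E f N)"
        by (simp add: norm_triangle_ineq4)
      also have "\<dots> \<le> real N ^ card ?K * cmod (X N) + (\<Sum>f\<in>?R. cmod (E f N))"
        using norm_sum[of "\<lambda>f. E f N" ?R] by (simp add: norm_mult norm_power)
      finally show ?case by simp
    qed
  qed simp
  ultimately show ?case unfolding s_def[symmetric] using landau_o.big_trans by blast
qed

text \<open>When all components are balanced, each nontrivial glueing loses at least one power of
  \<open>N\<close>.\<close>

lemma inj_sum_limit:
  assumes ps: "\<And>N. prob_space (M N)" and A: "random_matrices I M A" and tight: "tightness I M A"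
    and conc: "concentration I M A" and lim: "traffic_limit I M A \<tau>"
    and T: "labelled_in I T" and bal: "\<And>C. C \<in> components (graph T) \<Longrightarrow> balanced C"
  shows "(\<lambda>N. (\<integral>\<omega>. inj_sum N (A N \<omega>) T \<partial>M N) / of_nat N ^ card (components (graph T)))
    \<longlonglongrightarrow> (\<Prod>C\<in>components (graph T). \<tau> (T\<lparr>graph := C\<rparr>))"
proof -
  let ?K = "components (graph T)"
  have fin: "fin_digraph (graph T)" using T by (simp add: labelled_in_def)
  obtain Cs where cs: "set Cs = ?K" "distinct Cs"
    using finite_distinct_list[OF finite_components[OF fin]] by blast
  let ?Ts = "map (\<lambda>C. T\<lparr>graph := C\<rparr>) Cs"
  let ?R = "glueings (graph T) - {no_glueing (graph T)}"
  define X where "X N = (\<integral>\<omega>. (\<Prod>T'\<leftarrow>?Ts. tau0 N (A N \<omega>) T') \<partial>M N)" for N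
  define E where "E f N = (\<integral>\<omega>. inj_sum N (A N \<omega>) (quotient f T) \<partial>M N)" for f N
  have cyc: "cyclic_test_graph I (T\<lparr>graph := C\<rparr>)" if C: "C \<in> ?K" for C
    using component_test_graph_in[OF T C] bal[OF C]
      euler_trail_iff_balanced[OF components_fin[OF fin C] components_subgraph(2)[OF C]]
    by (simp add: cyclic_test_graph_def)
  have "(\<lambda>N. X N - (\<Prod>T'\<leftarrow>?Ts. \<integral>\<omega>. tau0 N (A N \<omega>) T' \<partial>M N)) \<longlonglongrightarrow> 0"
  proof -
    have "\<forall>T'\<in>set ?Ts. cyclic_test_graph I T'" using cyc cs(1) by auto
    then show ?thesis unfolding X_def using conc[unfolded concentration_def] by blast
  qed
  moreover have "(\<lambda>N. \<Prod>T'\<leftarrow>?Ts. \<integral>\<omega>. tau0 N (A N \<omega>) T' \<partial>M N) \<longlonglongrightarrow> (\<Prod>C\<in>?K. \<tau> (T\<lparr>graph := C\<rparr>))"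
  proof -
    have "(\<Prod>T'\<leftarrow>?Ts. \<integral>\<omega>. tau0 N (A N \<omega>) T' \<partial>M N) = (\<Prod>C\<in>?K. \<integral>\<omega>. tau0 N (A N \<omega>) (T\<lparr>graph := C\<rparr>) \<partial>M N)" for N
      using prod.distinct_set_conv_list[OF cs(2), of "\<lambda>C. \<integral>\<omega>. tau0 N (A N \<omega>) (T\<lparr>graph := C\<rparr>) \<partial>M N"]
      by (simp add: cs(1) o_def)
    moreover have "(\<lambda>N. \<Prod>C\<in>?K. \<integral>\<omega>. tau0 N (A N \<omega>) (T\<lparr>graph := C\<rparr>) \<partial>M N) \<longlonglongrightarrow> (\<Prod>C\<in>?K. \<tau> (T\<lparr>graph := C\<rparr>))"
      using lim cyc by (intro tendsto_prod) (auto simp: traffic_limit_def)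
    ultimately show ?thesis by simp
  qed
  ultimately have XL: "X \<longlonglongrightarrow> (\<Prod>C\<in>?K. \<tau> (T\<lparr>graph := C\<rparr>))"
    using Lim_transform[of "\<lambda>N. \<Prod>T'\<leftarrow>?Ts. \<integral>\<omega>. tau0 N (A N \<omega>) T' \<partial>M N" _ sequentially X]
    by (simp add: Lim_null[of X] tendsto_minus_cancel_left[symmetric])
  have EL: "(\<lambda>N. E f N / of_nat N ^ card ?K) \<longlonglongrightarrow> 0" if f: "f \<in> ?R" for f
  proof -
    let ?Q = "graph (quotient f T)"
    let ?m = "card (components ?Q)"
    have finQ: "fin_digraph ?Q" by (rule quotient_fin_digraph[OF fin])
    have "balanced ?Q" by (rule quotient_balanced[OF balanced_of_components[OF fin bal]])
    then have "leaves D = 2" if "D \<in> components ?Q" for D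
      using balanced_leaves[OF components_fin[OF finQ that] components_subgraph(2)[OF that]]
        component_balanced that by blast
    then have "(\<Sum>D\<in>components ?Q. real (leaves D)) / 2 = real ?m" by simp
    then have "(\<lambda>N. cmod (E f N)) \<in> O(\<lambda>N. real N powr real ?m)"
      using inj_sum_bound[OF ps A tight labelled_in_quotient[OF T], of f] by (simp add: E_def)
    then obtain c where c: "eventually (\<lambda>N. norm (cmod (E f N)) \<le> c * norm (real N powr real ?m)) at_top"
      by (rule landau_o.bigE)
    \<comment> \<open>The glued graph is balanced, so its bound is one factor \<open>N\<close> per component.\<close>
    have mk: "?m < card ?K" using card_components_glueing[OF fin, of f] f by blast
    show ?thesis
    proof (rule Lim_null_comparison)
      show "eventually (\<lambda>N. norm (E f N / of_nat N ^ card ?K) \<le> \<bar>c\<bar> * inverse (real N)) sequentially"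
        using c eventually_gt_at_top[of 0]
      proof eventually_elim
        case (elim N)
        have "cmod (E f N) \<le> c * real N ^ ?m" using elim by (simp add: powr_realpow)
        also have "\<dots> \<le> \<bar>c\<bar> * real N ^ ?m" by (intro mult_right_mono) auto
        finally have "cmod (E f N) / real N ^ card ?K \<le> \<bar>c\<bar> * real N ^ ?m / real N ^ card ?K"
          by (intro divide_right_mono) auto
        also have "\<dots> = \<bar>c\<bar> * inverse (real N ^ (card ?K - ?m))"
          using elim mk by (simp add: power_diff field_simps)
        also have "\<dots> \<le> \<bar>c\<bar> * inverse (real N)"
        proof (intro mult_left_mono le_imp_inverse_le)
          show "real N \<le> real N ^ (card ?K - ?m)" using elim mk by (intro self_le_power) auto
        qed (use elim in auto)
        finally show ?case by (simp add: norm_divide norm_power)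
      qed
      show "(\<lambda>N. \<bar>c\<bar> * inverse (real N)) \<longlonglongrightarrow> 0"
        using tendsto_mult_right_zero[OF lim_inverse_n] by blast
    qed
  qed
  have "(\<lambda>N. X N - (\<Sum>f\<in>?R. E f N / of_nat N ^ card ?K)) \<longlonglongrightarrow> (\<Prod>C\<in>?K. \<tau> (T\<lparr>graph := C\<rparr>)) - (\<Sum>f\<in>?R. 0)"
    using XL EL by (intro tendsto_diff tendsto_sum) auto
  moreover have "eventually (\<lambda>N. X N - (\<Sum>f\<in>?R. E f N / of_nat N ^ card ?K) =
      (\<integral>\<omega>. inj_sum N (A N \<omega>) T \<partial>M N) / of_nat N ^ card ?K) sequentially"
    using eventually_gt_at_top[of 0]
  proof eventually_elim
    case (elim N)
    have "(\<integral>\<omega>. inj_sum N (A N \<omega>) T \<partial>M N) = of_nat N ^ card ?K * X N - (\<Sum>f\<in>?R. E f N)"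
      using expectation_inj_sum_components[OF ps A T, of N]
      unfolding expectation_prod_components[OF elim cs(2,1), of M A] X_def E_def .
    then show ?case using elim by (simp add: diff_divide_distrib sum_divide_distrib)
  qed
  ultimately show ?thesis using Lim_transform_eventually by fastforce
qed

section \<open>Counting extensions of injections\<close>

definition falling :: "nat \<Rightarrow> nat \<Rightarrow> complex" where
  "falling N m = (\<Prod>i<m. of_nat N - of_nat i)"

lemma falling_nonzero: "m \<le> N \<Longrightarrow> falling N m \<noteq> 0"
  by (auto simp: falling_def)

lemma falling_asymptotic: "(\<lambda>N. falling N m / of_nat N ^ m) \<longlonglongrightarrow> 1"
proof -
  have "(\<lambda>N. \<Prod>i<m. 1 - of_nat i * (1 / of_nat N :: complex)) \<longlonglongrightarrow> (\<Prod>i<m. 1 - of_nat i * 0)"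
    by (intro tendsto_intros lim_1_over_n)
  moreover have "eventually (\<lambda>N. (\<Prod>i<m. 1 - of_nat i * (1 / of_nat N)) = falling N m / of_nat N ^ m) sequentially"
    using eventually_gt_at_top[of 0]
  proof eventually_elim
    case (elim N)
    have "(\<Prod>i<m. 1 - of_nat i * (1 / of_nat N)) = (\<Prod>i<m. (of_nat N - of_nat i) / (of_nat N :: complex))"
      using elim by (intro prod.cong) (auto simp: diff_divide_distrib)
    then show ?case by (simp add: falling_def prod_dividef)
  qed
  ultimately show ?thesis using Lim_transform_eventually by fastforce
qed

text \<open>An injection of \<open>W\<close> extends to one further vertex in as many ways as there are values left.\<close>

lemma sum_injections_insert:
  assumes fin: "finite W" and v: "v \<notin> W"
  shows "(\<Sum>\<phi>\<in>injections (insert v W) N. F (restrict \<phi> W)) =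
    (of_nat N - of_nat (card W)) * (\<Sum>\<psi>\<in>injections W N. F \<psi> :: complex)"
proof -
  have "(\<Sum>\<phi>\<in>injections (insert v W) N. F (restrict \<phi> W)) =
      (\<Sum>(\<psi>, a)\<in>Sigma (injections W N) (\<lambda>\<psi>. {..<N} - \<psi> ` W). F \<psi>)"
  proof (rule sum.reindex_bij_witness[where i = "\<lambda>(\<psi>, a). \<psi>(v := a)" and j = "\<lambda>\<phi>. (restrict \<phi> W, \<phi> v)"])
    fix \<phi> assume \<phi>: "\<phi> \<in> injections (insert v W) N"
    then have \<phi>': "\<phi> \<in> insert v W \<rightarrow>\<^sub>E {..<N}" "inj_on \<phi> (insert v W)" by (auto simp: injections_def)
    show "(case (restrict \<phi> W, \<phi> v) of (\<psi>, a) \<Rightarrow> \<psi>(v := a)) = \<phi>"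
      using PiE_arb[OF \<phi>'(1)] by (auto simp: fun_eq_iff)
    have "restrict \<phi> W \<in> injections W N"
      using \<phi>' by (auto simp: injections_def inj_on_restrict_eq PiE_iff intro: inj_on_subset)
    moreover have "\<phi> v \<in> {..<N} - restrict \<phi> W ` W"
      using \<phi>' v by (auto simp: PiE_iff inj_on_def)
    ultimately show "(restrict \<phi> W, \<phi> v) \<in> Sigma (injections W N) (\<lambda>\<psi>. {..<N} - \<psi> ` W)" by simp
  next
    fix p assume "p \<in> Sigma (injections W N) (\<lambda>\<psi>. {..<N} - \<psi> ` W)"
    then obtain \<psi> a where p: "p = (\<psi>, a)" and \<psi>: "\<psi> \<in> W \<rightarrow>\<^sub>E {..<N}" "inj_on \<psi> W" and a: "a < N" "a \<notin> \<psi> ` W"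
      by (auto simp: injections_def)
    show "(restrict (case p of (\<psi>, a) \<Rightarrow> \<psi>(v := a)) W, (case p of (\<psi>, a) \<Rightarrow> \<psi>(v := a)) v) = p"
      using p v PiE_arb[OF \<psi>(1)] by (auto simp: fun_eq_iff restrict_def)
    have "inj_on (\<psi>(v := a)) (insert v W)" using \<psi>(2) a(2) v by (auto simp: inj_on_def)
    moreover have "\<psi>(v := a) \<in> insert v W \<rightarrow>\<^sub>E {..<N}" using \<psi>(1) a(1) by (auto simp: PiE_iff extensional_def)
    ultimately show "(case p of (\<psi>, a) \<Rightarrow> \<psi>(v := a)) \<in> injections (insert v W) N"
      using p by (simp add: injections_def)
  qed simp
  also have "\<dots> = (\<Sum>\<psi>\<in>injections W N. \<Sum>a\<in>{..<N} - \<psi> ` W. F \<psi>)"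
    using fin by (intro sum.Sigma[symmetric]) (auto intro: finite_injections)
  also have "\<dots> = (\<Sum>\<psi>\<in>injections W N. (of_nat N - of_nat (card W)) * F \<psi>)"
  proof (intro sum.cong refl)
    fix \<psi> assume "\<psi> \<in> injections W N"
    then have \<psi>: "inj_on \<psi> W" "\<psi> ` W \<subseteq> {..<N}" by (auto simp: injections_def)
    have "card ({..<N} - \<psi> ` W) = N - card W" "card W \<le> N"
      using card_Diff_subset[of "\<psi> ` W" "{..<N}"] card_mono[OF _ \<psi>(2)] card_image[OF \<psi>(1)] \<psi>(2) fin by auto
    then show "(\<Sum>a\<in>{..<N} - \<psi> ` W. F \<psi>) = (of_nat N - of_nat (card W)) * F \<psi>"
      by (simp add: of_nat_diff)
  qed
  finally show ?thesis by (simp add: sum_distrib_left)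
qed

text \<open>Written without division, so that it also holds when there is no injection.\<close>

lemma sum_injections_restrict:
  assumes "finite V" "W \<subseteq> V"
  shows "falling N (card W) * (\<Sum>\<phi>\<in>injections V N. F (restrict \<phi> W)) =
    falling N (card V) * (\<Sum>\<psi>\<in>injections W N. F \<psi>)"
proof -
  have finW: "finite W" using assms finite_subset by blast
  have "falling N (card W) * (\<Sum>\<phi>\<in>injections (W \<union> U) N. F (restrict \<phi> W)) =
      falling N (card (W \<union> U)) * (\<Sum>\<psi>\<in>injections W N. F \<psi>)" if "finite U" "U \<inter> W = {}" for U
    using that
  proof (induct U rule: finite_induct)
    case empty
    have "restrict \<phi> W = \<phi>" if "\<phi> \<in> injections W N" for \<phi>
      using that unfolding injections_def using PiE_restrict by blast
    then show ?case by simp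
  next
    case (insert v U)
    have fin: "finite (W \<union> U)" and v: "v \<notin> W \<union> U" using insert finW by auto
    have res: "restrict (restrict \<phi> (W \<union> U)) W = restrict \<phi> W" for \<phi> :: "nat \<Rightarrow> nat"
      by (auto simp: restrict_def fun_eq_iff)
    have "(\<Sum>\<phi>\<in>injections (insert v (W \<union> U)) N. F (restrict \<phi> W)) =
        (of_nat N - of_nat (card (W \<union> U))) * (\<Sum>\<phi>\<in>injections (W \<union> U) N. F (restrict \<phi> W))"
      using sum_injections_insert[OF fin v, of "\<lambda>\<phi>. F (restrict \<phi> W)"] by (simp only: res)
    moreover have "falling N (card (insert v (W \<union> U))) =
        falling N (card (W \<union> U)) * (of_nat N - of_nat (card (W \<union> U)))"
      using fin v by (simp add: falling_def)
    moreover have IH: "falling N (card W) * (\<Sum>\<phi>\<in>injections (W \<union> U) N. F (restrict \<phi> W)) =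
      falling N (card (W \<union> U)) * (\<Sum>\<psi>\<in>injections W N. F \<psi>)" using insert by blast
    moreover have "W \<union> insert v U = insert v (W \<union> U)" by blast
    ultimately show ?case by (metis (no_types, lifting) mult.assoc mult.left_commute)
  qed
  moreover have "W \<union> (V - W) = V" "finite (V - W)" "(V - W) \<inter> W = {}" using assms by auto
  ultimately show ?thesis by metis
qed

lemma sum_injections_const:
  fixes c :: complex
  assumes "finite V" shows "(\<Sum>\<psi>\<in>injections V N. c) = falling N (card V) * c"
proof -
  have "injections {} N = {\<lambda>x. undefined}" by (auto simp: injections_def)
  then show ?thesis using sum_injections_restrict[OF assms empty_subsetI, of N "\<lambda>_. c"]
    by (simp add: falling_def)
qed

lemma injections_nonempty:
  assumes "finite V" "card V \<le> N" shows "injections V N \<noteq> {}"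
proof
  assume emp: "injections V N = {}"
  have "falling N (card V) = 0" using sum_injections_const[OF assms(1), where N = N and c = 1] unfolding emp by simp
  then show False using falling_nonzero[OF assms(2)] by simp
qed

lemma injections_restrict: "\<phi> \<in> injections V N \<Longrightarrow> W \<subseteq> V \<Longrightarrow> restrict \<phi> W \<in> injections W N"
  by (auto simp: injections_def inj_on_restrict_eq PiE_iff intro: inj_on_subset)

lemma permutation_between_injections:
  assumes fin: "finite V" and \<phi>: "\<phi> \<in> injections V N" "\<psi> \<in> injections V N"
  obtains \<pi> where "\<pi> permutes {..<N}" "\<And>v. v \<in> V \<Longrightarrow> \<pi> (\<phi> v) = \<psi> v"
proof -
  have i: "inj_on \<phi> V" "inj_on \<psi> V" and s: "\<phi> ` V \<subseteq> {..<N}" "\<psi> ` V \<subseteq> {..<N}"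
    using \<phi> by (auto simp: injections_def)
  have "card ({..<N} - \<phi> ` V) = card ({..<N} - \<psi> ` V)"
    using s fin by (simp add: card_Diff_subset card_image i)
  then obtain g where g: "bij_betw g ({..<N} - \<phi> ` V) ({..<N} - \<psi> ` V)"
    using finite_same_card_bij[of "{..<N} - \<phi> ` V" "{..<N} - \<psi> ` V"] by auto
  define h where "h = \<psi> \<circ> the_inv_into V \<phi>"
  have h: "h (\<phi> v) = \<psi> v" if "v \<in> V" for v using that the_inv_into_f_f[OF i(1)] by (simp add: h_def)
  have hb: "bij_betw h (\<phi> ` V) (\<psi> ` V)"
    unfolding h_def using i by (intro bij_betw_trans[OF bij_betw_the_inv_into]) (auto simp: bij_betw_def)
  define \<pi> where "\<pi> x = (if x \<in> \<phi> ` V then h x else if x \<in> {..<N} then g x else x)" for x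
  have "bij_betw \<pi> (\<phi> ` V \<union> ({..<N} - \<phi> ` V)) (\<psi> ` V \<union> ({..<N} - \<psi> ` V))"
  proof (rule bij_betw_combine)
    show "bij_betw \<pi> (\<phi> ` V) (\<psi> ` V)"
      using hb by (rule bij_betw_cong[THEN iffD1, rotated]) (simp add: \<pi>_def)
    show "bij_betw \<pi> ({..<N} - \<phi> ` V) ({..<N} - \<psi> ` V)"
      using g by (rule bij_betw_cong[THEN iffD1, rotated]) (simp add: \<pi>_def)
  qed blast
  moreover have "\<phi> ` V \<union> ({..<N} - \<phi> ` V) = {..<N}" "\<psi> ` V \<union> ({..<N} - \<psi> ` V) = {..<N}" using s by blast+
  ultimately have "bij_betw \<pi> {..<N} {..<N}" by simp
  moreover have "\<pi> x = x" if "x \<notin> {..<N}" for x using that s by (auto simp: \<pi>_def)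
  ultimately have "\<pi> permutes {..<N}" using bij_imp_permutes by blast
  moreover have "\<pi> (\<phi> v) = \<psi> v" if "v \<in> V" for v using that h by (simp add: \<pi>_def)
  ultimately show thesis using that by blast
qed

section \<open>Permutation invariance\<close>

lemma permutation_conjugation_entry:
  assumes A: "A \<in> carrier_mat N N" and \<pi>: "\<pi> permutes {..<N}" and ab: "a < N" "b < N"
  defines "U \<equiv> permutation_mat N \<pi>"
  shows "(U * A * mat_adjoint U) $$ (a, b) = A $$ (inv_into UNIV \<pi> a, inv_into UNIV \<pi> b)" "U * A * mat_adjoint U \<in> carrier_mat N N"
proof -
  have U: "U \<in> carrier_mat N N" by (simp add: U_def permutation_mat_def)
  have Us: "mat_adjoint U \<in> carrier_mat N N" using mat_adjoint_index(2)[OF U ab] .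
  show "U * A * mat_adjoint U \<in> carrier_mat N N" using U A Us by auto
  have eq: "a = \<pi> c \<longleftrightarrow> c = inv_into UNIV \<pi> a" for a c using permutes_inv_eq[OF \<pi>] by metis
  have inv: "inv_into UNIV \<pi> a < N" if "a < N" for a
    using that permutes_in_image[OF permutes_inv[OF \<pi>], of a] by simp
  have Ue: "U $$ (x, y) = (if y = inv_into UNIV \<pi> x then 1 else 0)" if "x < N" "y < N" for x y
    using that by (simp add: U_def permutation_mat_def eq)
  have Use: "mat_adjoint U $$ (y, x) = (if y = inv_into UNIV \<pi> x then 1 else 0)" if "x < N" "y < N" for x y
    using mat_adjoint_index(1)[OF U that(2,1)] Ue[OF that] by simp
  have UA: "(U * A) $$ (a, d) = A $$ (inv_into UNIV \<pi> a, d)" if d: "d < N" for d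
  proof -
    have "(U * A) $$ (a, d) = (\<Sum>c\<in>{0..<N}. U $$ (a, c) * A $$ (c, d))"
      using U A ab d by (simp add: scalar_prod_def)
    also have "\<dots> = (\<Sum>c\<in>{0..<N}. if c = inv_into UNIV \<pi> a then A $$ (c, d) else 0)"
      using Ue[OF ab(1)] by (intro sum.cong) auto
    also have "\<dots> = A $$ (inv_into UNIV \<pi> a, d)" using inv[OF ab(1)] by simp
    finally show ?thesis .
  qed
  have "(U * A * mat_adjoint U) $$ (a, b) = (\<Sum>d\<in>{0..<N}. (U * A) $$ (a, d) * mat_adjoint U $$ (d, b))"
    using U A Us ab by (subst index_mult_mat(1)) (auto simp: scalar_prod_def)
  also have "\<dots> = (\<Sum>d\<in>{0..<N}. if d = inv_into UNIV \<pi> b then A $$ (inv_into UNIV \<pi> a, d) else 0)"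
    using Use[OF ab(2)] UA by (intro sum.cong) auto
  also have "\<dots> = A $$ (inv_into UNIV \<pi> a, inv_into UNIV \<pi> b)" using inv[OF ab(2)] by simp
  finally show "(U * A * mat_adjoint U) $$ (a, b) = A $$ (inv_into UNIV \<pi> a, inv_into UNIV \<pi> b)" .
qed

lemma entries_measurable:
  assumes "\<And>i a b. i \<in> I \<Longrightarrow> a < N \<Longrightarrow> b < N \<Longrightarrow> (\<lambda>\<omega>. B \<omega> i $$ (a, b)) \<in> borel_measurable M"
  shows "(\<lambda>\<omega>. entries I N (B \<omega>)) \<in> measurable M (entry_space I N)"
  unfolding entries_def entry_space_def
  using assms by (intro measurable_restrict) (auto split: prod.split)

lemma letter_entry_measurable:
  assumes "fst l \<in> I" "a < N" "b < N"
  shows "(\<lambda>x. letter_entry l x a b) \<in> borel_measurable (entry_space I N)"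
proof -
  have "(\<lambda>x. x (fst l, c, d)) \<in> borel_measurable (entry_space I N)" if "c < N" "d < N" for c d
    unfolding entry_space_def using assms that by (intro measurable_component_singleton) auto
  from this[of a b] borel_measurable_continuous_on[OF continuous_on_cnj[OF continuous_on_id] this[of b a]]
  show ?thesis using assms by (cases "snd l") (simp_all add: letter_entry_def)
qed

text \<open>The edge product as a function of the array of all entries: equality in law and independence
  are assumptions on this array.\<close>

definition entry_prod :: "'i test_graph \<Rightarrow> (nat \<Rightarrow> nat) \<Rightarrow> ('i \<times> nat \<times> nat \<Rightarrow> complex) \<Rightarrow> complex" where
  "entry_prod T \<phi> x = (\<Prod>e\<in>arcs (graph T).
     letter_entry (label T e) x (\<phi> (tail (graph T) e)) (\<phi> (head (graph T) e)))"

lemma entry_prod_measurable: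
  assumes T: "labelled_in I T" and \<phi>: "\<And>v. v \<in> verts (graph T) \<Longrightarrow> \<phi> v < N"
  shows "entry_prod T \<phi> \<in> borel_measurable (entry_space I N)"
proof -
  interpret fin_digraph "graph T" using T by (simp add: labelled_in_def)
  show ?thesis unfolding entry_prod_def[abs_def]
    using T \<phi> by (intro borel_measurable_prod letter_entry_measurable) (auto simp: labelled_in_def)
qed

lemma edge_prod_eq_entry_prod:
  assumes T: "labelled_in I T" and \<phi>: "\<And>v. v \<in> verts (graph T) \<Longrightarrow> \<phi> v < N"
    and A: "\<And>i. i \<in> I \<Longrightarrow> A i \<in> carrier_mat N N"
  shows "edge_prod A T \<phi> = entry_prod T \<phi> (entries I N A)"
proof -
  interpret fin_digraph "graph T" using T by (simp add: labelled_in_def)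
  show ?thesis unfolding edge_prod_def entry_prod_def
    using T \<phi> A by (intro prod.cong refl letter_mat_entries) (auto simp: labelled_in_def)
qed

lemma expectation_edge_prod_permute:
  assumes A: "random_matrices I M A" and pinv: "permutation_invariant I M A"
    and T: "labelled_in I T" and \<phi>: "\<And>v. v \<in> verts (graph T) \<Longrightarrow> \<phi> v < N"
    and \<pi>: "\<pi> permutes {..<N}"
  shows "(\<integral>\<omega>. edge_prod (A N \<omega>) T (\<pi> \<circ> \<phi>) \<partial>M N) = (\<integral>\<omega>. edge_prod (A N \<omega>) T \<phi> \<partial>M N)"
proof -
  interpret fin_digraph "graph T" using T by (simp add: labelled_in_def)
  define \<sigma> where "\<sigma> = inv_into UNIV \<pi>"
  have \<sigma>: "\<sigma> permutes {..<N}" using permutes_inv[OF \<pi>] by (simp add: \<sigma>_def)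
  have inv\<sigma>: "inv_into UNIV \<sigma> = \<pi>" using permutes_inv_inv[OF \<pi>] by (simp add: \<sigma>_def)
  let ?U = "permutation_mat N \<sigma>"
  define B where "B \<omega> i = ?U * A N \<omega> i * mat_adjoint ?U" for \<omega> i
  have lt: "\<pi> x < N" if "x < N" for x using that permutes_in_image[OF \<pi>, of x] by simp
  have Be: "B \<omega> i $$ (a, b) = A N \<omega> i $$ (\<pi> a, \<pi> b)" "B \<omega> i \<in> carrier_mat N N"
    if "\<omega> \<in> space (M N)" "i \<in> I" "a < N" "b < N" for \<omega> i a b
    using permutation_conjugation_entry[OF random_matricesD(1)[OF A that(2,1)] \<sigma> that(3,4)] inv\<sigma>
    by (simp_all add: B_def)
  have meas: "(\<lambda>\<omega>. A N \<omega> i $$ (a, b)) \<in> borel_measurable (M N)" if "i \<in> I" "a < N" "b < N" for i a b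
    using random_matricesD(2)[OF A that] by (simp add: all_moments_def)
  have mA: "(\<lambda>\<omega>. entries I N (A N \<omega>)) \<in> measurable (M N) (entry_space I N)"
    using meas by (rule entries_measurable)
  have mB: "(\<lambda>\<omega>. entries I N (B \<omega>)) \<in> measurable (M N) (entry_space I N)"
  proof (rule entries_measurable)
    fix i a b assume iab: "i \<in> I" "a < N" "b < N"
    have "(\<lambda>\<omega>. A N \<omega> i $$ (\<pi> a, \<pi> b)) \<in> borel_measurable (M N)" using meas iab lt by blast
    moreover have "B \<omega> i $$ (a, b) = A N \<omega> i $$ (\<pi> a, \<pi> b)" if "\<omega> \<in> space (M N)" for \<omega>
      using Be(1) iab that by blast
    ultimately show "(\<lambda>\<omega>. B \<omega> i $$ (a, b)) \<in> borel_measurable (M N)"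
      by (subst measurable_cong) auto
  qed
  have mT: "entry_prod T \<phi> \<in> borel_measurable (entry_space I N)" by (rule entry_prod_measurable[OF T \<phi>])
  have d: "distr (M N) (entry_space I N) (\<lambda>\<omega>. entries I N (B \<omega>)) =
      distr (M N) (entry_space I N) (\<lambda>\<omega>. entries I N (A N \<omega>))"
    using pinv[unfolded permutation_invariant_def Let_def, rule_format, OF \<sigma>] by (simp only: B_def[abs_def])
  have "(\<integral>\<omega>. edge_prod (A N \<omega>) T (\<pi> \<circ> \<phi>) \<partial>M N) = (\<integral>\<omega>. entry_prod T \<phi> (entries I N (B \<omega>)) \<partial>M N)"
  proof (rule Bochner_Integration.integral_cong[OF refl])
    fix \<omega> assume \<omega>: "\<omega> \<in> space (M N)"
    have "edge_prod (A N \<omega>) T (\<pi> \<circ> \<phi>) = entry_prod T (\<pi> \<circ> \<phi>) (entries I N (A N \<omega>))"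
      using \<phi> lt random_matricesD(1)[OF A _ \<omega>] by (intro edge_prod_eq_entry_prod[OF T]) auto
    also have "\<dots> = entry_prod T \<phi> (entries I N (B \<omega>))"
      unfolding entry_prod_def
    proof (intro prod.cong refl)
      fix e assume e: "e \<in> arcs (graph T)"
      then have "fst (label T e) \<in> I" "\<phi> (tail (graph T) e) < N" "\<phi> (head (graph T) e) < N"
        using T \<phi> by (auto simp: labelled_in_def)
      then show "letter_entry (label T e) (entries I N (A N \<omega>)) ((\<pi> \<circ> \<phi>) (tail (graph T) e)) ((\<pi> \<circ> \<phi>) (head (graph T) e)) =
          letter_entry (label T e) (entries I N (B \<omega>)) (\<phi> (tail (graph T) e)) (\<phi> (head (graph T) e))"
        using Be(1)[OF \<omega>] lt by (simp add: letter_entry_def entries_def)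
    qed
    finally show "edge_prod (A N \<omega>) T (\<pi> \<circ> \<phi>) = entry_prod T \<phi> (entries I N (B \<omega>))" .
  qed
  also have "\<dots> = (\<integral>x. entry_prod T \<phi> x \<partial>distr (M N) (entry_space I N) (\<lambda>\<omega>. entries I N (B \<omega>)))"
    by (rule integral_distr[OF mB mT, symmetric])
  also have "\<dots> = (\<integral>\<omega>. entry_prod T \<phi> (entries I N (A N \<omega>)) \<partial>M N)"
    unfolding d by (rule integral_distr[OF mA mT])
  also have "\<dots> = (\<integral>\<omega>. edge_prod (A N \<omega>) T \<phi> \<partial>M N)"
    by (intro Bochner_Integration.integral_cong[OF refl] edge_prod_eq_entry_prod[OF T \<phi>, symmetric]
        random_matricesD(1)[OF A])
  finally show ?thesis .
qed

text \<open>Two injections differ by a permutation of the values.\<close>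

lemma expectation_edge_prod_injection_indep:
  assumes A: "random_matrices I M A" and pinv: "permutation_invariant I M A"
    and T: "labelled_in I T" and \<phi>: "\<phi> \<in> injections (verts (graph T)) N" "\<psi> \<in> injections (verts (graph T)) N"
  shows "(\<integral>\<omega>. edge_prod (A N \<omega>) T \<phi> \<partial>M N) = (\<integral>\<omega>. edge_prod (A N \<omega>) T \<psi> \<partial>M N)"
proof -
  interpret fin_digraph "graph T" using T by (simp add: labelled_in_def)
  obtain \<pi> where \<pi>: "\<pi> permutes {..<N}" "\<And>v. v \<in> verts (graph T) \<Longrightarrow> \<pi> (\<psi> v) = \<phi> v"
    using permutation_between_injections[OF finite_verts \<phi>(2,1)] by metis
  have "edge_prod (A N \<omega>) T \<phi> = edge_prod (A N \<omega>) T (\<pi> \<circ> \<psi>)" for \<omega>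
    using \<pi>(2) by (intro edge_prod_cong[OF wf_digraph]) simp
  moreover have "\<psi> v < N" if "v \<in> verts (graph T)" for v using \<phi>(2) that by (auto simp: injections_def)
  ultimately show ?thesis using expectation_edge_prod_permute[OF A pinv T _ \<pi>(1), of \<psi>] by simp
qed

section \<open>Independent families\<close>

definition family_test_graph :: "nat \<Rightarrow> (nat \<times> 'i) test_graph \<Rightarrow> 'i test_graph" where
  "family_test_graph j T =
     \<lparr> graph = family_subgraph j T, label = (\<lambda>e. (snd (fst (label T e)), snd (label T e))) \<rparr>"

lemma family_subgraph_simps [simp]:
  "arcs (family_subgraph j T) = {e \<in> arcs (graph T). fst (fst (label T e)) = j}"
  "tail (family_subgraph j T) = tail (graph T)" "head (family_subgraph j T) = head (graph T)"
  "verts (family_subgraph j T) = tail (graph T) ` {e \<in> arcs (graph T). fst (fst (label T e)) = j} \<union>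
     head (graph T) ` {e \<in> arcs (graph T). fst (fst (label T e)) = j}"
  by (simp_all add: family_subgraph_def Let_def)

lemma family_test_graph_simps [simp]:
  "graph (family_test_graph j T) = family_subgraph j T"
  "label (family_test_graph j T) = (\<lambda>e. (snd (fst (label T e)), snd (label T e)))"
  by (simp_all add: family_test_graph_def)

lemma family_subgraph_fin_digraph:
  assumes "fin_digraph (graph T)" shows "fin_digraph (family_subgraph j T)"
proof -
  interpret fin_digraph "graph T" by fact
  show ?thesis by unfold_locales auto
qed

lemma family_subgraph_verts_subset:
  assumes "wf_digraph (graph T)" shows "verts (family_subgraph j T) \<subseteq> verts (graph T)"
  using assms by (auto simp: wf_digraph_def)

lemma family_test_graph_labelled:
  assumes "labelled_in (joint_index p q) T"
  shows "labelled_in {..<q j} (family_test_graph j T)"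
  using assms family_subgraph_fin_digraph[of T j] unfolding labelled_in_def joint_index_def by fastforce

lemma edge_prod_joint:
  assumes T: "labelled_in (joint_index p q) T"
  shows "edge_prod (joint_family Z N \<omega>) T \<phi> = (\<Prod>j<p. edge_prod (Z j N \<omega>) (family_test_graph j T) \<phi>)"
proof -
  interpret fin_digraph "graph T" using T by (simp add: labelled_in_def)
  let ?f = "\<lambda>e. letter_mat (joint_family Z N \<omega>) (label T e) $$ (\<phi> (tail (graph T) e), \<phi> (head (graph T) e))"
  have "edge_prod (joint_family Z N \<omega>) T \<phi> = prod ?f (\<Union>j<p. arcs (family_subgraph j T))"
    unfolding edge_prod_def
    using T by (intro prod.cong) (auto simp: labelled_in_def joint_index_def)
  also have "\<dots> = (\<Prod>j<p. prod ?f (arcs (family_subgraph j T)))"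
    by (rule prod.UNION_disjoint) auto
  also have "\<dots> = (\<Prod>j<p. edge_prod (Z j N \<omega>) (family_test_graph j T) \<phi>)"
    unfolding edge_prod_def
    by (intro prod.cong refl) (auto simp: letter_mat_def joint_family_def split: prod.split)
  finally show ?thesis .
qed

lemma expectation_edge_prod_joint:
  assumes ind: "independent_traffic_families p q M Z \<tau>" and T: "labelled_in (joint_index p q) T"
    and \<phi>: "\<And>v. v \<in> verts (graph T) \<Longrightarrow> \<phi> v < N"
  shows "(\<integral>\<omega>. edge_prod (joint_family Z N \<omega>) T \<phi> \<partial>M N) =
    (\<Prod>j<p. \<integral>\<omega>. edge_prod (Z j N \<omega>) (family_test_graph j T) \<phi> \<partial>M N)"
proof -
  have ps: "prob_space (M N)" and rm: "\<And>j. j < p \<Longrightarrow> random_matrices {..<q j} M (Z j)"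
    and iv: "prob_space.indep_vars (M N) (\<lambda>j. entry_space {..<q j} N)
            (\<lambda>j \<omega>. entries {..<q j} N (Z j N \<omega>)) {..<p}"
    using ind by (simp_all add: independent_traffic_families_def)
  interpret prob_space "M N" by fact
  have wf: "wf_digraph (graph T)" using T by (simp add: labelled_in_def fin_digraph_def)
  let ?T = "\<lambda>j. family_test_graph j T"
  have Tj: "labelled_in {..<q j} (?T j)" for j by (rule family_test_graph_labelled[OF T])
  have \<phi>j: "\<phi> v < N" if "v \<in> verts (graph (?T j))" for v j
    using \<phi> family_subgraph_verts_subset[OF wf, of j] that by auto
  have "indep_vars (\<lambda>_. borel) (\<lambda>j \<omega>. entry_prod (?T j) \<phi> (entries {..<q j} N (Z j N \<omega>))) {..<p}"
    using iv entry_prod_measurable[OF Tj \<phi>j] by (rule indep_vars_compose2)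
  moreover have eq: "entry_prod (?T j) \<phi> (entries {..<q j} N (Z j N \<omega>)) = edge_prod (Z j N \<omega>) (?T j) \<phi>"
    if "j < p" "\<omega> \<in> space (M N)" for j \<omega>
    by (intro edge_prod_eq_entry_prod[OF Tj \<phi>j, symmetric] random_matricesD(1)[OF rm[OF that(1)] _ that(2)])
  moreover have "integrable (M N) (\<lambda>\<omega>. entry_prod (?T j) \<phi> (entries {..<q j} N (Z j N \<omega>)))" if "j < p" for j
    using all_moments_integrable[OF edge_prod_all_moments[where M = M, OF ps rm[OF that] Tj \<phi>j]] eq[OF that]
    by (subst Bochner_Integration.integrable_cong[OF refl]) auto
  ultimately have "(\<integral>\<omega>. (\<Prod>j<p. entry_prod (?T j) \<phi> (entries {..<q j} N (Z j N \<omega>))) \<partial>M N) =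
      (\<Prod>j<p. \<integral>\<omega>. entry_prod (?T j) \<phi> (entries {..<q j} N (Z j N \<omega>)) \<partial>M N)"
    by (intro indep_vars_lebesgue_integral) auto
  also have "(\<integral>\<omega>. (\<Prod>j<p. entry_prod (?T j) \<phi> (entries {..<q j} N (Z j N \<omega>))) \<partial>M N) =
      (\<integral>\<omega>. edge_prod (joint_family Z N \<omega>) T \<phi> \<partial>M N)"
    unfolding edge_prod_joint[OF T] using eq by (intro Bochner_Integration.integral_cong prod.cong) auto
  also have "(\<Prod>j<p. \<integral>\<omega>. entry_prod (?T j) \<phi> (entries {..<q j} N (Z j N \<omega>)) \<partial>M N) =
      (\<Prod>j<p. \<integral>\<omega>. edge_prod (Z j N \<omega>) (?T j) \<phi> \<partial>M N)"
    using eq by (intro Bochner_Integration.integral_cong prod.cong) auto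
  finally show ?thesis .
qed

lemma random_matrices_joint:
  assumes "\<And>j. j < p \<Longrightarrow> random_matrices {..<q j} M (Z j)"
  shows "random_matrices (joint_index p q) M (joint_family Z)"
  using assms unfolding random_matrices_def joint_index_def joint_family_def by auto

text \<open>For a permutation invariant family, the expected edge product does not depend on the injection;
  a sum over injections of a product in which all but one factor are constant factorises, up to the
  number of ways to extend injections.\<close>

lemma expectation_inj_sum_joint:
  assumes ind: "independent_traffic_families p q M Z \<tau>" and T: "labelled_in (joint_index p q) T"
    and p: "0 < p" and N: "card (verts (graph T)) \<le> N"
  shows "(\<Prod>j<p. falling N (card (verts (family_subgraph j T)))) *
      (\<integral>\<omega>. inj_sum N (joint_family Z N \<omega>) T \<partial>M N) =
    falling N (card (verts (graph T))) *
      (\<Prod>j<p. \<integral>\<omega>. inj_sum N (Z j N \<omega>) (family_test_graph j T) \<partial>M N)"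
proof -
  have ps: "\<And>N. prob_space (M N)" and rm: "\<And>j. j < p \<Longrightarrow> random_matrices {..<q j} M (Z j)"
    using ind by (simp_all add: independent_traffic_families_def)
  have "\<exists>j\<^sub>0. \<forall>j<p. j \<noteq> j\<^sub>0 \<longrightarrow> permutation_invariant {..<q j} M (Z j)"
    using ind by (simp add: independent_traffic_families_def)
  \<comment> \<open>If all families are invariant, any index can play the role of the exceptional one.\<close>
  then obtain k where k: "k < p" and pinv: "\<And>j. j < p \<Longrightarrow> j \<noteq> k \<Longrightarrow> permutation_invariant {..<q j} M (Z j)"
    using p by (metis (no_types))
  let ?G = "graph T" let ?V = "verts ?G" let ?W = "\<lambda>j. verts (family_subgraph j T)"
  let ?T = "\<lambda>j. family_test_graph j T"
  interpret fin_digraph ?G using T by (simp add: labelled_in_def)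
  have Tj: "labelled_in {..<q j} (?T j)" for j by (rule family_test_graph_labelled[OF T])
  have WV: "?W j \<subseteq> ?V" for j by (rule family_subgraph_verts_subset[OF wf_digraph])
  have finW: "finite (?W j)" for j using WV finite_verts by (rule finite_subset)
  have wfj: "wf_digraph (graph (?T j))" for j using Tj by (simp add: labelled_in_def fin_digraph_def)
  define m where "m j \<phi> = (\<integral>\<omega>. edge_prod (Z j N \<omega>) (?T j) \<phi> \<partial>M N)" for j \<phi>
  have mres: "m j (restrict \<phi> (?W j)) = m j \<phi>" for j \<phi>
    unfolding m_def by (intro arg_cong[where f = "integral\<^sup>L (M N)"] ext edge_prod_cong[OF wfj]) simp
  have lt: "\<phi> v < N" if "\<phi> \<in> injections V N" "v \<in> V" for \<phi> V v using that by (auto simp: injections_def)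
  have Ej: "(\<integral>\<omega>. inj_sum N (Z j N \<omega>) (?T j) \<partial>M N) = (\<Sum>\<psi>\<in>injections (?W j) N. m j \<psi>)" if "j < p" for j
    unfolding inj_sum_def m_def family_test_graph_simps(1)
    using all_moments_integrable[OF edge_prod_all_moments[where M = M, OF ps rm[OF that] Tj]] lt
    by (intro Bochner_Integration.integral_sum) auto
  have rmJ: "random_matrices (joint_index p q) M (joint_family Z)" using rm by (rule random_matrices_joint)
  have "(\<integral>\<omega>. inj_sum N (joint_family Z N \<omega>) T \<partial>M N) =
      (\<Sum>\<phi>\<in>injections ?V N. \<integral>\<omega>. edge_prod (joint_family Z N \<omega>) T \<phi> \<partial>M N)"
    unfolding inj_sum_def
    using all_moments_integrable[OF edge_prod_all_moments[where M = M, OF ps rmJ T]] lt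
    by (intro Bochner_Integration.integral_sum) auto
  also have "\<dots> = (\<Sum>\<phi>\<in>injections ?V N. \<Prod>j<p. m j \<phi>)"
    unfolding m_def using expectation_edge_prod_joint[OF ind T] lt by (intro sum.cong refl) auto
  finally have joint: "(\<integral>\<omega>. inj_sum N (joint_family Z N \<omega>) T \<partial>M N) = (\<Sum>\<phi>\<in>injections ?V N. \<Prod>j<p. m j \<phi>)" .
  obtain \<phi>0 where \<phi>0: "\<phi>0 \<in> injections ?V N" using injections_nonempty[OF finite_verts N] by blast
  have mconst: "m j \<psi> = m j \<phi>0" if "j < p" "j \<noteq> k" "\<psi> \<in> injections (?W j) N" for j \<psi>
  proof -
    have "m j \<psi> = m j (restrict \<phi>0 (?W j))"
      unfolding m_def
      using expectation_edge_prod_injection_indep[OF rm[OF that(1)] pinv[OF that(1,2)] Tj, of \<psi> N "restrict \<phi>0 (?W j)"]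
        that(3) injections_restrict[OF \<phi>0 WV] by simp
    then show ?thesis using mres by simp
  qed
  have mconst': "m j \<phi> = m j \<phi>0" if "j < p" "j \<noteq> k" "\<phi> \<in> injections ?V N" for j \<phi>
    using mconst[OF that(1,2) injections_restrict[OF that(3) WV]] mres by simp
  let ?J = "{..<p} - {k}"
  have split: "(\<Prod>j<p. f j) = f k * (\<Prod>j\<in>?J. f j)" for f :: "nat \<Rightarrow> complex"
    using k by (intro prod.remove) auto
  have EJ: "(\<Sum>\<psi>\<in>injections (?W j) N. m j \<psi>) = falling N (card (?W j)) * m j \<phi>0" if "j \<in> ?J" for j
  proof -
    have "(\<Sum>\<psi>\<in>injections (?W j) N. m j \<psi>) = (\<Sum>\<psi>\<in>injections (?W j) N. m j \<phi>0)"
      using mconst[of j] that by (intro sum.cong refl) auto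
    then show ?thesis using sum_injections_const[OF finW] by metis
  qed
  have "(\<Sum>\<phi>\<in>injections ?V N. \<Prod>j<p. m j \<phi>) = (\<Sum>\<phi>\<in>injections ?V N. m k \<phi> * (\<Prod>j\<in>?J. m j \<phi>0))"
    unfolding split using mconst' by (intro sum.cong arg_cong2[where f = "(*)"] prod.cong refl) auto
  also have "\<dots> = (\<Sum>\<phi>\<in>injections ?V N. m k \<phi>) * (\<Prod>j\<in>?J. m j \<phi>0)" by (rule sum_distrib_right[symmetric])
  finally have fac: "(\<integral>\<omega>. inj_sum N (joint_family Z N \<omega>) T \<partial>M N) =
      (\<Sum>\<phi>\<in>injections ?V N. m k \<phi>) * (\<Prod>j\<in>?J. m j \<phi>0)" using joint by simp
  have sk: "falling N (card (?W k)) * (\<Sum>\<phi>\<in>injections ?V N. m k \<phi>) =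
      falling N (card ?V) * (\<Sum>\<psi>\<in>injections (?W k) N. m k \<psi>)"
    using sum_injections_restrict[OF finite_verts WV[of k], of N "m k"] by (simp only: mres)
  have "(\<Prod>j<p. falling N (card (?W j))) * (\<integral>\<omega>. inj_sum N (joint_family Z N \<omega>) T \<partial>M N) =
      (falling N (card (?W k)) * (\<Sum>\<phi>\<in>injections ?V N. m k \<phi>)) *
      ((\<Prod>j\<in>?J. falling N (card (?W j))) * (\<Prod>j\<in>?J. m j \<phi>0))"
    unfolding fac split by (simp only: mult_ac)
  also have "\<dots> = falling N (card ?V) * ((\<Sum>\<psi>\<in>injections (?W k) N. m k \<psi>) *
      (\<Prod>j\<in>?J. \<Sum>\<psi>\<in>injections (?W j) N. m j \<psi>))"
  proof -
    have "(\<Prod>j\<in>?J. \<Sum>\<psi>\<in>injections (?W j) N. m j \<psi>) = (\<Prod>j\<in>?J. falling N (card (?W j)) * m j \<phi>0)"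
      using EJ by (intro prod.cong refl)
    then show ?thesis unfolding sk by (simp only: prod.distrib mult_ac)
  qed
  also have "(\<Sum>\<psi>\<in>injections (?W k) N. m k \<psi>) * (\<Prod>j\<in>?J. \<Sum>\<psi>\<in>injections (?W j) N. m j \<psi>) =
      (\<Prod>j<p. \<integral>\<omega>. inj_sum N (Z j N \<omega>) (?T j) \<partial>M N)"
    unfolding split[of "\<lambda>j. \<Sum>\<psi>\<in>injections (?W j) N. m j \<psi>", symmetric]
    using Ej by (intro prod.cong refl) simp
  finally show ?thesis .
qed

section \<open>Traffic freeness of the joint family\<close>

lemma family_components_eq: "family_components j T = components (family_subgraph j T)"
  by (simp add: family_components_def components_def)

lemma reduced_graph_eq_incidence_graph:
  "reduced_graph p T = incidence_graph (\<Union>j<p. components (family_subgraph j T))"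
  by (simp add: reduced_graph_def incidence_graph_def family_components_eq)

lemma component_test_graph_eq:
  "component_test_graph T C = (family_test_graph j T)\<lparr>graph := C\<rparr>"
  by (simp add: component_test_graph_def family_test_graph_def)

lemma sum_card_verts_components:
  assumes fin: "fin_digraph G"
  shows "(\<Sum>C\<in>components G. card (verts C)) = card (verts G)"
proof -
  have "card (\<Union>C\<in>components G. verts C) = (\<Sum>C\<in>components G. card (verts C))"
  proof (rule card_UN_disjoint[OF finite_components[OF fin]])
    show "\<forall>C\<in>components G. finite (verts C)"
      using fin_digraph.finite_verts[OF components_fin[OF fin]] by blast
    show "\<forall>C\<in>components G. \<forall>D\<in>components G. C \<noteq> D \<longrightarrow> verts C \<inter> verts D = {}"
    proof (intro ballI impI)
      fix C D assume "C \<in> components G" "D \<in> components G" "C \<noteq> D"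
      then show "verts C \<inter> verts D = {}" using components_overlap_eq[of C G D] by auto
    qed
  qed
  then show ?thesis using components_Union_verts[OF fin] by simp
qed

lemma family_component_arc:
  assumes fin: "fin_digraph (graph T)" and C: "C \<in> components (family_subgraph j T)"
  obtains e where "e \<in> arcs C" "fst (fst (label T e)) = j"
proof -
  let ?F = "family_subgraph j T"
  obtain v where v: "v \<in> verts C" using components_verts_nonempty[OF C] by blast
  have sub: "subgraph C ?F" by (rule components_subgraph(1)[OF C])
  then have "v \<in> verts ?F" using v by (auto simp: subgraph_def)
  then obtain e where e: "e \<in> arcs ?F" "v = tail ?F e \<or> v = head ?F e" by auto
  then have "e \<in> arcs C" using components_arc_iff[OF C e(1)] v by auto
  then show thesis using that e(1) by simp
qed

text \<open>Components of different families are different because each of them has an arc: the subgraph of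
  a family has no isolated vertices.\<close>

lemma family_components_blocks:
  fixes T :: "(nat \<times> nat) test_graph"
  assumes fin: "fin_digraph (graph T)"
  shows "blocks (tail (graph T)) (head (graph T)) (\<Union>j<p. components (family_subgraph j T))"
    and "i \<noteq> j \<Longrightarrow> components (family_subgraph i T) \<inter> components (family_subgraph j T) = {}"
proof -
  have finj: "fin_digraph (family_subgraph j T)" for j by (rule family_subgraph_fin_digraph[OF fin])
  have lab: "fst (fst (label T e)) = j" if "C \<in> components (family_subgraph j T)" "e \<in> arcs C" for C j e
    using components_subgraph(1)[OF that(1)] that(2) by (auto simp: subgraph_def)
  show "components (family_subgraph i T) \<inter> components (family_subgraph j T) = {}" if "i \<noteq> j" for i j
  proof (rule ccontr)
    assume "components (family_subgraph i T) \<inter> components (family_subgraph j T) \<noteq> {}"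
    then obtain C where C: "C \<in> components (family_subgraph i T)" "C \<in> components (family_subgraph j T)" by blast
    obtain e where "e \<in> arcs C" using family_component_arc[OF fin C(1)] by metis
    then show False using lab[OF C(1)] lab[OF C(2)] that by simp
  qed
  show "blocks (tail (graph T)) (head (graph T)) (\<Union>j<p. components (family_subgraph j T))"
    unfolding blocks_def
  proof (intro conjI ballI impI)
    show "finite (\<Union>j<p. components (family_subgraph j T))" using finite_components[OF finj] by simp
    fix C assume "C \<in> (\<Union>j<p. components (family_subgraph j T))"
    then obtain j where C: "C \<in> components (family_subgraph j T)" by blast
    show "fin_digraph C" "connected C" "tail C = tail (graph T)" "head C = head (graph T)"
      using components_fin[OF finj C] components_subgraph(2)[OF C] components_tail_head[OF C] by auto
    fix D assume "D \<in> (\<Union>j<p. components (family_subgraph j T))" "C \<noteq> D"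
    then obtain i where D: "D \<in> components (family_subgraph i T)" by blast
    show "arcs C \<inter> arcs D = {}"
    proof (cases "i = j")
      case True
      then show ?thesis using components_disjoint_arcs C D \<open>C \<noteq> D\<close> by blast
    next
      case False
      then show ?thesis using lab[OF C] lab[OF D] by auto
    qed
  qed
qed

text \<open>A connected graph with at least one arc has no isolated vertices, so every vertex is touched by
  some family.\<close>

lemma join_family_components:
  assumes T: "labelled_in (joint_index p q) T" and con: "connected (graph T)" and ne: "arcs (graph T) \<noteq> {}"
  shows "join (tail (graph T)) (head (graph T)) (\<Union>j<p. components (family_subgraph j T)) = graph T"
proof -
  interpret fin_digraph "graph T" using T by (simp add: labelled_in_def)
  have fin: "fin_digraph (graph T)" using T by (simp add: labelled_in_def)
  have finj: "fin_digraph (family_subgraph j T)" for j by (rule family_subgraph_fin_digraph[OF fin])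
  have lab: "fst (fst (label T e)) < p" if "e \<in> arcs (graph T)" for e
    using T that by (auto simp: labelled_in_def joint_index_def)
  have A: "(\<Union>C\<in>(\<Union>j<p. components (family_subgraph j T)). arcs C) = arcs (graph T)"
  proof -
    have "(\<Union>C\<in>(\<Union>j<p. components (family_subgraph j T)). arcs C) = (\<Union>j<p. arcs (family_subgraph j T))"
      using components_Union_arcs[OF finj] by blast
    then show ?thesis using lab by auto
  qed
  have inc: "\<exists>e\<in>arcs (graph T). v = tail (graph T) e \<or> v = head (graph T) e" if v: "v \<in> verts (graph T)" for v
  proof (rule ccontr)
    assume no: "\<not> ?thesis"
    then have "boundary (graph T) {v} = {}" by (auto simp: boundary_def)
    then have "{v} = verts (graph T)" using connectedD_boundary[OF con wf_digraph, of "{v}"] v by auto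
    moreover obtain e where "e \<in> arcs (graph T)" using ne by blast
    ultimately have "tail (graph T) e \<in> {v}" "e \<in> arcs (graph T)" using tail_in_verts[of e] by metis+
    then show False using no by auto
  qed
  have V: "(\<Union>C\<in>(\<Union>j<p. components (family_subgraph j T)). verts C) = verts (graph T)"
  proof -
    have "(\<Union>C\<in>(\<Union>j<p. components (family_subgraph j T)). verts C) = (\<Union>j<p. verts (family_subgraph j T))"
      using components_Union_verts[OF finj] by blast
    moreover have "\<dots> = verts (graph T)"
    proof
      show "(\<Union>j<p. verts (family_subgraph j T)) \<subseteq> verts (graph T)"
        using family_subgraph_verts_subset[OF wf_digraph] by blast
      show "verts (graph T) \<subseteq> (\<Union>j<p. verts (family_subgraph j T))"
      proof
        fix v assume "v \<in> verts (graph T)"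
        then obtain e where e: "e \<in> arcs (graph T)" "v = tail (graph T) e \<or> v = head (graph T) e"
          using inc by blast
        then have "v \<in> verts (family_subgraph (fst (fst (label T e))) T)" by auto
        then show "v \<in> (\<Union>j<p. verts (family_subgraph j T))" using lab[OF e(1)] by blast
      qed
    qed
    ultimately show ?thesis by simp
  qed
  show ?thesis
    using A V by (intro pre_digraph.equality) (simp_all only: join_simps A V, simp)
qed

lemma tau0_limit_single_vertex:
  assumes v: "verts (graph T) = {v}" and e: "arcs (graph T) = {}" and ps: "\<And>N. prob_space (M N)"
  shows "(\<lambda>N. \<integral>\<omega>. tau0 N (A N \<omega>) T \<partial>M N) \<longlonglongrightarrow> 1"
proof -
  have "tau0 N (A N \<omega>) T = 1" if "0 < N" for N \<omega>
  proof -
    have "(\<Sum>\<phi>\<in>injections {v} N. 1) = (of_nat N :: complex)"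
      using sum_injections_const[where V = "{v}" and N = N and c = 1] by (simp add: falling_def)
    then have "inj_sum N (A N \<omega>) T = of_nat N" unfolding inj_sum_def edge_prod_def v e prod.empty .
    then show ?thesis using that by (simp add: tau0_eq_inj_sum)
  qed
  then have "(\<integral>\<omega>. tau0 N (A N \<omega>) T \<partial>M N) = 1" if "0 < N" for N
    using prob_space.prob_space[OF ps, of N] that by simp
  then have "eventually (\<lambda>N. 1 = (\<integral>\<omega>. tau0 N (A N \<omega>) T \<partial>M N)) sequentially"
    by (intro eventually_mono[OF eventually_gt_at_top[of 0]]) simp
  then show ?thesis by (rule Lim_transform_eventually[OF tendsto_const])
qed

text \<open>The exact formula for the joint injective sum turns the expectation into the product of a
  factor tending to \<open>1\<close>, from the falling factorials, and of a power of \<open>N\<close> times the expected injective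
  sums of the families; \<open>block_exponent\<close> controls the total power of \<open>N\<close>.\<close>

lemma traffic_limit_joint:
  assumes ind: "independent_traffic_families p q M Z \<tau>"
  shows "traffic_limit (joint_index p q) M (joint_family Z) (traffic_free_product p \<tau>)"
  unfolding traffic_limit_def
proof (intro allI impI)
  fix T assume cyc: "cyclic_test_graph (joint_index p q) T"
  have ps: "\<And>N. prob_space (M N)" and rm: "\<And>j. j < p \<Longrightarrow> random_matrices {..<q j} M (Z j)"
    and lim: "\<And>j. j < p \<Longrightarrow> traffic_limit {..<q j} M (Z j) (\<tau> j)"
    and conc: "\<And>j. j < p \<Longrightarrow> concentration {..<q j} M (Z j)"
    and tight: "\<And>j. j < p \<Longrightarrow> tightness {..<q j} M (Z j)"
    using ind by (simp_all add: independent_traffic_families_def)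
  let ?G = "graph T"
  have fin: "fin_digraph ?G" and con: "connected ?G" and T: "labelled_in (joint_index p q) T"
    using cyc by (auto simp: cyclic_test_graph_def test_graph_def labelled_in_def)
  have bal: "balanced ?G"
    using cyc euler_trail_iff_balanced[OF fin con] by (simp add: cyclic_test_graph_def)
  interpret fin_digraph ?G by fact
  let ?F = "\<lambda>j. family_subgraph j T" let ?T = "\<lambda>j. family_test_graph j T"
  have finj: "fin_digraph (?F j)" for j by (rule family_subgraph_fin_digraph[OF fin])
  show "(\<lambda>N. \<integral>\<omega>. tau0 N (joint_family Z N \<omega>) T \<partial>M N) \<longlonglongrightarrow> traffic_free_product p \<tau> T"
  proof (cases "arcs ?G = {}")
    case True
    obtain v where v: "v \<in> verts ?G" using con connected_iff_boundary[OF wf_digraph] by blast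
    have "boundary ?G {v} = {}" using True by (simp add: boundary_def)
    then have V: "verts ?G = {v}" using connectedD_boundary[OF con wf_digraph, of "{v}"] v by auto
    have "family_components j T = {}" for j
    proof -
      have "verts (?F j) = {}" using True by simp
      then have "verts C = {}" if "C \<in> components (?F j)" for C
        using components_Union_verts[OF finj, of j] that by blast
      then have "components (?F j) = {}" using components_verts_nonempty by blast
      then show ?thesis by (simp add: family_components_eq)
    qed
    then have "traffic_free_product p \<tau> T = 1" using True by (simp add: traffic_free_product_def free_product_def)
    then show ?thesis using tau0_limit_single_vertex[OF V True ps] by simp
  next
    case False
    let ?comps = "\<lambda>j. components (?F j)"
    define K where "K = (\<Union>j<p. ?comps j)"
    have K: "blocks (tail ?G) (head ?G) K" unfolding K_def by (rule family_components_blocks(1)[OF fin])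
    have jn: "join (tail ?G) (head ?G) K = ?G" unfolding K_def by (rule join_family_components[OF T con False])
    have conK: "connected (join (tail ?G) (head ?G) K)" and balK: "balanced (join (tail ?G) (head ?G) K)"
      using con bal unfolding jn .
    have neK: "K \<noteq> {}"
    proof
      assume "K = {}"
      then have "arcs ?G = {}" using jn by (metis join_simps(2) UN_empty)
      then show False using False by simp
    qed
    have p0: "0 < p" using neK by (auto simp: K_def)
    have VK: "(\<Union>C\<in>K. verts C) = verts ?G" using jn join_simps(1) by metis
    have sumK: "(\<Sum>C\<in>K. f C) = (\<Sum>j<p. \<Sum>C\<in>?comps j. f C)" for f :: "_ \<Rightarrow> nat"
      unfolding K_def
    proof (rule sum.UNION_disjoint)
      show "\<forall>j\<in>{..<p}. finite (?comps j)" using finite_components[OF finj] by blast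
      show "\<forall>i\<in>{..<p}. \<forall>j\<in>{..<p}. i \<noteq> j \<longrightarrow> ?comps i \<inter> ?comps j = {}"
        using family_components_blocks(2)[OF fin] by blast
    qed simp
    let ?w = "\<lambda>j. card (verts (?F j))"
    have sumV: "(\<Sum>C\<in>K. card (verts C)) = (\<Sum>j<p. ?w j)"
      unfolding sumK using sum_card_verts_components[OF finj] by (intro sum.cong refl)
    have cardK: "card K = (\<Sum>j<p. card (?comps j))" using sumK[of "\<lambda>_. 1"] by simp
    define d where "d = card (verts ?G)"
    define E where "E j N = (\<integral>\<omega>. inj_sum N (Z j N \<omega>) (?T j) \<partial>M N)" for j N
    \<comment> \<open>The falling factorials, compared with the powers of \<open>N\<close> that they replace.\<close>
    define R where "R N = (falling N d / of_nat N ^ d) * (\<Prod>j<p. of_nat N ^ ?w j / falling N (?w j))" for N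
    have "R \<longlonglongrightarrow> 1 * (\<Prod>j<p. inverse 1)"
      unfolding R_def
    proof (intro tendsto_mult tendsto_prod falling_asymptotic)
      fix j
      have "(\<lambda>N. inverse (falling N (?w j) / of_nat N ^ ?w j)) \<longlonglongrightarrow> inverse 1"
        by (intro tendsto_inverse falling_asymptotic) simp
      then show "(\<lambda>N. of_nat N ^ ?w j / falling N (?w j)) \<longlonglongrightarrow> inverse 1" by simp
    qed
    then have R1: "R \<longlonglongrightarrow> 1" by simp
    have wd: "?w j \<le> d" for j
      unfolding d_def using family_subgraph_verts_subset[OF wf_digraph] by (intro card_mono) auto
    \<comment> \<open>The leading order of the expectation.\<close>
    define Y where "Y N = of_nat N ^ d / (of_nat N * (\<Prod>j<p. of_nat N ^ ?w j)) * (\<Prod>j<p. E j N)" for N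
    have "eventually (\<lambda>N. R N * Y N = (\<integral>\<omega>. tau0 N (joint_family Z N \<omega>) T \<partial>M N)) sequentially"
      using eventually_gt_at_top[of 0] eventually_ge_at_top[of d]
    proof eventually_elim
      case (elim N)
      have f0: "falling N (?w j) \<noteq> 0" for j using wd[of j] elim by (intro falling_nonzero) simp
      then have P0: "(\<Prod>j<p. falling N (?w j)) \<noteq> 0" by simp
      have N0: "(of_nat N :: complex) \<noteq> 0" "(\<Prod>j<p. (of_nat N :: complex) ^ ?w j) \<noteq> 0" using elim by auto
      have "(\<Prod>j<p. falling N (?w j)) * (\<integral>\<omega>. inj_sum N (joint_family Z N \<omega>) T \<partial>M N) = falling N d * (\<Prod>j<p. E j N)"
        using expectation_inj_sum_joint[OF ind T p0, of N] elim unfolding E_def d_def by simp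
      then have "(\<integral>\<omega>. inj_sum N (joint_family Z N \<omega>) T \<partial>M N) = falling N d * (\<Prod>j<p. E j N) / (\<Prod>j<p. falling N (?w j))"
        using P0 by (simp add: field_simps)
      then show ?case
        using N0 by (simp add: tau0_eq_inj_sum R_def Y_def prod_dividef)
    qed
    then have main: "(\<lambda>N. \<integral>\<omega>. tau0 N (joint_family Z N \<omega>) T \<partial>M N) \<longlonglongrightarrow> L" if "Y \<longlonglongrightarrow> L" for L
      using Lim_transform_eventually[OF tendsto_mult[OF R1 that]] by simp
    have free: "free_product p T \<longleftrightarrow> (\<forall>J\<subseteq>K. \<not> is_core J)"
      using incidence_graph_tree_iff[OF K neK conK] False
      by (simp add: free_product_def reduced_graph_eq_incidence_graph K_def)
    show ?thesis
    proof (cases "free_product p T")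
      case True
      then have "(\<Sum>C\<in>K. card (verts C)) + 1 = card (\<Union>C\<in>K. verts C) + card K" and balC: "\<forall>C\<in>K. balanced C"
        using block_exponent(1)[OF K neK conK balK] free by auto
      then have ex: "(\<Sum>j<p. ?w j) + 1 = d + (\<Sum>j<p. card (?comps j))"
        using VK sumV cardK d_def by metis
      have "(\<lambda>N. E j N / of_nat N ^ card (?comps j)) \<longlonglongrightarrow> (\<Prod>C\<in>?comps j. \<tau> j (component_test_graph T C))" if j: "j < p" for j
      proof -
        have "balanced C" if "C \<in> components (graph (?T j))" for C
          using balC that j by (auto simp: K_def)
        from inj_sum_limit[OF ps rm[OF j] tight[OF j] conc[OF j] lim[OF j] family_test_graph_labelled[OF T] this]
        show ?thesis unfolding E_def component_test_graph_eq[of T _ j] family_test_graph_simps(1) .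
      qed
      then have "(\<lambda>N. \<Prod>j<p. E j N / of_nat N ^ card (?comps j)) \<longlonglongrightarrow>
          (\<Prod>j<p. \<Prod>C\<in>?comps j. \<tau> j (component_test_graph T C))"
        by (intro tendsto_prod) (simp only: lessThan_iff)
      moreover have "eventually (\<lambda>N. (\<Prod>j<p. E j N / of_nat N ^ card (?comps j)) = Y N) sequentially"
        using eventually_gt_at_top[of 0]
      proof eventually_elim
        case (elim N)
        have "(of_nat N :: complex) * (\<Prod>j<p. of_nat N ^ ?w j) = of_nat N ^ ((\<Sum>j<p. ?w j) + 1)"
          by (simp add: power_sum)
        also have "\<dots> = of_nat N ^ d * (\<Prod>j<p. of_nat N ^ card (?comps j))"
          unfolding ex by (simp add: power_add power_sum)
        finally show ?case using elim by (simp add: Y_def prod_dividef)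
      qed
      ultimately have "Y \<longlonglongrightarrow> (\<Prod>j<p. \<Prod>C\<in>?comps j. \<tau> j (component_test_graph T C))"
        using Lim_transform_eventually by fastforce
      then show ?thesis using main True by (simp add: traffic_free_product_def family_components_eq)
    next
      case nf: False
      define s where "s j = (\<Sum>C\<in>?comps j. real (leaves C)) / 2" for j
      have "\<exists>J\<subseteq>K. is_core J" using nf free by blast
      then have "2 * card (\<Union>C\<in>K. verts C) + (\<Sum>C\<in>K. leaves C) \<le> 2 * (\<Sum>C\<in>K. card (verts C))"
        by (rule block_exponent(2)[OF K neK conK balK])
      then have "2 * d + (\<Sum>j<p. \<Sum>C\<in>?comps j. leaves C) \<le> 2 * (\<Sum>j<p. ?w j)"
        using VK sumV sumK[of leaves] d_def by simp
      then have "real (2 * d + (\<Sum>j<p. \<Sum>C\<in>?comps j. leaves C)) \<le> real (2 * (\<Sum>j<p. ?w j))"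
        by (simp only: of_nat_le_iff)
      then have "2 * real d + (\<Sum>j<p. \<Sum>C\<in>?comps j. real (leaves C)) \<le> 2 * (\<Sum>j<p. real (?w j))"
        by (simp only: of_nat_sum of_nat_mult of_nat_add of_nat_numeral)
      then have ex: "real d + (\<Sum>j<p. s j) \<le> (\<Sum>j<p. real (?w j))"
        by (simp add: s_def sum_divide_distrib[symmetric])
      have "(\<lambda>N. \<Prod>j<p. cmod (E j N)) \<in> O(\<lambda>N. \<Prod>j<p. real N powr s j)"
      proof (rule landau_o.big_prod)
        fix j assume "j \<in> {..<p}"
        then have j: "j < p" by simp
        show "(\<lambda>N. cmod (E j N)) \<in> O(\<lambda>N. real N powr s j)"
          using inj_sum_bound[OF ps rm[OF j] tight[OF j] family_test_graph_labelled[OF T]] by (simp add: E_def s_def)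
      qed
      then obtain c where c: "c > 0" "eventually (\<lambda>N. norm (\<Prod>j<p. cmod (E j N)) \<le> c * norm (\<Prod>j<p. real N powr s j)) at_top"
        by (rule landau_o.bigE)
      have "Y \<longlonglongrightarrow> 0"
      proof (rule Lim_null_comparison)
        show "eventually (\<lambda>N. norm (Y N) \<le> c * inverse (real N)) sequentially"
          using c(2) eventually_ge_at_top[of 1]
        proof eventually_elim
          case (elim N)
          have N: "0 < real N" "1 \<le> real N" using elim by auto
          have "norm (Y N) = real N ^ d / (real N * (\<Prod>j<p. real N ^ ?w j)) * norm (\<Prod>j<p. cmod (E j N))"
            by (simp add: Y_def norm_mult norm_divide norm_power prod_norm[symmetric] abs_prod)
          also have "\<dots> \<le> real N ^ d / (real N * (\<Prod>j<p. real N ^ ?w j)) * (c * norm (\<Prod>j<p. real N powr s j))"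
            using elim(1) by (intro mult_left_mono divide_nonneg_nonneg mult_nonneg_nonneg prod_nonneg) simp_all
          also have "\<dots> = c * (real N powr (real d + (\<Sum>j<p. s j)) / real N powr (1 + (\<Sum>j<p. real (?w j))))"
          proof -
            have "norm (\<Prod>j<p. real N powr s j) = real N powr (\<Sum>j<p. s j)"
              using N by (simp add: powr_sum abs_prod)
            moreover have "real N ^ d = real N powr real d" using N by (simp add: powr_realpow)
            moreover have "real N * (\<Prod>j<p. real N ^ ?w j) = real N powr (1 + (\<Sum>j<p. real (?w j)))"
            proof -
              have "(\<Prod>j<p. real N ^ ?w j) = real N ^ (\<Sum>j<p. ?w j)" by (rule power_sum[symmetric])
              also have "\<dots> = real N powr (\<Sum>j<p. real (?w j))"
                using powr_realpow[OF N(1), of "\<Sum>j<p. ?w j"] by (simp only: of_nat_sum)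
              finally show ?thesis using N(1) by (simp only: powr_add powr_one)
            qed
            ultimately show ?thesis by (simp only: powr_add) (simp only: times_divide_eq_left times_divide_eq_right mult_ac)
          qed
          also have "\<dots> = c * real N powr (real d + (\<Sum>j<p. s j) - (1 + (\<Sum>j<p. real (?w j))))"
            by (simp only: powr_diff)
          also have "\<dots> \<le> c * real N powr (- 1)"
            using N ex c(1) by (intro mult_left_mono powr_mono) auto
          also have "\<dots> = c * inverse (real N)" using N by (simp add: powr_minus)
          finally show ?case .
        qed
        show "(\<lambda>N. c * inverse (real N)) \<longlonglongrightarrow> 0" using tendsto_mult_right_zero[OF lim_inverse_n] by blast
      qed
      then show ?thesis using main nf by (simp add: traffic_free_product_def)
    qed
  qed
qed

section \<open>Traces of words\<close>

text \<open>The directed cycle labelled by the word; the empty word gives a single vertex.\<close>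

definition word_graph :: "'i letter list \<Rightarrow> 'i test_graph" where
  "word_graph w = \<lparr> graph = \<lparr> verts = {..<max 1 (length w)}, arcs = {..<length w}, tail = (\<lambda>i. i),
     head = (\<lambda>i. Suc i mod length w) \<rparr>, label = (\<lambda>i. w ! i) \<rparr>"

lemma word_graph_simps [simp]:
  "verts (graph (word_graph w)) = {..<max 1 (length w)}" "arcs (graph (word_graph w)) = {..<length w}"
  "tail (graph (word_graph w)) = (\<lambda>i. i)" "head (graph (word_graph w)) = (\<lambda>i. Suc i mod length w)"
  "label (word_graph w) = (\<lambda>i. w ! i)"
  by (simp_all add: word_graph_def)

lemma word_graph_fin_digraph: "fin_digraph (graph (word_graph w))"
proof unfold_locales
  fix e assume "e \<in> arcs (graph (word_graph w))"
  then have "e < length w" by simp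
  moreover from this have "Suc e mod length w < length w" by (intro mod_less_divisor) linarith
  ultimately have "e < length w" "Suc e mod length w < length w" by simp_all
  then show "tail (graph (word_graph w)) e \<in> verts (graph (word_graph w))"
    "head (graph (word_graph w)) e \<in> verts (graph (word_graph w))" by auto
qed auto

lemma word_graph_connected: "connected (graph (word_graph w))"
proof -
  interpret fin_digraph "graph (word_graph w)" by (rule word_graph_fin_digraph)
  have "S = verts (graph (word_graph w))"
    if S: "S \<subseteq> verts (graph (word_graph w))" "S \<noteq> {}" "boundary (graph (word_graph w)) S = {}" for S
  proof (cases "w = []")
    case True
    then show ?thesis using S(1,2) by auto
  next
    case False
    let ?n = "length w"
    have step: "Suc i mod ?n \<in> S \<longleftrightarrow> i \<in> S" if "i < ?n" for i
      using S(3) that by (auto simp: boundary_def)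
    have all: "i \<in> S \<longleftrightarrow> 0 \<in> S" if "i < ?n" for i
      using that
    proof (induct i)
      case (Suc i)
      then show ?case using step[of i] by simp
    qed simp
    have mx: "max 1 ?n = ?n" using False by (cases w) auto
    obtain x where x: "x \<in> S" using S(2) by blast
    then have "x < ?n" using S(1) mx by auto
    then have "{..<?n} \<subseteq> S" using x all by blast
    then show ?thesis using S(1) mx by simp
  qed
  moreover have "0 \<in> verts (graph (word_graph w))" by simp
  ultimately show ?thesis unfolding connected_iff_boundary[OF wf_digraph] by blast
qed

text \<open>The head map of the cycle is a bijection.\<close>

lemma word_graph_balanced: "balanced (graph (word_graph w))"
proof -
  let ?n = "length w"
  let ?s = "\<lambda>i. Suc i mod ?n"
  have inj: "inj_on ?s {..<?n}"
    by (rule inj_onI) (auto simp: mod_Suc split: if_splits)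
  have "?s ` {..<?n} \<subseteq> {..<?n}" by (auto intro: mod_less_divisor)
  then have surj: "?s ` {..<?n} = {..<?n}" using inj endo_inj_surj[of "{..<?n}" ?s] by blast
  have "card {i \<in> {..<?n}. i \<in> S} = card {i \<in> {..<?n}. ?s i \<in> S}" for S
  proof -
    have "{i \<in> {..<?n}. i \<in> S} = ?s ` {i \<in> {..<?n}. ?s i \<in> S}"
    proof
      show "?s ` {i \<in> {..<?n}. ?s i \<in> S} \<subseteq> {i \<in> {..<?n}. i \<in> S}" using surj by blast
      show "{i \<in> {..<?n}. i \<in> S} \<subseteq> ?s ` {i \<in> {..<?n}. ?s i \<in> S}"
      proof
        fix x assume x: "x \<in> {i \<in> {..<?n}. i \<in> S}"
        then have "x \<in> ?s ` {..<?n}" using surj by simp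
        then obtain i where "i \<in> {..<?n}" "x = ?s i" by (rule imageE)
        then show "x \<in> ?s ` {i \<in> {..<?n}. ?s i \<in> S}" using x by blast
      qed
    qed
    then show ?thesis using card_image[OF inj_on_subset[OF inj], of "{i \<in> {..<?n}. ?s i \<in> S}"] by auto
  qed
  then show ?thesis by (simp add: balanced_def excess_def)
qed

lemma quotient_word_graph_cyclic:
  assumes "w \<in> lists (I \<times> UNIV)"
  shows "cyclic_test_graph I (quotient f (word_graph w))"
proof -
  have fin: "fin_digraph (graph (quotient f (word_graph w)))"
    by (rule quotient_fin_digraph[OF word_graph_fin_digraph])
  have con: "connected (graph (quotient f (word_graph w)))"
    by (rule quotient_connected[OF word_graph_fin_digraph word_graph_connected])
  have "fst (w ! e) \<in> I" if "e < length w" for e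
  proof -
    have "w ! e \<in> I \<times> UNIV" using assms nth_mem[OF that] by auto
    then show ?thesis by auto
  qed
  then show ?thesis
    using fin con euler_trail_iff_balanced[OF fin con] quotient_balanced[OF word_graph_balanced]
    by (auto simp: cyclic_test_graph_def test_graph_def)
qed

lemma letter_mat_carrier:
  assumes "A (fst l) \<in> carrier_mat N N" shows "letter_mat A l \<in> carrier_mat N N"
proof -
  have "mat_adjoint (A (fst l)) \<in> carrier_mat N N"
    using assms mat_of_rows_carrier(1)[of N "map conjugate (cols (A (fst l)))"] by (auto simp: mat_adjoint_def)
  then show ?thesis using assms by (simp add: letter_mat_def)
qed

lemma word_mat_carrier:
  assumes "\<forall>l\<in>set w. A (fst l) \<in> carrier_mat N N" shows "word_mat N A w \<in> carrier_mat N N"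
  using assms
proof (induct w)
  case (Cons l w)
  have "letter_mat A l \<in> carrier_mat N N" using Cons(2) by (intro letter_mat_carrier) simp
  moreover have "word_mat N A w \<in> carrier_mat N N" using Cons by simp
  ultimately show ?case by (simp add: word_mat_def)
qed (simp add: word_mat_def)

lemma word_mat_append_letter:
  assumes "\<forall>l\<in>set (w @ [l']). A (fst l) \<in> carrier_mat N N"
  shows "word_mat N A (w @ [l']) = word_mat N A w * letter_mat A l'"
  using assms
proof (induct w)
  case Nil
  then have "letter_mat A l' \<in> carrier_mat N N" using letter_mat_carrier by simp
  then show ?case by (simp add: word_mat_def)
next
  case (Cons l w)
  have "letter_mat A l \<in> carrier_mat N N" "letter_mat A l' \<in> carrier_mat N N"
    using Cons(2) by (auto intro!: letter_mat_carrier)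
  moreover have "word_mat N A w \<in> carrier_mat N N" using Cons(2) by (intro word_mat_carrier) auto
  moreover have "word_mat N A (w @ [l']) = word_mat N A w * letter_mat A l'" using Cons by simp
  ultimately show ?case by (simp add: word_mat_def)
qed

lemma sum_PiE_Suc:
  "(\<Sum>\<phi>\<in>{..<Suc n} \<rightarrow>\<^sub>E {..<N}. g \<phi>) = (\<Sum>c<N. \<Sum>\<phi>\<in>{..<n} \<rightarrow>\<^sub>E {..<N}. g (\<phi>(n := c)))"
proof -
  have "(\<Sum>c<N. \<Sum>\<phi>\<in>{..<n} \<rightarrow>\<^sub>E {..<N}. g (\<phi>(n := c))) =
      (\<Sum>(c, \<phi>)\<in>{..<N} \<times> ({..<n} \<rightarrow>\<^sub>E {..<N}). g (\<phi>(n := c)))"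
    by (simp add: sum.cartesian_product)
  also have "\<dots> = (\<Sum>\<phi>\<in>(\<lambda>(c, \<phi>). \<phi>(n := c)) ` ({..<N} \<times> ({..<n} \<rightarrow>\<^sub>E {..<N})). g \<phi>)"
  proof (rule sum.reindex_cong[symmetric])
    show "inj_on (\<lambda>(c, \<phi>). \<phi>(n := c)) ({..<N} \<times> ({..<n} \<rightarrow>\<^sub>E {..<N}))"
      by (rule inj_combinator) simp
  qed auto
  also have "(\<lambda>(c, \<phi>). \<phi>(n := c)) ` ({..<N} \<times> ({..<n} \<rightarrow>\<^sub>E {..<N})) = {..<Suc n} \<rightarrow>\<^sub>E {..<N}"
    by (simp add: PiE_insert_eq lessThan_Suc)
  finally show ?thesis by (rule sym)
qed

text \<open>The weight of the walk that follows \<open>\<phi>\<close> and ends in \<open>b\<close>. The endpoint is a separate argument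
  because taking it to be \<open>\<phi> 0\<close> closes the walk.\<close>

definition walk_weight :: "('i \<Rightarrow> complex mat) \<Rightarrow> 'i letter list \<Rightarrow> nat \<Rightarrow> (nat \<Rightarrow> nat) \<Rightarrow> complex" where
  "walk_weight A w b \<phi> =
     (\<Prod>i<length w. letter_mat A (w ! i) $$ (\<phi> i, if Suc i = length w then b else \<phi> (Suc i)))"

lemma walk_weight_append_letter:
  "walk_weight A (w @ [l]) b (\<phi>(length w := c)) = walk_weight A w c \<phi> * letter_mat A l $$ (c, b)"
proof -
  have "(\<Prod>i<length w. letter_mat A ((w @ [l]) ! i) $$
        ((\<phi>(length w := c)) i, if Suc i = Suc (length w) then b else (\<phi>(length w := c)) (Suc i))) =
      walk_weight A w c \<phi>"
    unfolding walk_weight_def by (intro prod.cong refl) (auto simp: nth_append)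
  then show ?thesis by (simp add: walk_weight_def)
qed

lemma word_mat_entry:
  assumes "w \<noteq> []" "\<forall>l\<in>set w. A (fst l) \<in> carrier_mat N N" "a < N" "b < N"
  shows "word_mat N A w $$ (a, b) =
    (\<Sum>\<phi>\<in>{..<length w} \<rightarrow>\<^sub>E {..<N}. if \<phi> 0 = a then walk_weight A w b \<phi> else 0)"
  using assms
proof (induct w arbitrary: b rule: rev_nonempty_induct)
  case (single l)
  have "letter_mat A l \<in> carrier_mat N N" using letter_mat_carrier[of A l N] single by simp
  then have "word_mat N A [l] $$ (a, b) = letter_mat A l $$ (a, b)" by (simp add: word_mat_def)
  moreover have "(\<Sum>\<phi>\<in>{..<Suc 0} \<rightarrow>\<^sub>E {..<N}. if \<phi> 0 = a then letter_mat A l $$ (\<phi> 0, b) else 0) =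
      letter_mat A l $$ (a, b)"
    unfolding sum_PiE_Suc lessThan_0 PiE_empty_domain using single.prems(2) by simp
  ultimately show ?case by (simp add: walk_weight_def cong: if_cong)
next
  case (snoc l w)
  let ?n = "length w"
  have cl: "letter_mat A l \<in> carrier_mat N N" using snoc.prems(1) by (intro letter_mat_carrier) simp
  have cw: "word_mat N A w \<in> carrier_mat N N" using snoc.prems(1) by (intro word_mat_carrier) simp
  have "word_mat N A (w @ [l]) $$ (a, b) = (\<Sum>c<N. word_mat N A w $$ (a, c) * letter_mat A l $$ (c, b))"
    using word_mat_append_letter[of w l A N] snoc.prems cl cw
    by (simp add: scalar_prod_def lessThan_atLeast0)
  also have "\<dots> = (\<Sum>c<N. \<Sum>\<phi>\<in>{..<?n} \<rightarrow>\<^sub>E {..<N}.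
      if (\<phi>(?n := c)) 0 = a then walk_weight A (w @ [l]) b (\<phi>(?n := c)) else 0)"
  proof (intro sum.cong refl)
    fix c assume "c \<in> {..<N}"
    then have "word_mat N A w $$ (a, c) =
        (\<Sum>\<phi>\<in>{..<?n} \<rightarrow>\<^sub>E {..<N}. if \<phi> 0 = a then walk_weight A w c \<phi> else 0)"
      using snoc.hyps(2)[of c] snoc.prems by simp
    then show "word_mat N A w $$ (a, c) * letter_mat A l $$ (c, b) = (\<Sum>\<phi>\<in>{..<?n} \<rightarrow>\<^sub>E {..<N}.
        if (\<phi>(?n := c)) 0 = a then walk_weight A (w @ [l]) b (\<phi>(?n := c)) else 0)"
      unfolding walk_weight_append_letter using snoc.hyps(1)
      by (simp only: sum_distrib_right) (intro sum.cong refl, simp)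
  qed
  finally show ?case by (simp only: sum_PiE_Suc length_append_singleton)
qed

lemma trace_word_mat:
  assumes "\<forall>l\<in>set w. A (fst l) \<in> carrier_mat N N"
  shows "(\<Sum>a<N. word_mat N A w $$ (a, a)) =
    (\<Sum>\<phi>\<in>verts (graph (word_graph w)) \<rightarrow>\<^sub>E {..<N}. edge_prod A (word_graph w) \<phi>)"
proof (cases "w = []")
  case True
  then show ?thesis by (simp add: word_mat_def edge_prod_def card_PiE)
next
  case False
  let ?n = "length w"
  have "(\<Sum>a<N. word_mat N A w $$ (a, a)) =
      (\<Sum>a<N. \<Sum>\<phi>\<in>{..<?n} \<rightarrow>\<^sub>E {..<N}. if \<phi> 0 = a then walk_weight A w a \<phi> else 0)"
    using word_mat_entry[OF False assms] by (intro sum.cong refl) auto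
  also have "\<dots> = (\<Sum>\<phi>\<in>{..<?n} \<rightarrow>\<^sub>E {..<N}. \<Sum>a<N. if \<phi> 0 = a then walk_weight A w a \<phi> else 0)"
    by (rule sum.swap)
  also have "\<dots> = (\<Sum>\<phi>\<in>{..<?n} \<rightarrow>\<^sub>E {..<N}. edge_prod A (word_graph w) \<phi>)"
  proof (intro sum.cong refl)
    fix \<phi> assume "\<phi> \<in> {..<?n} \<rightarrow>\<^sub>E {..<N}"
    then have "\<phi> 0 < N" using False by (auto simp: PiE_iff)
    then have "(\<Sum>a<N. if \<phi> 0 = a then walk_weight A w a \<phi> else 0) = walk_weight A w (\<phi> 0) \<phi>" by simp
    also have "\<dots> = edge_prod A (word_graph w) \<phi>"
      unfolding edge_prod_def walk_weight_def by (intro prod.cong) (auto simp: mod_Suc)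
    finally show "(\<Sum>a<N. if \<phi> 0 = a then walk_weight A w a \<phi> else 0) = edge_prod A (word_graph w) \<phi>" .
  qed
  moreover have "max 1 ?n = ?n" using False by (cases w) auto
  ultimately show ?thesis by simp
qed

lemma normalised_trace_word_mat:
  assumes "\<forall>l\<in>set w. A (fst l) \<in> carrier_mat N N"
  shows "(\<Sum>a<N. word_mat N A w $$ (a, a)) / of_nat N =
    (\<Sum>f\<in>partition_maps (verts (graph (word_graph w))). tau0 N A (quotient f (word_graph w)))"
  unfolding trace_word_mat[OF assms] sum_edge_prod_eq_quotients[OF word_graph_fin_digraph] tau0_eq_inj_sum
  by (rule sum_divide_distrib)

lemma expected_trace_limit:
  assumes ps: "\<And>N. prob_space (M N)" and A: "random_matrices I M A" and lim: "traffic_limit I M A \<tau>"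
    and P: "P \<in> star_polynomials I"
  shows "expected_trace M A P \<longlonglongrightarrow> (\<Sum>w\<in>Poly_Mapping.keys P. Poly_Mapping.lookup P w *
    (\<Sum>f\<in>partition_maps (verts (graph (word_graph w))). \<tau> (quotient f (word_graph w))))"
proof -
  let ?K = "Poly_Mapping.keys P"
  let ?F = "\<lambda>w :: 'b letter list. partition_maps (verts (graph (word_graph w)))"
  have w: "w \<in> lists (I \<times> UNIV)" if "w \<in> ?K" for w using P that by (auto simp: star_polynomials_def)
  have cyc: "cyclic_test_graph I (quotient f (word_graph w))" if "w \<in> ?K" for w f
    by (rule quotient_word_graph_cyclic[OF w[OF that]])
  have int: "integrable (M N) (\<lambda>\<omega>. tau0 N (A N \<omega>) (quotient f (word_graph w)))" if "w \<in> ?K" for w f N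
  proof -
    have "labelled_in I (quotient f (word_graph w))"
      using cyc[OF that, of f] by (simp add: cyclic_test_graph_def test_graph_def labelled_in_def)
    from all_moments_integrable[OF inj_sum_all_moments[OF ps A this]]
    show ?thesis unfolding tau0_eq_inj_sum by (intro integrable_divide)
  qed
  have "expected_trace M A P N = (\<Sum>w\<in>?K. Poly_Mapping.lookup P w *
      (\<Sum>f\<in>?F w. \<integral>\<omega>. tau0 N (A N \<omega>) (quotient f (word_graph w)) \<partial>M N))" for N
  proof -
    have "expected_trace M A P N = (\<integral>\<omega>. (\<Sum>w\<in>?K. Poly_Mapping.lookup P w *
        (\<Sum>f\<in>?F w. tau0 N (A N \<omega>) (quotient f (word_graph w)))) \<partial>M N)"
      unfolding expected_trace_def
    proof (rule Bochner_Integration.integral_cong[OF refl])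
      fix \<omega> assume \<omega>: "\<omega> \<in> space (M N)"
      have "(\<Sum>a<N. star_poly_mat N (A N \<omega>) P $$ (a, a)) =
          (\<Sum>a<N. \<Sum>w\<in>?K. Poly_Mapping.lookup P w * word_mat N (A N \<omega>) w $$ (a, a))"
        by (intro sum.cong refl) (simp add: star_poly_mat_def)
      also have "\<dots> = (\<Sum>w\<in>?K. Poly_Mapping.lookup P w * (\<Sum>a<N. word_mat N (A N \<omega>) w $$ (a, a)))"
        unfolding sum_distrib_left by (rule sum.swap)
      finally have "(1 / of_nat N) * (\<Sum>a<N. star_poly_mat N (A N \<omega>) P $$ (a, a)) =
          (\<Sum>w\<in>?K. Poly_Mapping.lookup P w * ((\<Sum>a<N. word_mat N (A N \<omega>) w $$ (a, a)) / of_nat N))"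
        by (simp only: sum_divide_distrib[of _ ?K] times_divide_eq_left mult_1_left times_divide_eq_right)
      also have "\<dots> = (\<Sum>w\<in>?K. Poly_Mapping.lookup P w *
          (\<Sum>f\<in>?F w. tau0 N (A N \<omega>) (quotient f (word_graph w))))"
      proof (intro sum.cong refl)
        fix w assume "w \<in> ?K"
        then have "w \<in> lists (I \<times> UNIV)" by (rule w)
        then have "\<forall>l\<in>set w. A N \<omega> (fst l) \<in> carrier_mat N N"
          using random_matricesD(1)[OF A _ \<omega>] by (auto simp: lists_eq_set subset_iff)
        from normalised_trace_word_mat[OF this]
        show "Poly_Mapping.lookup P w * ((\<Sum>a<N. word_mat N (A N \<omega>) w $$ (a, a)) / of_nat N) =
          Poly_Mapping.lookup P w * (\<Sum>f\<in>?F w. tau0 N (A N \<omega>) (quotient f (word_graph w)))" by (rule arg_cong)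
      qed
      finally show "(1 / of_nat N) * (\<Sum>a<N. star_poly_mat N (A N \<omega>) P $$ (a, a)) =
        (\<Sum>w\<in>?K. Poly_Mapping.lookup P w * (\<Sum>f\<in>?F w. tau0 N (A N \<omega>) (quotient f (word_graph w))))" .
    qed
    also have "\<dots> = (\<Sum>w\<in>?K. \<integral>\<omega>. Poly_Mapping.lookup P w *
        (\<Sum>f\<in>?F w. tau0 N (A N \<omega>) (quotient f (word_graph w))) \<partial>M N)"
      using int by (intro Bochner_Integration.integral_sum integrable_mult_right Bochner_Integration.integrable_sum)
    also have "\<dots> = (\<Sum>w\<in>?K. Poly_Mapping.lookup P w *
      (\<Sum>f\<in>?F w. \<integral>\<omega>. tau0 N (A N \<omega>) (quotient f (word_graph w)) \<partial>M N))"
    proof (intro sum.cong refl)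
      fix w assume "w \<in> ?K"
      then show "(\<integral>\<omega>. Poly_Mapping.lookup P w * (\<Sum>f\<in>?F w. tau0 N (A N \<omega>) (quotient f (word_graph w))) \<partial>M N) =
        Poly_Mapping.lookup P w * (\<Sum>f\<in>?F w. \<integral>\<omega>. tau0 N (A N \<omega>) (quotient f (word_graph w)) \<partial>M N)"
        using int by (simp add: Bochner_Integration.integral_sum)
    qed
    finally show ?thesis .
  qed
  moreover have "(\<lambda>N. \<Sum>w\<in>?K. Poly_Mapping.lookup P w *
      (\<Sum>f\<in>?F w. \<integral>\<omega>. tau0 N (A N \<omega>) (quotient f (word_graph w)) \<partial>M N)) \<longlonglongrightarrow>
    (\<Sum>w\<in>?K. Poly_Mapping.lookup P w * (\<Sum>f\<in>?F w. \<tau> (quotient f (word_graph w))))"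
    using lim cyc by (intro tendsto_sum tendsto_mult tendsto_const) (auto simp: traffic_limit_def)
  ultimately show ?thesis by presburger
qed

lemma expected_trace_limit_joint:
  assumes ind: "independent_traffic_families p q M Z \<tau>" and P: "P \<in> star_polynomials (joint_index p q)"
  shows "expected_trace M (joint_family Z) P \<longlonglongrightarrow> (\<Sum>w\<in>Poly_Mapping.keys P. Poly_Mapping.lookup P w *
    (\<Sum>f\<in>partition_maps (verts (graph (word_graph w))). traffic_free_product p \<tau> (quotient f (word_graph w))))"
proof (rule expected_trace_limit[OF _ _ traffic_limit_joint[OF ind] P])
  show "prob_space (M N)" for N using ind by (simp add: independent_traffic_families_def)
  show "random_matrices (joint_index p q) M (joint_family Z)"
    using ind by (intro random_matrices_joint) (simp add: independent_traffic_families_def)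
qed

theorem theorem2p3:
  fixes p :: nat and q :: "nat \<Rightarrow> nat"
    and M :: "nat \<Rightarrow> 'w measure" and Z :: "nat \<Rightarrow> ('w, nat) matrix_family"
    and M' :: "nat \<Rightarrow> 'v measure" and Z' :: "nat \<Rightarrow> ('v, nat) matrix_family"
    and \<tau> :: "nat \<Rightarrow> nat test_graph \<Rightarrow> complex"
  assumes "independent_traffic_families p q M Z \<tau>"
  shows "traffic_limit (joint_index p q) M (joint_family Z) (traffic_free_product p \<tau>) \<and>
    (\<forall>P\<in>star_polynomials (joint_index p q).
       convergent (expected_trace M (joint_family Z) P)) \<and>
    (independent_traffic_families p q M' Z' \<tau> \<longrightarrow>
       (\<forall>P\<in>star_polynomials (joint_index p q).
          lim (expected_trace M (joint_family Z) P) =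
          lim (expected_trace M' (joint_family Z') P)))"
proof (intro conjI ballI impI)
  show "traffic_limit (joint_index p q) M (joint_family Z) (traffic_free_product p \<tau>)"
    by (rule traffic_limit_joint[OF assms])
  fix P assume P: "P \<in> star_polynomials (joint_index p q)"
  show "convergent (expected_trace M (joint_family Z) P)"
    by (rule convergentI[OF expected_trace_limit_joint[OF assms P]])
  assume "independent_traffic_families p q M' Z' \<tau>"
  from expected_trace_limit_joint[OF assms P] expected_trace_limit_joint[OF this P]
  show "lim (expected_trace M (joint_family Z) P) = lim (expected_trace M' (joint_family Z') P)"
    by (simp only: limI)
qed

end
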